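(* Let $H$ be a finite-dimensional cocommutative Hopf algebra over a field $k$ and $\omega:H\otimes H\otimes H\to k$ a normalized $3$-cocycle. Then $D^\omega(H)=H^*\#_\sigma H$ is a quasitriangular quasi-Hopf algebra, i.e. there exist a comultiplication, counit, reassociator, antipode (with its distinguished elements $\alpha,\beta$) and an $R$-matrix on the algebra $H^*\#_\sigma H$ making it a quasitriangular quasi-Hopf algebra.
   Context: $H$ is a finite-dimensional cocommutative Hopf algebra over $k$ with antipode $S$; Sweedler notation is used for iterated comultiplications. $H^*$ is the dual commutative Hopf algebra, with unit $\varepsilon$ and product $(\varphi\psi)(h)=\varphi(h_1)\psi(h_2)$. Regular actions: $(h\rightharpoonup\varphi)(a)=\varphi(ah)$, $(\varphi\leftharpoonup h)(a)=\varphi(ha)$. A normalized $3$-cocycle is a convolution invertible linear map $\omega:H\otimes H\otimes H\to k$ with $\omega(x_1,y_1,z_1t_1)\,\omega(x_2y_2,z_2,t_2)=\omega(y_1,z_1,t_1)\,\omega(x_1,y_2z_2,t_2)\,\omega(x_2,y_3,z_3)$ and $\omega(1,x,y)=\omega(x,1,y)=\omega(x,y,1)=\varepsilon(x)\varepsilon(y)$ for all $x,y,z,t\in H$; $\omega^{-1}$ is its convolution inverse. Put $g\triangleleft x=S(x_1)gx_2$; $\theta(g;x,y)=\omega(g_1,x_1,y_1)\,\omega(x_2,y_2,g_2\triangleleft(x_3y_3))\,\omega^{-1}(x_4,g_3\triangleleft x_5,y_4)$; $\sigma:H\otimes H\to H^*$, $\sigma(x,y)(g)=\theta(g;x,y)$.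 $D^\omega(H)=H^*\#_\sigma H$ is the vector space $H^*\otimes H$ (elements written $\varphi\# h$) with unit $\varepsilon\#1_H$ and associative product $(\varphi\#h)(\varphi'\#h')=\varphi\,(h_1\rightharpoonup\varphi'\leftharpoonup S(h_2))\,\sigma(h_3,h'_1)\#h_4h'_2$. A quasi-bialgebra $(A,\Delta,\varepsilon,\Phi)$ consists of an associative unital algebra $A$, algebra maps $\Delta:A\to A\otimes A$, $\Delta(h)=h_1\otimes h_2$, and $\varepsilon:A\to k$, and an invertible $\Phi=X^1\otimes X^2\otimes X^3\in A^{\otimes 3}$ with inverse $\Phi^{-1}=x^1\otimes x^2\otimes x^3$, such that $(\mathrm{id}\otimes\Delta)(\Delta(h))=\Phi(\Delta\otimes\mathrm{id})(\Delta(h))\Phi^{-1}$, $(\mathrm{id}\otimes\varepsilon)\Delta(h)=h=(\varepsilon\otimes\mathrm{id})\Delta(h)$, $(1\otimes\Phi)(\mathrm{id}\otimes\Delta\otimes\mathrm{id})(\Phi)(\Phi\otimes1)=(\mathrm{id}\otimes\mathrm{id}\otimes\Delta)(\Phi)(\Delta\otimes\mathrm{id}\otimes\mathrm{id})(\Phi)$, and $(\mathrm{id}\otimes\varepsilon\otimes\mathrm{id})(\Phi)=1\otimes1$. It is a quasi-Hopf algebra if there are an algebra anti-morphism $S:A\to A$ and $\alpha,\beta\in A$ with $S(h_1)\alpha h_2=\varepsilon(h)\alpha$, $h_1\beta S(h_2)=\varepsilon(h)\beta$, $X^1\beta S(X^2)\alpha X^3=1$ and $S(x^1)\alpha x^2\beta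 S(x^3)=1$. It is quasitriangular if there is an invertible $R=R^1\otimes R^2\in A\otimes A$ with (writing $r^1\otimes r^2$ for a second copy of $R$, and $Y$, $y$ for second copies of $\Phi$, $\Phi^{-1}$) $\Delta^{\rm cop}(h)R=R\Delta(h)$, where $\Delta^{\rm cop}(h)=h_2\otimes h_1$; $(\Delta\otimes\mathrm{id})(R)=X^2R^1x^1Y^1\otimes X^3x^3r^1Y^2\otimes X^1R^2x^2r^2Y^3$; $(\mathrm{id}\otimes\Delta)(R)=x^3R^1X^2r^1y^1\otimes x^1X^1r^2y^2\otimes x^2R^2X^3y^3$; and $\varepsilon(R^1)R^2=\varepsilon(R^2)R^1=1$. *)

theory Defs
  imports "HOL-Analysis.Cartesian_Space"
begin

text \<open>
  A finite-dimensional vector space is a type with a scalar multiplication \<open>scale\<close> and a basis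
  \<open>b\<close> indexed by a finite type.  The tensor powers of the space are modelled by the arrays of
  coordinates with respect to the product basis; \<open>tensor2 x y\<close> is the pure tensor, and
  \<open>lift2 s t F\<close> is the value at \<open>t\<close> of the linear map, into a space with scalar multiplication
  \<open>s\<close>, induced by the bilinear map \<open>F\<close>.  Hence \<open>lift2 s t (\<lambda>x y. F x y)\<close> is what one writes as
  \<open>F(t\<^sup>1, t\<^sup>2)\<close> for \<open>t = t\<^sup>1 \<otimes> t\<^sup>2\<close> (summation understood).  Three and four factors are treated
  in the same way.
\<close>

locale fd_space = finite_dimensional_vector_space scale "range b"
  for scale :: "'k::field \<Rightarrow> 'a::ab_group_add \<Rightarrow> 'a" and b :: "'n::finite \<Rightarrow> 'a" +
  assumes inj_b: "inj b"
begin

definition coord :: "'n \<Rightarrow> 'a \<Rightarrow> 'k" where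
  "coord i x = representation (range b) x (b i)"

definition tensor2 :: "'a \<Rightarrow> 'a \<Rightarrow> 'k ^ ('n \<times> 'n)" where
  "tensor2 x y = (\<chi> p. case p of (i, j) \<Rightarrow> coord i x * coord j y)"

definition tensor3 :: "'a \<Rightarrow> 'a \<Rightarrow> 'a \<Rightarrow> 'k ^ ('n \<times> 'n \<times> 'n)" where
  "tensor3 x y z = (\<chi> p. case p of (i, j, l) \<Rightarrow> coord i x * coord j y * coord l z)"

definition tensor4 :: "'a \<Rightarrow> 'a \<Rightarrow> 'a \<Rightarrow> 'a \<Rightarrow> 'k ^ ('n \<times> 'n \<times> 'n \<times> 'n)" where
  "tensor4 x y z w =
     (\<chi> p. case p of (i, j, l, m) \<Rightarrow> coord i x * coord j y * coord l z * coord m w)"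

definition lift2 ::
    "('k \<Rightarrow> 'v::ab_group_add \<Rightarrow> 'v) \<Rightarrow> 'k ^ ('n \<times> 'n) \<Rightarrow> ('a \<Rightarrow> 'a \<Rightarrow> 'v) \<Rightarrow> 'v" where
  "lift2 s t F = (\<Sum>(i, j)\<in>UNIV. s (t $ (i, j)) (F (b i) (b j)))"

definition lift3 ::
    "('k \<Rightarrow> 'v::ab_group_add \<Rightarrow> 'v) \<Rightarrow> 'k ^ ('n \<times> 'n \<times> 'n) \<Rightarrow> ('a \<Rightarrow> 'a \<Rightarrow> 'a \<Rightarrow> 'v) \<Rightarrow> 'v" where
  "lift3 s t F = (\<Sum>(i, j, l)\<in>UNIV. s (t $ (i, j, l)) (F (b i) (b j) (b l)))"

definition lift4 ::
    "('k \<Rightarrow> 'v::ab_group_add \<Rightarrow> 'v) \<Rightarrow> 'k ^ ('n \<times> 'n \<times> 'n \<times> 'n) \<Rightarrow>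
     ('a \<Rightarrow> 'a \<Rightarrow> 'a \<Rightarrow> 'a \<Rightarrow> 'v) \<Rightarrow> 'v" where
  "lift4 s t F = (\<Sum>(i, j, l, m)\<in>UNIV. s (t $ (i, j, l, m)) (F (b i) (b j) (b l) (b m)))"

lemma sum_coord: "(\<Sum>i\<in>UNIV. scale (coord i x) (b i)) = x"
proof -
  have "(\<Sum>v\<in>range b. scale (representation (range b) x v) v) = x"
    by (rule sum_representation_eq)
       (auto simp: independent_Basis span_Basis finite_Basis)
  then show ?thesis
    by (simp add: sum.reindex[OF inj_b] coord_def)
qed

lemma linear_expand:
  assumes "Vector_Spaces.linear scale s f"
  shows "f x = (\<Sum>i\<in>UNIV. s (coord i x) (f (b i)))"
proof -
  interpret l: Vector_Spaces.linear scale s f by fact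
  have "f x = f (\<Sum>i\<in>UNIV. scale (coord i x) (b i))" by (simp add: sum_coord)
  also have "\<dots> = (\<Sum>i\<in>UNIV. s (coord i x) (f (b i)))" by (simp add: l.sum l.scale)
  finally show ?thesis .
qed

text \<open>The universal property of the tensor square.\<close>

lemma lift2_tensor2:
  assumes l1: "\<And>y. Vector_Spaces.linear scale s (\<lambda>x. F x y)"
    and l2: "\<And>x. Vector_Spaces.linear scale s (F x)"
  shows "lift2 s (tensor2 x y) F = F x y"
proof -
  interpret l: Vector_Spaces.linear scale s "F 0" by (rule l2)
  have "F x y = (\<Sum>i\<in>UNIV. s (coord i x) (\<Sum>j\<in>UNIV. s (coord j y) (F (b i) (b j))))"
    unfolding linear_expand[OF l1, of x y] by (simp flip: linear_expand[OF l2])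
  also have "\<dots> = (\<Sum>i\<in>UNIV. \<Sum>j\<in>UNIV. s (coord i x * coord j y) (F (b i) (b j)))"
    by (simp add: l.vs2.scale_sum_right)
  also have "\<dots> = lift2 s (tensor2 x y) F"
    by (simp add: lift2_def tensor2_def sum.cartesian_product flip: UNIV_Times_UNIV)
  finally show ?thesis ..
qed

lemma coord_b: "coord i (b j) = (if i = j then 1 else 0)"
  using inj_b by (auto simp: coord_def representation_basis independent_Basis inj_eq)

lemma tensor2_spans: "lift2 (*s) t tensor2 = t"
proof -
  have *: "tensor2 (b i) (b j) = axis (i, j) 1" for i j
    by (auto simp: tensor2_def axis_def vec_eq_iff coord_b)
  have "lift2 (*s) t tensor2 = (\<Sum>p\<in>UNIV. (t $ p) *s axis p 1)"
    by (auto simp: lift2_def * intro!: sum.cong)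
  also have "\<dots> = t" by (rule basis_expansion)
  finally show ?thesis .
qed

end

locale fd_algebra = fd_space scale b
  for scale :: "'k::field \<Rightarrow> 'a::ab_group_add \<Rightarrow> 'a" and b :: "'n::finite \<Rightarrow> 'a" +
  fixes mult :: "'a \<Rightarrow> 'a \<Rightarrow> 'a" (infixl "\<odot>" 70)
    and one :: 'a
  assumes mult_linear_left: "Vector_Spaces.linear scale scale (\<lambda>x. x \<odot> y)"
    and mult_linear_right: "Vector_Spaces.linear scale scale (\<lambda>y. x \<odot> y)"
    and mult_assoc: "(x \<odot> y) \<odot> z = x \<odot> (y \<odot> z)"
    and one_left: "one \<odot> x = x"
    and one_right: "x \<odot> one = x"
begin

definition mult2 :: "'k ^ ('n \<times> 'n) \<Rightarrow> 'k ^ ('n \<times> 'n) \<Rightarrow> 'k ^ ('n \<times> 'n)" (infixl "\<odot>\<^sub>2" 70) where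
  "t \<odot>\<^sub>2 u = lift2 (*s) t (\<lambda>x1 x2. lift2 (*s) u (\<lambda>y1 y2. tensor2 (x1 \<odot> y1) (x2 \<odot> y2)))"

definition mult3 ::
    "'k ^ ('n \<times> 'n \<times> 'n) \<Rightarrow> 'k ^ ('n \<times> 'n \<times> 'n) \<Rightarrow> 'k ^ ('n \<times> 'n \<times> 'n)" (infixl "\<odot>\<^sub>3" 70) where
  "t \<odot>\<^sub>3 u = lift3 (*s) t (\<lambda>x1 x2 x3. lift3 (*s) u (\<lambda>y1 y2 y3.
     tensor3 (x1 \<odot> y1) (x2 \<odot> y2) (x3 \<odot> y3)))"

definition mult4 ::
    "'k ^ ('n \<times> 'n \<times> 'n \<times> 'n) \<Rightarrow> 'k ^ ('n \<times> 'n \<times> 'n \<times> 'n) \<Rightarrow> 'k ^ ('n \<times> 'n \<times> 'n \<times> 'n)"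
    (infixl "\<odot>\<^sub>4" 70) where
  "t \<odot>\<^sub>4 u = lift4 (*s) t (\<lambda>x1 x2 x3 x4. lift4 (*s) u (\<lambda>y1 y2 y3 y4.
     tensor4 (x1 \<odot> y1) (x2 \<odot> y2) (x3 \<odot> y3) (x4 \<odot> y4)))"

definition inverses2 :: "'k ^ ('n \<times> 'n) \<Rightarrow> 'k ^ ('n \<times> 'n) \<Rightarrow> bool" where
  "inverses2 t u \<longleftrightarrow> t \<odot>\<^sub>2 u = tensor2 one one \<and> u \<odot>\<^sub>2 t = tensor2 one one"

definition inverses3 :: "'k ^ ('n \<times> 'n \<times> 'n) \<Rightarrow> 'k ^ ('n \<times> 'n \<times> 'n) \<Rightarrow> bool" where
  "inverses3 t u \<longleftrightarrow> t \<odot>\<^sub>3 u = tensor3 one one one \<and> u \<odot>\<^sub>3 t = tensor3 one one one"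

end

text \<open>An algebra with algebra maps \<open>\<Delta> : A \<rightarrow> A \<otimes> A\<close> and \<open>\<epsilon> : A \<rightarrow> k\<close> such that \<open>\<epsilon>\<close> is a counit for
  \<open>\<Delta>\<close>; no coassociativity yet.\<close>

locale fd_algebra_comult = fd_algebra scale b mult one
  for scale :: "'k::field \<Rightarrow> 'a::ab_group_add \<Rightarrow> 'a" and b :: "'n::finite \<Rightarrow> 'a"
    and mult :: "'a \<Rightarrow> 'a \<Rightarrow> 'a" (infixl "\<odot>" 70) and one :: 'a +
  fixes \<Delta> :: "'a \<Rightarrow> 'k ^ ('n \<times> 'n)"
    and \<epsilon> :: "'a \<Rightarrow> 'k"
  assumes comult_linear: "Vector_Spaces.linear scale (*s) \<Delta>"
    and comult_mult: "\<Delta> (x \<odot> y) = \<Delta> x \<odot>\<^sub>2 \<Delta> y"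
    and comult_one: "\<Delta> one = tensor2 one one"
    and counit_linear: "Vector_Spaces.linear scale (*) \<epsilon>"
    and counit_mult: "\<epsilon> (x \<odot> y) = \<epsilon> x * \<epsilon> y"
    and counit_one: "\<epsilon> one = 1"
    and counit_right: "lift2 scale (\<Delta> x) (\<lambda>x1 x2. scale (\<epsilon> x2) x1) = x"
    and counit_left: "lift2 scale (\<Delta> x) (\<lambda>x1 x2. scale (\<epsilon> x1) x2) = x"


subsection \<open>Cocommutative Hopf algebras\<close>

locale hopf_algebra = fd_algebra_comult scale b mult one \<Delta> \<epsilon>
  for scale :: "'k::field \<Rightarrow> 'a::ab_group_add \<Rightarrow> 'a" and b :: "'n::finite \<Rightarrow> 'a"
    and mult :: "'a \<Rightarrow> 'a \<Rightarrow> 'a" (infixl "\<odot>" 70) and one :: 'a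
    and \<Delta> :: "'a \<Rightarrow> 'k ^ ('n \<times> 'n)" and \<epsilon> :: "'a \<Rightarrow> 'k" +
  fixes S :: "'a \<Rightarrow> 'a"
  assumes coassoc:
      "lift2 (*s) (\<Delta> x) (\<lambda>x1 y. lift2 (*s) (\<Delta> y) (\<lambda>x2 x3. tensor3 x1 x2 x3)) =
       lift2 (*s) (\<Delta> x) (\<lambda>y x3. lift2 (*s) (\<Delta> y) (\<lambda>x1 x2. tensor3 x1 x2 x3))"
    and antipode_linear: "Vector_Spaces.linear scale scale S"
    and antipode_left: "lift2 scale (\<Delta> x) (\<lambda>x1 x2. S x1 \<odot> x2) = scale (\<epsilon> x) one"
    and antipode_right: "lift2 scale (\<Delta> x) (\<lambda>x1 x2. x1 \<odot> S x2) = scale (\<epsilon> x) one"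
begin

text \<open>Sweedler notation: \<open>sw3 s x (\<lambda>x1 x2 x3. F x1 x2 x3)\<close> is \<open>F(x\<^sub>1, x\<^sub>2, x\<^sub>3)\<close> for a multilinear
  \<open>F\<close> with values in a space with scalar multiplication \<open>s\<close>.\<close>

definition sw2 :: "('k \<Rightarrow> 'v::ab_group_add \<Rightarrow> 'v) \<Rightarrow> 'a \<Rightarrow> ('a \<Rightarrow> 'a \<Rightarrow> 'v) \<Rightarrow> 'v" where
  "sw2 s x F = lift2 s (\<Delta> x) F"

definition sw3 :: "('k \<Rightarrow> 'v::ab_group_add \<Rightarrow> 'v) \<Rightarrow> 'a \<Rightarrow> ('a \<Rightarrow> 'a \<Rightarrow> 'a \<Rightarrow> 'v) \<Rightarrow> 'v" where
  "sw3 s x F = sw2 s x (\<lambda>x1 y. sw2 s y (F x1))"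

definition sw4 ::
    "('k \<Rightarrow> 'v::ab_group_add \<Rightarrow> 'v) \<Rightarrow> 'a \<Rightarrow> ('a \<Rightarrow> 'a \<Rightarrow> 'a \<Rightarrow> 'a \<Rightarrow> 'v) \<Rightarrow> 'v" where
  "sw4 s x F = sw2 s x (\<lambda>x1 y. sw3 s y (F x1))"

definition sw5 ::
    "('k \<Rightarrow> 'v::ab_group_add \<Rightarrow> 'v) \<Rightarrow> 'a \<Rightarrow> ('a \<Rightarrow> 'a \<Rightarrow> 'a \<Rightarrow> 'a \<Rightarrow> 'a \<Rightarrow> 'v) \<Rightarrow> 'v" where
  "sw5 s x F = sw2 s x (\<lambda>x1 y. sw4 s y (F x1))"

text \<open>Linear maps \<open>H \<otimes> H \<otimes> H \<rightarrow> k\<close> are given as trilinear maps.\<close>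

definition trilinear :: "('a \<Rightarrow> 'a \<Rightarrow> 'a \<Rightarrow> 'k) \<Rightarrow> bool" where
  "trilinear f \<longleftrightarrow>
     (\<forall>y z. Vector_Spaces.linear scale (*) (\<lambda>x. f x y z)) \<and>
     (\<forall>x z. Vector_Spaces.linear scale (*) (\<lambda>y. f x y z)) \<and>
     (\<forall>x y. Vector_Spaces.linear scale (*) (\<lambda>z. f x y z))"

definition conv3 ::
    "('a \<Rightarrow> 'a \<Rightarrow> 'a \<Rightarrow> 'k) \<Rightarrow> ('a \<Rightarrow> 'a \<Rightarrow> 'a \<Rightarrow> 'k) \<Rightarrow> 'a \<Rightarrow> 'a \<Rightarrow> 'a \<Rightarrow> 'k" where
  "conv3 f g x y z = sw2 (*) x (\<lambda>x1 x2. sw2 (*) y (\<lambda>y1 y2. sw2 (*) z (\<lambda>z1 z2.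
     f x1 y1 z1 * g x2 y2 z2)))"

definition conv_inverse3 :: "('a \<Rightarrow> 'a \<Rightarrow> 'a \<Rightarrow> 'k) \<Rightarrow> ('a \<Rightarrow> 'a \<Rightarrow> 'a \<Rightarrow> 'k) \<Rightarrow> bool" where
  "conv_inverse3 f g \<longleftrightarrow> trilinear g \<and>
     (\<forall>x y z. conv3 f g x y z = \<epsilon> x * \<epsilon> y * \<epsilon> z) \<and>
     (\<forall>x y z. conv3 g f x y z = \<epsilon> x * \<epsilon> y * \<epsilon> z)"

text \<open>The operations on \<open>H\<^sup>* = {\<phi>. Vector_Spaces.linear scale (*) \<phi>}\<close>: the product, and the actions
  \<open>(h \<rightharpoonup> \<phi>)(a) = \<phi>(ah)\<close> and \<open>(\<phi> \<leftharpoonup> h)(a) = \<phi>(ha)\<close>.\<close>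

definition dual_mult :: "('a \<Rightarrow> 'k) \<Rightarrow> ('a \<Rightarrow> 'k) \<Rightarrow> 'a \<Rightarrow> 'k" (infixl "\<star>" 70) where
  "(\<phi> \<star> \<psi>) h = sw2 (*) h (\<lambda>h1 h2. \<phi> h1 * \<psi> h2)"

definition left_hit :: "'a \<Rightarrow> ('a \<Rightarrow> 'k) \<Rightarrow> 'a \<Rightarrow> 'k" (infixr "\<rightharpoonup>" 75) where
  "(h \<rightharpoonup> \<phi>) a = \<phi> (a \<odot> h)"

definition right_hit :: "('a \<Rightarrow> 'k) \<Rightarrow> 'a \<Rightarrow> 'a \<Rightarrow> 'k" (infixl "\<leftharpoonup>" 76) where
  "(\<phi> \<leftharpoonup> h) a = \<phi> (h \<odot> a)"

definition conj_act :: "'a \<Rightarrow> 'a \<Rightarrow> 'a" (infixl "\<lhd>" 71) where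
  "g \<lhd> x = sw2 scale x (\<lambda>x1 x2. S x1 \<odot> g \<odot> x2)"

end

locale cocommutative_hopf_algebra = hopf_algebra scale b mult one \<Delta> \<epsilon> S
  for scale :: "'k::field \<Rightarrow> 'a::ab_group_add \<Rightarrow> 'a" and b :: "'n::finite \<Rightarrow> 'a"
    and mult :: "'a \<Rightarrow> 'a \<Rightarrow> 'a" (infixl "\<odot>" 70) and one :: 'a
    and \<Delta> :: "'a \<Rightarrow> 'k ^ ('n \<times> 'n)" and \<epsilon> :: "'a \<Rightarrow> 'k" and S :: "'a \<Rightarrow> 'a" +
  assumes cocommutative: "lift2 (*s) (\<Delta> x) (\<lambda>x1 x2. tensor2 x2 x1) = \<Delta> x"


subsection \<open>The algebra \<open>D\<^sup>\<omega>(H)\<close>\<close>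

locale normalized_3cocycle = cocommutative_hopf_algebra scale b mult one \<Delta> \<epsilon> S
  for scale :: "'k::field \<Rightarrow> 'a::ab_group_add \<Rightarrow> 'a" and b :: "'n::finite \<Rightarrow> 'a"
    and mult :: "'a \<Rightarrow> 'a \<Rightarrow> 'a" (infixl "\<odot>" 70) and one :: 'a
    and \<Delta> :: "'a \<Rightarrow> 'k ^ ('n \<times> 'n)" and \<epsilon> :: "'a \<Rightarrow> 'k" and S :: "'a \<Rightarrow> 'a" +
  fixes \<omega> :: "'a \<Rightarrow> 'a \<Rightarrow> 'a \<Rightarrow> 'k"
  assumes omega_trilinear: "trilinear \<omega>"
    and omega_invertible: "\<exists>\<omega>'. conv_inverse3 \<omega> \<omega>'"
    and omega_cocycle:
      "sw2 (*) x (\<lambda>x1 x2. sw2 (*) y (\<lambda>y1 y2. sw2 (*) z (\<lambda>z1 z2. sw2 (*) t (\<lambda>t1 t2.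
         \<omega> x1 y1 (z1 \<odot> t1) * \<omega> (x2 \<odot> y2) z2 t2)))) =
       sw2 (*) x (\<lambda>x1 x2. sw3 (*) y (\<lambda>y1 y2 y3. sw3 (*) z (\<lambda>z1 z2 z3. sw2 (*) t (\<lambda>t1 t2.
         \<omega> y1 z1 t1 * \<omega> x1 (y2 \<odot> z2) t2 * \<omega> x2 y3 z3))))"
    and omega_one1: "\<omega> one x y = \<epsilon> x * \<epsilon> y"
    and omega_one2: "\<omega> x one y = \<epsilon> x * \<epsilon> y"
    and omega_one3: "\<omega> x y one = \<epsilon> x * \<epsilon> y"
begin

definition omega_inv :: "'a \<Rightarrow> 'a \<Rightarrow> 'a \<Rightarrow> 'k" where
  "omega_inv = (THE \<omega>'. conv_inverse3 \<omega> \<omega>')"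

definition theta :: "'a \<Rightarrow> 'a \<Rightarrow> 'a \<Rightarrow> 'k" where
  "theta g x y =
     sw3 (*) g (\<lambda>g1 g2 g3. sw5 (*) x (\<lambda>x1 x2 x3 x4 x5. sw4 (*) y (\<lambda>y1 y2 y3 y4.
       \<omega> g1 x1 y1 * \<omega> x2 y2 (g2 \<lhd> (x3 \<odot> y3)) * omega_inv x4 (g3 \<lhd> x5) y4)))"

definition sigma :: "'a \<Rightarrow> 'a \<Rightarrow> 'a \<Rightarrow> 'k" where
  "sigma x y g = theta g x y"

text \<open>The space \<open>H\<^sup>* \<otimes> H\<close> in coordinates with respect to the basis \<open>b\<close> of \<open>H\<close> and its dual basis
  \<open>coord\<close> of \<open>H\<^sup>*\<close> (\<open>\<phi> (b i)\<close> is the \<open>i\<close>-th coordinate of \<open>\<phi>\<close>).\<close>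

definition smash :: "('a \<Rightarrow> 'k) \<Rightarrow> 'a \<Rightarrow> 'k ^ ('n \<times> 'n)" (infix "\<sharp>" 65) where
  "\<phi> \<sharp> h = (\<chi> p. case p of (i, j) \<Rightarrow> \<phi> (b i) * coord j h)"

text \<open>The product \<open>(\<phi> \<sharp> h)(\<phi>' \<sharp> h')\<close>.\<close>

definition smash_mult :: "('a \<Rightarrow> 'k) \<Rightarrow> 'a \<Rightarrow> ('a \<Rightarrow> 'k) \<Rightarrow> 'a \<Rightarrow> 'k ^ ('n \<times> 'n)" where
  "smash_mult \<phi> h \<phi>' h' =
     sw4 (*s) h (\<lambda>h1 h2 h3 h4. sw2 (*s) h' (\<lambda>h1' h2'.
       (\<phi> \<star> (h1 \<rightharpoonup> \<phi>' \<leftharpoonup> S h2) \<star> sigma h3 h1') \<sharp> (h4 \<odot> h2')))"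

text \<open>Its bilinear extension to \<open>H\<^sup>* \<otimes> H\<close>; see \<open>D_mult_smash\<close> below.\<close>

definition D_mult :: "'k ^ ('n \<times> 'n) \<Rightarrow> 'k ^ ('n \<times> 'n) \<Rightarrow> 'k ^ ('n \<times> 'n)" where
  "D_mult u v = (\<Sum>(i, j)\<in>UNIV. \<Sum>(l, m)\<in>UNIV.
     (u $ (i, j) * v $ (l, m)) *s smash_mult (coord i) (b j) (coord l) (b m))"

lemma lift2_linear:
  assumes "vector_space s"
  shows "Vector_Spaces.linear scale s (\<lambda>x. lift2 s (\<Delta> x) F)"
proof -
  interpret s: vector_space s by fact
  interpret d: Vector_Spaces.linear scale "(*s)" \<Delta> by (rule comult_linear)
  have "lift2 s (\<Delta> (x + y)) F = lift2 s (\<Delta> x) F + lift2 s (\<Delta> y) F" for x y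
    by (simp only: lift2_def d.add vector_add_component s.scale_left_distrib case_prod_unfold sum.distrib)
  moreover have "lift2 s (\<Delta> (scale c x)) F = s c (lift2 s (\<Delta> x) F)" for c x
    by (simp only: lift2_def d.scale vector_smult_component s.scale_sum_right case_prod_unfold s.scale_scale)
  ultimately show ?thesis
    by unfold_locales
qed

lemma dual_expand:
  assumes "Vector_Spaces.linear scale (*) \<phi>"
  shows "\<phi> = (\<lambda>a. \<Sum>i\<in>UNIV. \<phi> (b i) * coord i a)"
proof
  fix a
  show "\<phi> a = (\<Sum>i\<in>UNIV. \<phi> (b i) * coord i a)"
    by (subst linear_expand[OF assms]) (simp only: mult.commute)
qed

lemma smash_mult_sum1:
  assumes "finite I"
  shows "smash_mult (\<lambda>a. \<Sum>i\<in>I. c i * f i a) h \<phi>' h' =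
    (\<Sum>i\<in>I. c i *s smash_mult (f i) h \<phi>' h')"
proof -
  have add: "smash_mult (\<lambda>a. f a + g a) h \<phi>' h' = smash_mult f h \<phi>' h' + smash_mult g h \<phi>' h'"
    for f g
    by (simp add: smash_mult_def sw4_def sw3_def sw2_def lift2_def dual_mult_def smash_def
        vec_eq_iff case_prod_unfold algebra_simps sum.distrib)
  have scl: "smash_mult (\<lambda>a. c * f a) h \<phi>' h' = c *s smash_mult f h \<phi>' h'" for c f
    by (simp add: smash_mult_def sw4_def sw3_def sw2_def lift2_def dual_mult_def smash_def
        vec_eq_iff case_prod_unfold algebra_simps sum_distrib_left)
  from assms show ?thesis
  proof induction
    case empty
    show ?case using scl[of 0 "\<lambda>_. 0"] by (simp add: vec_eq_iff)
  next
    case (insert i I)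
    then show ?case by (simp add: add scl)
  qed
qed

lemma smash_mult_sum2:
  assumes "finite I"
  shows "smash_mult \<phi> h (\<lambda>a. \<Sum>i\<in>I. c i * f i a) h' =
    (\<Sum>i\<in>I. c i *s smash_mult \<phi> h (f i) h')"
proof -
  have add: "smash_mult \<phi> h (\<lambda>a. f a + g a) h' = smash_mult \<phi> h f h' + smash_mult \<phi> h g h'"
    for f g
    by (simp add: smash_mult_def sw4_def sw3_def sw2_def lift2_def dual_mult_def smash_def
        left_hit_def right_hit_def vec_eq_iff case_prod_unfold algebra_simps sum.distrib)
  have scl: "smash_mult \<phi> h (\<lambda>a. c * f a) h' = c *s smash_mult \<phi> h f h'" for c f
    by (simp add: smash_mult_def sw4_def sw3_def sw2_def lift2_def dual_mult_def smash_def
        left_hit_def right_hit_def vec_eq_iff case_prod_unfold algebra_simps sum_distrib_left)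
  from assms show ?thesis
  proof induction
    case empty
    show ?case using scl[of 0 "\<lambda>_. 0"] by (simp add: vec_eq_iff)
  next
    case (insert i I)
    then show ?case by (simp add: add scl)
  qed
qed

lemma smash_mult_linear1: "Vector_Spaces.linear scale (*s) (\<lambda>h. smash_mult \<phi> h \<phi>' h')"
  unfolding smash_mult_def sw4_def sw2_def by (rule lift2_linear) (rule vec.vector_space_axioms)

lemma smash_mult_linear2: "Vector_Spaces.linear scale (*s) (\<lambda>h'. smash_mult \<phi> h \<phi>' h')"
proof -
  interpret d: Vector_Spaces.linear scale "(*s)" \<Delta> by (rule comult_linear)
  show ?thesis
    by unfold_locales
       (simp_all add: smash_mult_def sw4_def sw3_def sw2_def lift2_def d.add d.scale vec_eq_iff
          case_prod_unfold algebra_simps sum.distrib sum_distrib_left)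
qed

lemma D_mult_smash:
  assumes "Vector_Spaces.linear scale (*) \<phi>" "Vector_Spaces.linear scale (*) \<phi>'"
  shows "D_mult (\<phi> \<sharp> h) (\<phi>' \<sharp> h') = smash_mult \<phi> h \<phi>' h'"
proof -
  have e1: "smash_mult \<phi> h \<phi>' h' = (\<Sum>i\<in>UNIV. \<phi> (b i) *s smash_mult (coord i) h \<phi>' h')"
    by (subst dual_expand[OF assms(1)]) (rule smash_mult_sum1, simp)
  have e2: "smash_mult \<eta> h \<phi>' h' = (\<Sum>j\<in>UNIV. coord j h *s smash_mult \<eta> (b j) \<phi>' h')" for \<eta>
    by (rule linear_expand[OF smash_mult_linear1])
  have e3: "smash_mult \<eta> x \<phi>' h' = (\<Sum>l\<in>UNIV. \<phi>' (b l) *s smash_mult \<eta> x (coord l) h')" for \<eta> x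
    by (subst dual_expand[OF assms(2)]) (rule smash_mult_sum2, simp)
  have e4: "smash_mult \<eta> x \<psi> h' = (\<Sum>m\<in>UNIV. coord m h' *s smash_mult \<eta> x \<psi> (b m))" for \<eta> x \<psi>
    by (rule linear_expand[OF smash_mult_linear2])
  have "smash_mult \<phi> h \<phi>' h' =
      (\<Sum>i\<in>UNIV. \<phi> (b i) *s (\<Sum>j\<in>UNIV. coord j h *s (\<Sum>l\<in>UNIV. \<phi>' (b l) *s (\<Sum>m\<in>UNIV. coord m h' *s
         smash_mult (coord i) (b j) (coord l) (b m)))))"
    by (subst e1, subst e2, subst e3, subst e4) (rule refl)
  also have "\<dots> = (\<Sum>i\<in>UNIV. \<Sum>j\<in>UNIV. \<Sum>l\<in>UNIV. \<Sum>m\<in>UNIV.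
      (\<phi> (b i) * coord j h * (\<phi>' (b l) * coord m h')) *s
        smash_mult (coord i) (b j) (coord l) (b m))"
    by (simp add: vec.scale_sum_right mult.assoc)
  also have "\<dots> = D_mult (\<phi> \<sharp> h) (\<phi>' \<sharp> h')"
    unfolding D_mult_def UNIV_Times_UNIV[symmetric] sum.cartesian_product[symmetric]
    by (simp add: smash_def)
  finally show ?thesis ..
qed

definition D_one :: "'k ^ ('n \<times> 'n)" where
  "D_one = \<epsilon> \<sharp> one"

end


subsection \<open>Quasitriangular quasi-Hopf algebras\<close>

text \<open>\<open>\<Psi>\<close> stands for \<open>\<Phi>\<inverse>\<close>.\<close>

locale quasi_bialgebra = fd_algebra_comult scale b mult one \<Delta> \<epsilon>
  for scale :: "'k::field \<Rightarrow> 'a::ab_group_add \<Rightarrow> 'a" and b :: "'n::finite \<Rightarrow> 'a"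
    and mult :: "'a \<Rightarrow> 'a \<Rightarrow> 'a" (infixl "\<odot>" 70) and one :: 'a
    and \<Delta> :: "'a \<Rightarrow> 'k ^ ('n \<times> 'n)" and \<epsilon> :: "'a \<Rightarrow> 'k" +
  fixes \<Phi> \<Psi> :: "'k ^ ('n \<times> 'n \<times> 'n)"
  assumes reassociator_inverse: "inverses3 \<Phi> \<Psi>"
    and quasi_coassoc:
      "lift2 (*s) (\<Delta> h) (\<lambda>h1 h2. lift2 (*s) (\<Delta> h2) (\<lambda>a c. tensor3 h1 a c)) =
       \<Phi> \<odot>\<^sub>3 lift2 (*s) (\<Delta> h) (\<lambda>h1 h2. lift2 (*s) (\<Delta> h1) (\<lambda>a c. tensor3 a c h2)) \<odot>\<^sub>3 \<Psi>"
    and pentagon: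
      "lift3 (*s) \<Phi> (\<lambda>X1 X2 X3. tensor4 one X1 X2 X3) \<odot>\<^sub>4
       lift3 (*s) \<Phi> (\<lambda>X1 X2 X3. lift2 (*s) (\<Delta> X2) (\<lambda>a c. tensor4 X1 a c X3)) \<odot>\<^sub>4
       lift3 (*s) \<Phi> (\<lambda>X1 X2 X3. tensor4 X1 X2 X3 one) =
       lift3 (*s) \<Phi> (\<lambda>X1 X2 X3. lift2 (*s) (\<Delta> X3) (\<lambda>a c. tensor4 X1 X2 a c)) \<odot>\<^sub>4
       lift3 (*s) \<Phi> (\<lambda>X1 X2 X3. lift2 (*s) (\<Delta> X1) (\<lambda>a c. tensor4 a c X2 X3))"
    and reassociator_counit:
      "lift3 (*s) \<Phi> (\<lambda>X1 X2 X3. \<epsilon> X2 *s tensor2 X1 X3) = tensor2 one one"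

locale quasi_hopf_algebra = quasi_bialgebra scale b mult one \<Delta> \<epsilon> \<Phi> \<Psi>
  for scale :: "'k::field \<Rightarrow> 'a::ab_group_add \<Rightarrow> 'a" and b :: "'n::finite \<Rightarrow> 'a"
    and mult :: "'a \<Rightarrow> 'a \<Rightarrow> 'a" (infixl "\<odot>" 70) and one :: 'a
    and \<Delta> :: "'a \<Rightarrow> 'k ^ ('n \<times> 'n)" and \<epsilon> :: "'a \<Rightarrow> 'k"
    and \<Phi> \<Psi> :: "'k ^ ('n \<times> 'n \<times> 'n)" +
  fixes S :: "'a \<Rightarrow> 'a" and \<alpha> \<beta> :: 'a
  assumes antipode_linear: "Vector_Spaces.linear scale scale S"
    and antipode_mult: "S (x \<odot> y) = S y \<odot> S x"
    and antipode_one: "S one = one"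
    and antipode_alpha: "lift2 scale (\<Delta> h) (\<lambda>h1 h2. S h1 \<odot> \<alpha> \<odot> h2) = scale (\<epsilon> h) \<alpha>"
    and antipode_beta: "lift2 scale (\<Delta> h) (\<lambda>h1 h2. h1 \<odot> \<beta> \<odot> S h2) = scale (\<epsilon> h) \<beta>"
    and antipode_reassociator:
      "lift3 scale \<Phi> (\<lambda>X1 X2 X3. X1 \<odot> \<beta> \<odot> S X2 \<odot> \<alpha> \<odot> X3) = one"
    and antipode_reassociator_inv:
      "lift3 scale \<Psi> (\<lambda>x1 x2 x3. S x1 \<odot> \<alpha> \<odot> x2 \<odot> \<beta> \<odot> S x3) = one"

locale quasitriangular_quasi_hopf_algebra = quasi_hopf_algebra scale b mult one \<Delta> \<epsilon> \<Phi> \<Psi> S \<alpha> \<beta>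
  for scale :: "'k::field \<Rightarrow> 'a::ab_group_add \<Rightarrow> 'a" and b :: "'n::finite \<Rightarrow> 'a"
    and mult :: "'a \<Rightarrow> 'a \<Rightarrow> 'a" (infixl "\<odot>" 70) and one :: 'a
    and \<Delta> :: "'a \<Rightarrow> 'k ^ ('n \<times> 'n)" and \<epsilon> :: "'a \<Rightarrow> 'k"
    and \<Phi> \<Psi> :: "'k ^ ('n \<times> 'n \<times> 'n)" and S :: "'a \<Rightarrow> 'a" and \<alpha> \<beta> :: 'a +
  fixes R :: "'k ^ ('n \<times> 'n)"
  assumes R_invertible: "\<exists>R'. inverses2 R R'"
    and R_comult: "lift2 (*s) (\<Delta> h) (\<lambda>h1 h2. tensor2 h2 h1) \<odot>\<^sub>2 R = R \<odot>\<^sub>2 \<Delta> h"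
    and R_hexagon_left:
      "lift2 (*s) R (\<lambda>R1 R2. lift2 (*s) (\<Delta> R1) (\<lambda>a c. tensor3 a c R2)) =
       lift3 (*s) \<Phi> (\<lambda>X1 X2 X3. lift2 (*s) R (\<lambda>R1 R2. lift3 (*s) \<Psi> (\<lambda>x1 x2 x3.
       lift2 (*s) R (\<lambda>r1 r2. lift3 (*s) \<Phi> (\<lambda>Y1 Y2 Y3.
         tensor3 (X2 \<odot> R1 \<odot> x1 \<odot> Y1) (X3 \<odot> x3 \<odot> r1 \<odot> Y2) (X1 \<odot> R2 \<odot> x2 \<odot> r2 \<odot> Y3))))))"
    and R_hexagon_right:
      "lift2 (*s) R (\<lambda>R1 R2. lift2 (*s) (\<Delta> R2) (\<lambda>a c. tensor3 R1 a c)) =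
       lift3 (*s) \<Psi> (\<lambda>x1 x2 x3. lift2 (*s) R (\<lambda>R1 R2. lift3 (*s) \<Phi> (\<lambda>X1 X2 X3.
       lift2 (*s) R (\<lambda>r1 r2. lift3 (*s) \<Psi> (\<lambda>y1 y2 y3.
         tensor3 (x3 \<odot> R1 \<odot> X2 \<odot> r1 \<odot> y1) (x1 \<odot> X1 \<odot> r2 \<odot> y2) (x2 \<odot> R2 \<odot> X3 \<odot> y3))))))"
    and R_counit_left: "lift2 scale R (\<lambda>R1 R2. scale (\<epsilon> R1) R2) = one"
    and R_counit_right: "lift2 scale R (\<lambda>R1 R2. scale (\<epsilon> R2) R1) = one"

end

theory Submission
  imports Defs
begin

text \<open>
  A cocommutative Hopf algebra behaves like the group algebra of a group, and for group algebras
  the theorem is the classical computation of Dijkgraaf, Pasquier and Roche.  This can be made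
  literal with the functor of points.  For a commutative \<open>k\<close>-algebra \<open>K\<close> the group-like elements of
  \<open>K \<otimes> H\<close> form an honest group \<open>G(K)\<close>, on which \<open>\<omega>\<close> induces an honest \<open>3\<close>-cocycle with values in the
  units of \<open>K\<close>.  At group-like elements the indices of Sweedler notation may be erased, so that an
  identity between multilinear Sweedler expressions becomes an identity between group words and values
  of \<open>\<omega>\<close>.  Conversely, identities at points imply identities in \<open>H\<close> if \<open>K\<close> contains enough generic
  points.  Four suffice, because every axiom involves at most four elements of \<open>H\<close> and \<open>H\<^sup>*\<close>, and
  the coordinate ring of \<open>G\<^sup>4\<close> (the dual of \<open>H \<otimes> H \<otimes> H \<otimes> H\<close>) has four: the projections
  (\<open>ex_generic_points\<close>).

  An element of \<open>D\<^sup>\<omega>(H) = H\<^sup>* \<otimes> H\<close> can be evaluated at a point \<open>g\<close> in its first factor, and the elements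
  that matter take monomial values \<open>c x\<close> with \<open>c\<close> in \<open>K\<close> and \<open>x\<close> in \<open>G(K)\<close>.  Such values multiply like
  arrows of the action groupoid of \<open>G\<close> on itself by conjugation, twisted by \<open>\<theta>\<close>
  (\<open>D_multiplicative\<close>), also in tensor powers (\<open>multiplicative_tens\<close>).  The structure is, with
  \<open>\<gamma>\<^sub>x(g, h) = \<omega>(g, h, x) \<omega>(x, g \<triangleleft> x, h \<triangleleft> x) \<omega>\<inverse>(g, x, h \<triangleleft> x)\<close>,
  \<^item> \<open>\<Delta>(\<phi> # x)(g, h) = \<phi>(g h) \<gamma>\<^sub>x(g, h) x \<otimes> x\<close> and \<open>\<epsilon>(\<phi> # x) = \<phi>(1) \<epsilon>(x)\<close>,
  \<^item> \<open>\<Phi>(g, h, k) = \<omega>\<inverse>(g, h, k)\<close> and \<open>R(g, h) = 1 \<otimes> g\<close>,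
  \<^item> \<open>S(\<phi> # x)(g) = \<phi>(x g\<inverse> x\<inverse>) \<kappa>(g, x) x\<inverse>\<close>, \<open>\<alpha> = 1\<close> and \<open>\<beta>(g) = \<omega>(g, g\<inverse>, g)\<close>, where \<open>\<kappa>(g, x)\<close> is
    the inverse of \<open>\<gamma>\<^sub>x(x g\<inverse> x\<inverse>, x g x\<inverse>) \<theta>(g; x\<inverse>, x)\<close>.

  Comparing monomial values, every axiom becomes a statement about the group cocycle.  Associativity is
  the two-cocycle condition for \<open>\<theta>\<close> (\<open>th_cocycle\<close>), multiplicativity of \<open>\<Delta>\<close> is \<open>th_ga_compatible\<close>,
  quasi-coassociativity is \<open>ga_coassoc\<close>, the pentagon is the cocycle equation, the intertwining property
  of \<open>R\<close> is \<open>ga_th_swap\<close>, and the hexagons restate the definitions of \<open>\<theta>\<close> and \<open>\<gamma>\<close>.  The antipode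
  axioms are \<open>ka_mult\<close>, \<open>ka_inverse\<close>, \<open>ka_beta\<close> and \<open>w_inv_inv\<close>.
\<close>

section \<open>Group cocycles with values in a commutative monoid\<close>

text \<open>The group lives on a carrier because it will be the group of points of \<open>H\<close> over an
  algebra, which depends on all the data.  The values of the cocycle are units of a commutative
  monoid, \<open>w'\<close> being the inverse of \<open>w\<close>.\<close>

locale group_3cocycle = comm_monoid mul unit
  for mul :: "'c \<Rightarrow> 'c \<Rightarrow> 'c" (infixl "\<cdot>" 70) and unit :: 'c ("\<one>") +
  fixes G :: "'g set" and gmul :: "'g \<Rightarrow> 'g \<Rightarrow> 'g" (infixl "\<otimes>" 70)
    and ginv :: "'g \<Rightarrow> 'g" and gone :: 'g
    and w w' :: "'g \<Rightarrow> 'g \<Rightarrow> 'g \<Rightarrow> 'c"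
  assumes gmul_closed [simp]: "x \<in> G \<Longrightarrow> y \<in> G \<Longrightarrow> x \<otimes> y \<in> G"
    and ginv_closed [simp]: "x \<in> G \<Longrightarrow> ginv x \<in> G"
    and gone_closed [simp]: "gone \<in> G"
    and gassoc: "x \<in> G \<Longrightarrow> y \<in> G \<Longrightarrow> z \<in> G \<Longrightarrow> x \<otimes> y \<otimes> z = x \<otimes> (y \<otimes> z)"
    and gone_left [simp]: "x \<in> G \<Longrightarrow> gone \<otimes> x = x"
    and ginv_left [simp]: "x \<in> G \<Longrightarrow> ginv x \<otimes> x = gone"
    and w_inverse: "x \<in> G \<Longrightarrow> y \<in> G \<Longrightarrow> z \<in> G \<Longrightarrow> w x y z \<cdot> w' x y z = \<one>"
    and w_cocycle: "x \<in> G \<Longrightarrow> y \<in> G \<Longrightarrow> z \<in> G \<Longrightarrow> t \<in> G \<Longrightarrow>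
      w x y (z \<otimes> t) \<cdot> w (x \<otimes> y) z t = w y z t \<cdot> w x (y \<otimes> z) t \<cdot> w x y z"
    and w_one1 [simp]: "x \<in> G \<Longrightarrow> y \<in> G \<Longrightarrow> w gone x y = \<one>"
    and w_one2 [simp]: "x \<in> G \<Longrightarrow> y \<in> G \<Longrightarrow> w x gone y = \<one>"
    and w_one3 [simp]: "x \<in> G \<Longrightarrow> y \<in> G \<Longrightarrow> w x y gone = \<one>"
begin

lemma ginv_left_cancel [simp]: "x \<in> G \<Longrightarrow> y \<in> G \<Longrightarrow> ginv x \<otimes> (x \<otimes> y) = y"
  by (simp flip: gassoc)

lemma ginv_right [simp]: "x \<in> G \<Longrightarrow> x \<otimes> ginv x = gone"
  by (metis gassoc ginv_closed ginv_left gone_left gone_closed gmul_closed)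

lemma gone_right [simp]: "x \<in> G \<Longrightarrow> x \<otimes> gone = x"
  by (metis gassoc ginv_closed ginv_left gone_left ginv_right)

lemma ginv_right_cancel [simp]: "x \<in> G \<Longrightarrow> y \<in> G \<Longrightarrow> x \<otimes> (ginv x \<otimes> y) = y"
  by (simp flip: gassoc)

lemma ginv_unique: "x \<in> G \<Longrightarrow> y \<in> G \<Longrightarrow> x \<otimes> y = gone \<Longrightarrow> ginv x = y"
  by (metis ginv_left_cancel ginv_closed gone_right)

lemma ginv_ginv [simp]: "x \<in> G \<Longrightarrow> ginv (ginv x) = x"
  by (rule ginv_unique) auto

lemma ginv_gone [simp]: "ginv gone = gone"
  by (rule ginv_unique) auto

lemma ginv_gmul: "x \<in> G \<Longrightarrow> y \<in> G \<Longrightarrow> ginv (x \<otimes> y) = ginv y \<otimes> ginv x"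
  by (rule ginv_unique) (auto simp: gassoc)

definition cj :: "'g \<Rightarrow> 'g \<Rightarrow> 'g" (infixl "\<triangleleft>" 71) where
  "g \<triangleleft> x = ginv x \<otimes> g \<otimes> x"

lemma cj_closed [simp]: "g \<in> G \<Longrightarrow> x \<in> G \<Longrightarrow> g \<triangleleft> x \<in> G"
  by (simp add: cj_def)

lemma cj_gone [simp]: "g \<in> G \<Longrightarrow> g \<triangleleft> gone = g" "x \<in> G \<Longrightarrow> gone \<triangleleft> x = gone"
  by (simp_all add: cj_def)

lemma cj_cj: "g \<in> G \<Longrightarrow> x \<in> G \<Longrightarrow> y \<in> G \<Longrightarrow> g \<triangleleft> x \<triangleleft> y = g \<triangleleft> (x \<otimes> y)"
  by (simp add: cj_def gassoc ginv_gmul)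

lemma gmul_cj: "g \<in> G \<Longrightarrow> h \<in> G \<Longrightarrow> x \<in> G \<Longrightarrow> (g \<otimes> h) \<triangleleft> x = g \<triangleleft> x \<otimes> h \<triangleleft> x"
  by (simp add: cj_def gassoc)

lemma ginv_cj: "g \<in> G \<Longrightarrow> x \<in> G \<Longrightarrow> ginv (g \<triangleleft> x) = ginv g \<triangleleft> x"
  by (simp add: cj_def gassoc ginv_gmul)

lemma gmul_cj_swap: "g \<in> G \<Longrightarrow> x \<in> G \<Longrightarrow> x \<otimes> g \<triangleleft> x = g \<otimes> x"
  by (simp add: cj_def gassoc)

lemma cj_inv_cancel [simp]:
  "g \<in> G \<Longrightarrow> x \<in> G \<Longrightarrow> g \<triangleleft> x \<triangleleft> ginv x = g"
  "g \<in> G \<Longrightarrow> x \<in> G \<Longrightarrow> g \<triangleleft> ginv x \<triangleleft> x = g"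
  by (simp_all add: cj_cj)

definition invertible :: "'c \<Rightarrow> bool" where
  "invertible a \<longleftrightarrow> (\<exists>a'. a \<cdot> a' = \<one>)"

text \<open>An identity between quotients of values of \<open>w\<close> is proved by multiplying both sides by a
  unit that clears all denominators and then comparing products of cocycle equations.\<close>

lemma cancel:
  assumes "a \<cdot> e = c \<cdot> e" "invertible e"
  shows "a = c"
  using assms unfolding invertible_def by (metis assoc right_neutral)

lemma invertible_mul [intro, simp]: "invertible a \<Longrightarrow> invertible c \<Longrightarrow> invertible (a \<cdot> c)"
proof -
  assume "invertible a" "invertible c"
  then obtain a' c' where "a \<cdot> a' = \<one>" "c \<cdot> c' = \<one>" by (auto simp: invertible_def)
  then have "(a \<cdot> c) \<cdot> (a' \<cdot> c') = \<one>" by (metis assoc commute left_neutral)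
  then show ?thesis unfolding invertible_def by blast
qed

lemma invertible_w [intro, simp]: "x \<in> G \<Longrightarrow> y \<in> G \<Longrightarrow> z \<in> G \<Longrightarrow> invertible (w x y z)"
  unfolding invertible_def using w_inverse by blast

lemma w'_one [simp]:
  assumes "x \<in> G" "y \<in> G"
  shows "w' gone x y = \<one>" "w' x gone y = \<one>" "w' x y gone = \<one>"
  using w_inverse[of gone x y] w_inverse[of x gone y] w_inverse[of x y gone] assms
  by simp_all

text \<open>The multiplier \<open>\<theta>\<close> of the product of \<open>D\<^sup>\<omega>\<close>, the multiplier \<open>\<gamma>\<close> of its coproduct, and their
  inverses, in the form in which Dijkgraaf, Pasquier and Roche wrote them for finite groups.\<close>

definition th :: "'g \<Rightarrow> 'g \<Rightarrow> 'g \<Rightarrow> 'c" where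
  "th g x y = w g x y \<cdot> w x y (g \<triangleleft> (x \<otimes> y)) \<cdot> w' x (g \<triangleleft> x) y"

definition th' :: "'g \<Rightarrow> 'g \<Rightarrow> 'g \<Rightarrow> 'c" where
  "th' g x y = w' g x y \<cdot> w' x y (g \<triangleleft> (x \<otimes> y)) \<cdot> w x (g \<triangleleft> x) y"

definition ga :: "'g \<Rightarrow> 'g \<Rightarrow> 'g \<Rightarrow> 'c" where
  "ga x g h = w g h x \<cdot> w x (g \<triangleleft> x) (h \<triangleleft> x) \<cdot> w' g x (h \<triangleleft> x)"

definition ga' :: "'g \<Rightarrow> 'g \<Rightarrow> 'g \<Rightarrow> 'c" where
  "ga' x g h = w' g h x \<cdot> w' x (g \<triangleleft> x) (h \<triangleleft> x) \<cdot> w g x (h \<triangleleft> x)"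

lemma mul_inverse3:
  assumes "a \<cdot> a' = \<one>" "c \<cdot> c' = \<one>" "e \<cdot> e' = \<one>"
  shows "(a \<cdot> c \<cdot> e') \<cdot> (a' \<cdot> c' \<cdot> e) = \<one>"
proof -
  have "(a \<cdot> c \<cdot> e') \<cdot> (a' \<cdot> c' \<cdot> e) = (a \<cdot> a') \<cdot> (c \<cdot> c') \<cdot> (e \<cdot> e')" by (simp only: ac_simps)
  then show ?thesis by (simp add: assms)
qed

lemma th_inverse: "g \<in> G \<Longrightarrow> x \<in> G \<Longrightarrow> y \<in> G \<Longrightarrow> th g x y \<cdot> th' g x y = \<one>"
  unfolding th_def th'_def by (rule mul_inverse3) (simp_all add: w_inverse)

lemma ga_inverse: "g \<in> G \<Longrightarrow> x \<in> G \<Longrightarrow> y \<in> G \<Longrightarrow> ga g x y \<cdot> ga' g x y = \<one>"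
  unfolding ga_def ga'_def by (rule mul_inverse3) (simp_all add: w_inverse)

lemma th_eq:
  assumes "g \<in> G" "x \<in> G" "y \<in> G"
  shows "th g x y \<cdot> w x (g \<triangleleft> x) y = w g x y \<cdot> w x y (g \<triangleleft> (x \<otimes> y))"
proof -
  have "th g x y \<cdot> w x (g \<triangleleft> x) y
      = w g x y \<cdot> w x y (g \<triangleleft> (x \<otimes> y)) \<cdot> (w x (g \<triangleleft> x) y \<cdot> w' x (g \<triangleleft> x) y)"
    unfolding th_def by (simp only: ac_simps)
  then show ?thesis using assms by (simp add: w_inverse)
qed

lemma ga_eq:
  assumes "g \<in> G" "x \<in> G" "h \<in> G"
  shows "ga x g h \<cdot> w g x (h \<triangleleft> x) = w g h x \<cdot> w x (g \<triangleleft> x) (h \<triangleleft> x)"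
proof -
  have "ga x g h \<cdot> w g x (h \<triangleleft> x)
      = w g h x \<cdot> w x (g \<triangleleft> x) (h \<triangleleft> x) \<cdot> (w g x (h \<triangleleft> x) \<cdot> w' g x (h \<triangleleft> x))"
    unfolding ga_def by (simp only: ac_simps)
  then show ?thesis using assms by (simp add: w_inverse)
qed

lemma th_one [simp]:
  assumes "g \<in> G" "x \<in> G"
  shows "th g x gone = \<one>" "th g gone x = \<one>" "th gone g x = \<one>"
  using assms by (simp_all add: th_def w_inverse)

lemma ga_one [simp]:
  assumes "g \<in> G" "x \<in> G"
  shows "ga x g gone = \<one>" "ga x gone g = \<one>" "ga gone g x = \<one>"
  using assms by (simp_all add: ga_def w_inverse)

text \<open>Two-cocycle condition for \<open>\<theta>\<close>.  Move \<open>g\<close> through the word \<open>xyz\<close> from left to right,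
  conjugating it by the letters it passes; the alternating product of the cocycle equations at the
  four words so obtained is the claim, up to the common factor \<open>E\<close>.\<close>

lemma th_cocycle:
  assumes G: "g \<in> G" "x \<in> G" "y \<in> G" "z \<in> G"
  shows "th g x y \<cdot> th g (x \<otimes> y) z = th (g \<triangleleft> x) y z \<cdot> th g x (y \<otimes> z)"
proof -
  define a c d where "a = g \<triangleleft> x" and "c = g \<triangleleft> (x \<otimes> y)" and "d = g \<triangleleft> (x \<otimes> (y \<otimes> z))"
  have acd: "a \<in> G" "c \<in> G" "d \<in> G" using G by (simp_all add: a_def c_def d_def)
  have s: "x \<otimes> a = g \<otimes> x" "a \<otimes> y = y \<otimes> c" "c \<otimes> z = z \<otimes> d"
    using G by (simp_all add: a_def c_def d_def cj_def gassoc ginv_gmul)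
  note t1 = th_eq[OF G(1,2,3), folded a_def c_def]
  have t2: "th g (x \<otimes> y) z \<cdot> w (x \<otimes> y) c z = w g (x \<otimes> y) z \<cdot> w (x \<otimes> y) z d"
    using th_eq[of g "x \<otimes> y" z] G by (simp add: c_def d_def gassoc)
  have t3: "th a y z \<cdot> w y c z = w a y z \<cdot> w y z d"
    using th_eq[of a y z] G by (simp add: a_def c_def d_def cj_cj)
  have t4: "th g x (y \<otimes> z) \<cdot> w x a (y \<otimes> z) = w g x (y \<otimes> z) \<cdot> w x (y \<otimes> z) d"
    using th_eq[of g x "y \<otimes> z"] G by (simp add: a_def d_def)
  note c1 = w_cocycle[OF G]
  note c2 = w_cocycle[OF G(2) acd(1) G(3,4), unfolded s]
  note c3 = w_cocycle[OF G(2,3) acd(2) G(4), unfolded s]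
  note c4 = w_cocycle[OF G(2,3,4) acd(3)]
  \<comment> \<open>the terms of the four equations that occur neither in the claim nor in a denominator\<close>
  define E where "E = w x y z \<cdot> w (g \<otimes> x) y z \<cdot> w x (y \<otimes> c) z \<cdot> w x y (z \<otimes> d)"
  define X where "X = w x a y \<cdot> w (x \<otimes> y) c z \<cdot> w y c z \<cdot> w x a (y \<otimes> z) \<cdot> E"
  have "th g x y \<cdot> th g (x \<otimes> y) z \<cdot> X
     = (th g x y \<cdot> w x a y) \<cdot> (th g (x \<otimes> y) z \<cdot> w (x \<otimes> y) c z) \<cdot> w y c z \<cdot> w x a (y \<otimes> z) \<cdot> E"
    unfolding X_def by (simp only: ac_simps)
  also have "\<dots> = (w x y z \<cdot> w g (x \<otimes> y) z \<cdot> w g x y) \<cdot> (w x a (y \<otimes> z) \<cdot> w (g \<otimes> x) y z)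
      \<cdot> (w y c z \<cdot> w x (y \<otimes> c) z \<cdot> w x y c) \<cdot> (w x y (z \<otimes> d) \<cdot> w (x \<otimes> y) z d)"
    unfolding t1 t2 E_def by (simp only: ac_simps)
  also have "\<dots> = (w g x (y \<otimes> z) \<cdot> w (g \<otimes> x) y z) \<cdot> (w a y z \<cdot> w x (y \<otimes> c) z \<cdot> w x a y)
      \<cdot> (w x y (z \<otimes> d) \<cdot> w (x \<otimes> y) c z) \<cdot> (w y z d \<cdot> w x (y \<otimes> z) d \<cdot> w x y z)"
    unfolding c1 c2 c3 c4 ..
  also have "\<dots> = (th a y z \<cdot> w y c z) \<cdot> (th g x (y \<otimes> z) \<cdot> w x a (y \<otimes> z))
      \<cdot> w x a y \<cdot> w (x \<otimes> y) c z \<cdot> E"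
    unfolding t3 t4 E_def by (simp only: ac_simps)
  also have "\<dots> = th a y z \<cdot> th g x (y \<otimes> z) \<cdot> X"
    unfolding X_def by (simp only: ac_simps)
  finally have "th g x y \<cdot> th g (x \<otimes> y) z \<cdot> X = th a y z \<cdot> th g x (y \<otimes> z) \<cdot> X" .
  moreover have "invertible X"
    unfolding X_def E_def using G acd by (intro invertible_mul invertible_w gmul_closed)
  ultimately show ?thesis unfolding a_def by (rule cancel)
qed

text \<open>The same method with the six shuffles of the words \<open>gh\<close> and \<open>xy\<close>; this identity makes the
  coproduct multiplicative.\<close>

lemma th_ga_compatible:
  assumes G: "g \<in> G" "h \<in> G" "x \<in> G" "y \<in> G"
  shows "th g x y \<cdot> th h x y \<cdot> ga x g h \<cdot> ga y (g \<triangleleft> x) (h \<triangleleft> x)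
    = th (g \<otimes> h) x y \<cdot> ga (x \<otimes> y) g h"
proof -
  define a c p q where "a = g \<triangleleft> x" and "c = h \<triangleleft> x" and "p = g \<triangleleft> (x \<otimes> y)" and "q = h \<triangleleft> (x \<otimes> y)"
  have acd: "a \<in> G" "c \<in> G" "p \<in> G" "q \<in> G" using G by (simp_all add: a_def c_def p_def q_def)
  have s: "x \<otimes> a = g \<otimes> x" "x \<otimes> c = h \<otimes> x" "a \<otimes> y = y \<otimes> p" "c \<otimes> y = y \<otimes> q"
    using G by (simp_all add: a_def c_def p_def q_def cj_def gassoc ginv_gmul)
  have r: "a \<triangleleft> y = p" "c \<triangleleft> y = q" using G by (simp_all add: a_def c_def p_def q_def cj_cj)
  have t1: "th g x y \<cdot> w x a y = w g x y \<cdot> w x y p"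
    using th_eq[OF G(1,3,4)] by (simp add: a_def p_def)
  have t2: "th h x y \<cdot> w x c y = w h x y \<cdot> w x y q"
    using th_eq[OF G(2,3,4)] by (simp add: c_def q_def)
  have t3: "ga x g h \<cdot> w g x c = w g h x \<cdot> w x a c"
    using ga_eq[OF G(1,3,2)] by (simp add: c_def a_def)
  have t4: "ga y a c \<cdot> w a y q = w a c y \<cdot> w y p q"
    using ga_eq[OF acd(1) G(4) acd(2)] by (simp add: r)
  have t5: "th (g \<otimes> h) x y \<cdot> w x (a \<otimes> c) y = w (g \<otimes> h) x y \<cdot> w x y (p \<otimes> q)"
    using th_eq[of "g \<otimes> h" x y] G by (simp add: gmul_cj a_def c_def p_def q_def)
  have t6: "ga (x \<otimes> y) g h \<cdot> w g (x \<otimes> y) q = w g h (x \<otimes> y) \<cdot> w (x \<otimes> y) p q"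
    using ga_eq[of g "x \<otimes> y" h] G by (simp add: p_def q_def)
  note c1 = w_cocycle[OF G]
  note c2 = w_cocycle[OF G(1,3) acd(2) G(4), unfolded s]
  note c3 = w_cocycle[OF G(1,3,4) acd(4)]
  note c4 = w_cocycle[OF G(3) acd(1,2) G(4), unfolded s]
  note c5 = w_cocycle[OF G(3) acd(1) G(4) acd(4), unfolded s]
  note c6 = w_cocycle[OF G(3,4) acd(3,4)]
  define E where "E = w g (h \<otimes> x) y \<cdot> w g x (y \<otimes> q) \<cdot> w (g \<otimes> x) c y \<cdot> w x a (y \<otimes> q)
    \<cdot> w (g \<otimes> x) y q \<cdot> w x (y \<otimes> p) q"
  define Y where "Y = w x a y \<cdot> w x c y \<cdot> w g x c \<cdot> w a y q"
  define Z where "Z = w x (a \<otimes> c) y \<cdot> w g (x \<otimes> y) q"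
  have "th g x y \<cdot> th h x y \<cdot> ga x g h \<cdot> ga y a c \<cdot> (Y \<cdot> Z \<cdot> E)
     = (th g x y \<cdot> w x a y) \<cdot> (th h x y \<cdot> w x c y) \<cdot> (ga x g h \<cdot> w g x c) \<cdot> (ga y a c \<cdot> w a y q) \<cdot> Z \<cdot> E"
    unfolding Y_def by (simp only: ac_simps)
  also have "\<dots> = (w h x y \<cdot> w g (h \<otimes> x) y \<cdot> w g h x) \<cdot> (w g x (y \<otimes> q) \<cdot> w (g \<otimes> x) c y)
      \<cdot> (w x y q \<cdot> w g (x \<otimes> y) q \<cdot> w g x y) \<cdot> (w a c y \<cdot> w x (a \<otimes> c) y \<cdot> w x a c)
      \<cdot> (w x a (y \<otimes> q) \<cdot> w (g \<otimes> x) y q) \<cdot> (w y p q \<cdot> w x (y \<otimes> p) q \<cdot> w x y p)"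
    unfolding t1 t2 t3 t4 E_def Z_def by (simp only: ac_simps)
  also have "\<dots> = (w g h (x \<otimes> y) \<cdot> w (g \<otimes> h) x y) \<cdot> (w x c y \<cdot> w g (h \<otimes> x) y \<cdot> w g x c)
      \<cdot> (w g x (y \<otimes> q) \<cdot> w (g \<otimes> x) y q) \<cdot> (w x a (y \<otimes> q) \<cdot> w (g \<otimes> x) c y)
      \<cdot> (w a y q \<cdot> w x (y \<otimes> p) q \<cdot> w x a y) \<cdot> (w x y (p \<otimes> q) \<cdot> w (x \<otimes> y) p q)"
    unfolding c1 c2 c3 c4 c5 c6 ..
  also have "\<dots> = (th (g \<otimes> h) x y \<cdot> w x (a \<otimes> c) y) \<cdot> (ga (x \<otimes> y) g h \<cdot> w g (x \<otimes> y) q) \<cdot> Y \<cdot> E"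
    unfolding t5 t6 E_def Y_def by (simp only: ac_simps)
  also have "\<dots> = th (g \<otimes> h) x y \<cdot> ga (x \<otimes> y) g h \<cdot> (Y \<cdot> Z \<cdot> E)"
    unfolding Z_def by (simp only: ac_simps)
  finally have "th g x y \<cdot> th h x y \<cdot> ga x g h \<cdot> ga y a c \<cdot> (Y \<cdot> Z \<cdot> E)
    = th (g \<otimes> h) x y \<cdot> ga (x \<otimes> y) g h \<cdot> (Y \<cdot> Z \<cdot> E)" .
  moreover have "invertible (Y \<cdot> Z \<cdot> E)"
    unfolding Y_def Z_def E_def using G acd by (intro invertible_mul invertible_w gmul_closed)
  ultimately show ?thesis unfolding a_def c_def by (rule cancel)
qed

text \<open>The same method with the four shuffles of \<open>ghk\<close> and \<open>x\<close>; this identity is quasi-coassociativity.\<close>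

lemma ga_coassoc:
  assumes G: "x \<in> G" "g \<in> G" "h \<in> G" "k \<in> G"
  shows "ga x g h \<cdot> ga x (g \<otimes> h) k \<cdot> w (g \<triangleleft> x) (h \<triangleleft> x) (k \<triangleleft> x)
    = ga x h k \<cdot> ga x g (h \<otimes> k) \<cdot> w g h k"
proof -
  define a c d where "a = g \<triangleleft> x" and "c = h \<triangleleft> x" and "d = k \<triangleleft> x"
  have acd: "a \<in> G" "c \<in> G" "d \<in> G" using G by (simp_all add: a_def c_def d_def)
  have s: "x \<otimes> a = g \<otimes> x" "x \<otimes> c = h \<otimes> x" "x \<otimes> d = k \<otimes> x"
    using G by (simp_all add: a_def c_def d_def cj_def gassoc ginv_gmul)
  have t1: "ga x g h \<cdot> w g x c = w g h x \<cdot> w x a c"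
    using ga_eq[of g x h] G by (simp add: a_def c_def)
  have t2: "ga x (g \<otimes> h) k \<cdot> w (g \<otimes> h) x d = w (g \<otimes> h) k x \<cdot> w x (a \<otimes> c) d"
    using ga_eq[of "g \<otimes> h" x k] G by (simp add: a_def c_def d_def gmul_cj)
  have t3: "ga x h k \<cdot> w h x d = w h k x \<cdot> w x c d"
    using ga_eq[of h x k] G by (simp add: c_def d_def)
  have t4: "ga x g (h \<otimes> k) \<cdot> w g x (c \<otimes> d) = w g (h \<otimes> k) x \<cdot> w x a (c \<otimes> d)"
    using ga_eq[of g x "h \<otimes> k"] G by (simp add: a_def c_def d_def gmul_cj)
  note c1 = w_cocycle[OF G(2,3,4,1)]
  note c2 = w_cocycle[OF G(2,3,1) acd(3), unfolded s]
  note c3 = w_cocycle[OF G(2,1) acd(2,3), unfolded s]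
  note c4 = w_cocycle[OF G(1) acd, unfolded s]
  define E where "E = w g h (k \<otimes> x) \<cdot> w g (h \<otimes> x) d \<cdot> w (g \<otimes> x) c d"
  define Y where "Y = w g x c \<cdot> w (g \<otimes> h) x d"
  define Z where "Z = w h x d \<cdot> w g x (c \<otimes> d)"
  have "ga x g h \<cdot> ga x (g \<otimes> h) k \<cdot> w a c d \<cdot> (Y \<cdot> Z \<cdot> E)
     = (ga x g h \<cdot> w g x c) \<cdot> (ga x (g \<otimes> h) k \<cdot> w (g \<otimes> h) x d) \<cdot> w a c d \<cdot> Z \<cdot> E"
    unfolding Y_def by (simp only: ac_simps)
  also have "\<dots> = (w g h (k \<otimes> x) \<cdot> w (g \<otimes> h) k x) \<cdot> (w h x d \<cdot> w g (h \<otimes> x) d \<cdot> w g h x)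
      \<cdot> (w g x (c \<otimes> d) \<cdot> w (g \<otimes> x) c d) \<cdot> (w a c d \<cdot> w x (a \<otimes> c) d \<cdot> w x a c)"
    unfolding t1 t2 E_def Z_def by (simp only: ac_simps)
  also have "\<dots> = (w h k x \<cdot> w g (h \<otimes> k) x \<cdot> w g h k) \<cdot> (w g h (k \<otimes> x) \<cdot> w (g \<otimes> h) x d)
      \<cdot> (w x c d \<cdot> w g (h \<otimes> x) d \<cdot> w g x c) \<cdot> (w x a (c \<otimes> d) \<cdot> w (g \<otimes> x) c d)"
    unfolding c1 c2 c3 c4 ..
  also have "\<dots> = (ga x h k \<cdot> w h x d) \<cdot> (ga x g (h \<otimes> k) \<cdot> w g x (c \<otimes> d)) \<cdot> w g h k \<cdot> Y \<cdot> E"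
    unfolding t3 t4 E_def Y_def by (simp only: ac_simps)
  also have "\<dots> = ga x h k \<cdot> ga x g (h \<otimes> k) \<cdot> w g h k \<cdot> (Y \<cdot> Z \<cdot> E)"
    unfolding Z_def by (simp only: ac_simps)
  finally have "ga x g h \<cdot> ga x (g \<otimes> h) k \<cdot> w a c d \<cdot> (Y \<cdot> Z \<cdot> E)
    = ga x h k \<cdot> ga x g (h \<otimes> k) \<cdot> w g h k \<cdot> (Y \<cdot> Z \<cdot> E)" .
  moreover have "invertible (Y \<cdot> Z \<cdot> E)"
    unfolding Y_def Z_def E_def using G acd by (intro invertible_mul invertible_w gmul_closed)
  ultimately show ?thesis unfolding a_def c_def d_def by (rule cancel)
qed

lemma w_inv_inv: "g \<in> G \<Longrightarrow> w (ginv g) g (ginv g) \<cdot> w g (ginv g) g = \<one>"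
  using w_cocycle[of g "ginv g" g "ginv g"] by simp

text \<open>After cancellation both sides are \<open>w h g x \<cdot> w x (g \<triangleleft> x) (h \<triangleleft> (g \<otimes> x))\<close>.  The identity
  says that the \<open>R\<close>-matrix intertwines the coproduct and its opposite.\<close>

lemma ga_th_swap:
  assumes G: "x \<in> G" "g \<in> G" "h \<in> G"
  shows "ga x h g \<cdot> th h x (g \<triangleleft> x) = ga x g (h \<triangleleft> g) \<cdot> th h g x"
proof -
  define a c d e where "a = g \<triangleleft> x" and "c = h \<triangleleft> g" and "d = h \<triangleleft> x" and "e = h \<triangleleft> (g \<otimes> x)"
  have acd: "a \<in> G" "c \<in> G" "d \<in> G" "e \<in> G" using G by (simp_all add: a_def c_def d_def e_def)
  have s: "x \<otimes> a = g \<otimes> x" "c \<triangleleft> x = e" using G by (simp_all add: a_def c_def e_def gmul_cj_swap cj_cj)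
  have t1: "ga x h g \<cdot> w h x a = w h g x \<cdot> w x d a"
    using ga_eq[of h x g] G by (simp add: a_def d_def)
  have t2: "th h x a \<cdot> w x d a = w h x a \<cdot> w x a e"
    using th_eq[of h x a] G acd by (simp add: s d_def e_def)
  have t3: "ga x g c \<cdot> w g x e = w g c x \<cdot> w x a e"
    using ga_eq[of g x c] G acd by (simp add: s a_def)
  have t4: "th h g x \<cdot> w g c x = w h g x \<cdot> w g x e"
    using th_eq[of h g x] G acd by (simp add: s c_def e_def)
  define X where "X = w h x a \<cdot> w x d a \<cdot> w g x e \<cdot> w g c x"
  have "ga x h g \<cdot> th h x a \<cdot> X = (ga x h g \<cdot> w h x a) \<cdot> (th h x a \<cdot> w x d a) \<cdot> w g x e \<cdot> w g c x"
    unfolding X_def by (simp only: ac_simps)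
  also have "\<dots> = (ga x g c \<cdot> w g x e) \<cdot> (th h g x \<cdot> w g c x) \<cdot> w h x a \<cdot> w x d a"
    unfolding t1 t2 t3 t4 by (simp only: ac_simps)
  also have "\<dots> = ga x g c \<cdot> th h g x \<cdot> X"
    unfolding X_def by (simp only: ac_simps)
  finally show ?thesis unfolding a_def c_def
    by (rule cancel) (unfold X_def, use G acd in \<open>intro invertible_mul invertible_w gmul_closed\<close>)
qed

lemma w'_cocycle:
  assumes "x \<in> G" "y \<in> G" "z \<in> G" "t \<in> G"
  shows "w' y z t \<cdot> w' x (y \<otimes> z) t \<cdot> w' x y z = w' x y (z \<otimes> t) \<cdot> w' (x \<otimes> y) z t"
proof (rule cancel)
  let ?P = "w y z t \<cdot> w x (y \<otimes> z) t \<cdot> w x y z"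
  have "w' y z t \<cdot> w' x (y \<otimes> z) t \<cdot> w' x y z \<cdot> ?P
    = (w y z t \<cdot> w' y z t) \<cdot> (w x (y \<otimes> z) t \<cdot> w' x (y \<otimes> z) t) \<cdot> (w x y z \<cdot> w' x y z)"
    by (simp only: ac_simps)
  also have "\<dots> = (w x y (z \<otimes> t) \<cdot> w' x y (z \<otimes> t)) \<cdot> (w (x \<otimes> y) z t \<cdot> w' (x \<otimes> y) z t)"
    using assms by (simp add: w_inverse)
  also have "\<dots> = w' x y (z \<otimes> t) \<cdot> w' (x \<otimes> y) z t \<cdot> (w x y (z \<otimes> t) \<cdot> w (x \<otimes> y) z t)"
    by (simp only: ac_simps)
  finally show "w' y z t \<cdot> w' x (y \<otimes> z) t \<cdot> w' x y z \<cdot> ?P = w' x y (z \<otimes> t) \<cdot> w' (x \<otimes> y) z t \<cdot> ?P"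
    using assms by (simp add: w_cocycle)
  show "invertible ?P" using assms by (intro invertible_mul invertible_w gmul_closed)
qed

lemma th_inv_swap:
  "h \<in> G \<Longrightarrow> g \<in> G \<Longrightarrow> th h g (ginv g) = th (h \<triangleleft> g) (ginv g) g"
  using th_cocycle[of h g "ginv g" g] by simp

text \<open>The scalar in the antipode \<open>S(\<phi> # x)(g) = \<phi>(x g\<inverse> x\<inverse>) \<kappa>(g, x) x\<inverse>\<close>: it is the one that makes
  \<open>\<alpha> = 1\<close> possible.  Then \<open>\<beta>(g) = \<omega>(g, g\<inverse>, g)\<close> is forced by the axioms.\<close>

definition ka :: "'g \<Rightarrow> 'g \<Rightarrow> 'c" where
  "ka g x = ga' x (ginv g \<triangleleft> ginv x) (g \<triangleleft> ginv x) \<cdot> th' g (ginv x) x"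

definition be :: "'g \<Rightarrow> 'c" where
  "be g = w g (ginv g) g"

lemma ka_inverse:
  assumes G: "g \<in> G" "x \<in> G"
  shows "ka g x \<cdot> (ga x (ginv g \<triangleleft> ginv x) (g \<triangleleft> ginv x) \<cdot> th g (ginv x) x) = \<one>"
proof -
  have "ka g x \<cdot> (ga x (ginv g \<triangleleft> ginv x) (g \<triangleleft> ginv x) \<cdot> th g (ginv x) x)
    = (ga x (ginv g \<triangleleft> ginv x) (g \<triangleleft> ginv x) \<cdot> ga' x (ginv g \<triangleleft> ginv x) (g \<triangleleft> ginv x))
      \<cdot> (th g (ginv x) x \<cdot> th' g (ginv x) x)"
    unfolding ka_def by (simp only: ac_simps)
  then show ?thesis using G by (simp add: ga_inverse th_inverse)
qed

lemma ka_one [simp]: "g \<in> G \<Longrightarrow> ka g gone = \<one>"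
  using ka_inverse[of g gone] by simp

text \<open>Quasi-coassociativity at \<open>(g, g\<inverse>, g)\<close> compares \<open>ga x g (ginv g)\<close> with \<open>ga x (ginv g) g\<close>.\<close>

lemma ka_beta:
  assumes G: "g \<in> G" "x \<in> G"
  shows "be (g \<triangleleft> x) \<cdot> ka (g \<triangleleft> x) x \<cdot> (ga x g (ginv g) \<cdot> th g x (ginv x)) = be g"
proof -
  have k: "ka (g \<triangleleft> x) x \<cdot> (ga x (ginv g) g \<cdot> th g x (ginv x)) = \<one>"
    using ka_inverse[of "g \<triangleleft> x" x] G by (simp add: ginv_cj th_inv_swap)
  have c: "ga x g (ginv g) \<cdot> be (g \<triangleleft> x) = ga x (ginv g) g \<cdot> be g"
    using ga_coassoc[of x g "ginv g" g] G by (simp add: be_def ginv_cj)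
  have "be (g \<triangleleft> x) \<cdot> ka (g \<triangleleft> x) x \<cdot> (ga x g (ginv g) \<cdot> th g x (ginv x))
    = (ga x g (ginv g) \<cdot> be (g \<triangleleft> x)) \<cdot> (ka (g \<triangleleft> x) x \<cdot> th g x (ginv x))"
    by (simp only: ac_simps)
  also have "\<dots> = be g \<cdot> (ka (g \<triangleleft> x) x \<cdot> (ga x (ginv g) g \<cdot> th g x (ginv x)))"
    unfolding c by (simp only: ac_simps)
  finally show ?thesis unfolding k by simp
qed

text \<open>The condition for the antipode to reverse products.  The factors \<open>ga\<close> cancel by
  compatibility, as \<open>a \<otimes> c\<close> is the unit, and what remains follows from the two-cocycle condition.\<close>

lemma ka_mult:
  assumes G: "g \<in> G" "x \<in> G" "y \<in> G"
  shows "th (ginv g \<triangleleft> ginv (x \<otimes> y)) x y \<cdot> ka g (x \<otimes> y)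
    = ka g y \<cdot> ka (g \<triangleleft> ginv y) x \<cdot> th g (ginv y) (ginv x)"
proof -
  define a c h where "a = ginv g \<triangleleft> ginv (x \<otimes> y)" and "c = g \<triangleleft> ginv (x \<otimes> y)" and "h = g \<triangleleft> ginv y"
  have ac: "a \<in> G" "c \<in> G" "h \<in> G" using G by (simp_all add: a_def c_def h_def)
  have ax: "a \<triangleleft> x = ginv g \<triangleleft> ginv y" "c \<triangleleft> x = h"
    using G by (simp_all add: a_def c_def h_def cj_cj ginv_gmul gassoc)
  have hx: "ginv h \<triangleleft> ginv x = a" "h \<triangleleft> ginv x = c"
    using G by (simp_all add: a_def c_def h_def cj_cj ginv_gmul ginv_cj)
  have ac1: "a \<otimes> c = gone" using G by (simp add: a_def c_def flip: gmul_cj)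
  define P Q R where "P = ga (x \<otimes> y) a c \<cdot> th g (ginv (x \<otimes> y)) (x \<otimes> y)"
    and "Q = ga y (a \<triangleleft> x) (c \<triangleleft> x) \<cdot> th g (ginv y) y" and "R = ga x a c \<cdot> th h (ginv x) x"
  have p: "ka g (x \<otimes> y) \<cdot> P = \<one>" using ka_inverse[of g "x \<otimes> y"] G by (simp add: P_def a_def c_def)
  have q: "ka g y \<cdot> Q = \<one>" using ka_inverse[of g y] G by (simp add: Q_def ax h_def)
  have r: "ka h x \<cdot> R = \<one>" using ka_inverse[of h x] ac G by (simp add: R_def hx)
  have t1: "th g (ginv y) (ginv x) \<cdot> th g (ginv (x \<otimes> y)) (x \<otimes> y) = th h (ginv x) (x \<otimes> y) \<cdot> th g (ginv y) y"
    using th_cocycle[of g "ginv y" "ginv x" "x \<otimes> y"] G by (simp add: ginv_gmul h_def)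
  have t2: "th h (ginv x) x = th c x y \<cdot> th h (ginv x) (x \<otimes> y)"
    using th_cocycle[of h "ginv x" x y] G ac by (simp add: hx)
  have t3: "th a x y \<cdot> th c x y \<cdot> ga x a c \<cdot> ga y (a \<triangleleft> x) (c \<triangleleft> x) = ga (x \<otimes> y) a c"
    using th_ga_compatible[of a c x y] G ac by (simp add: ac1)
  have m: "th a x y \<cdot> Q \<cdot> R = th g (ginv y) (ginv x) \<cdot> P"
  proof -
    have "th a x y \<cdot> Q \<cdot> R = (th a x y \<cdot> th c x y \<cdot> ga x a c \<cdot> ga y (a \<triangleleft> x) (c \<triangleleft> x))
        \<cdot> (th h (ginv x) (x \<otimes> y) \<cdot> th g (ginv y) y)"
      unfolding Q_def R_def t2 by (simp only: ac_simps)
    also have "\<dots> = th g (ginv y) (ginv x) \<cdot> P"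
      unfolding t3 P_def t1[symmetric] by (simp only: ac_simps)
    finally show ?thesis .
  qed
  have "th a x y \<cdot> ka g (x \<otimes> y) = th a x y \<cdot> ka g (x \<otimes> y) \<cdot> (ka g y \<cdot> Q) \<cdot> (ka h x \<cdot> R)"
    by (simp add: q r)
  also have "\<dots> = (th a x y \<cdot> Q \<cdot> R) \<cdot> (ka g (x \<otimes> y) \<cdot> ka g y \<cdot> ka h x)"
    by (simp only: ac_simps)
  also have "\<dots> = (ka g (x \<otimes> y) \<cdot> P) \<cdot> (ka g y \<cdot> ka h x \<cdot> th g (ginv y) (ginv x))"
    unfolding m by (simp only: ac_simps)
  finally show ?thesis unfolding p a_def h_def by simp
qed

end

section \<open>Commutative algebras and linear functionals over them\<close>

text \<open>A commutative algebra \<open>K\<close> over the field \<open>k\<close>, given by explicit operations on a type,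
  because the algebra used below has structure constants taken from \<open>H\<close>.\<close>

locale comm_alg = comm_monoid mul unit
  for mul :: "'c::ab_group_add \<Rightarrow> 'c \<Rightarrow> 'c" (infixl "\<cdot>" 70) and unit :: 'c ("\<one>") +
  fixes emb :: "'k::field \<Rightarrow> 'c"
  assumes distrib_right: "(a + c) \<cdot> e = a \<cdot> e + c \<cdot> e"
    and emb_add: "emb (r + s) = emb r + emb s"
    and emb_mult: "emb (r * s) = emb r \<cdot> emb s"
    and emb_1 [simp]: "emb 1 = \<one>"
begin

lemma distrib_left: "e \<cdot> (a + c) = e \<cdot> a + e \<cdot> c"
  by (metis commute distrib_right)

lemma mul_zero [simp]: "0 \<cdot> a = 0" "a \<cdot> 0 = 0"
  using distrib_right[of 0 0 a] distrib_left[of a 0 0] by simp_all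

lemma emb_0 [simp]: "emb 0 = 0"
  using emb_add[of 0 0] by simp

lemma emb_sum: "emb (sum f A) = (\<Sum>x\<in>A. emb (f x))"
  by (induction A rule: infinite_finite_induct) (simp_all add: emb_add)

lemma sum_mul_right: "sum f A \<cdot> c = (\<Sum>x\<in>A. f x \<cdot> c)"
  by (induction A rule: infinite_finite_induct) (simp_all add: distrib_right)

lemma sum_mul_left: "c \<cdot> sum f A = (\<Sum>x\<in>A. c \<cdot> f x)"
  by (induction A rule: infinite_finite_induct) (simp_all add: distrib_left)

text \<open>The value at \<open>f\<close> of the \<open>K\<close>-linear functional with coordinates \<open>U\<close>.  Nested occurrences
  behave like iterated integrals: they commute, and constant factors can be pulled out.\<close>

definition J :: "('p::finite \<Rightarrow> 'c) \<Rightarrow> ('p \<Rightarrow> 'c) \<Rightarrow> 'c" where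
  "J U f = (\<Sum>p\<in>UNIV. U p \<cdot> f p)"

lemma J_add: "J U (\<lambda>p. f p + g p) = J U f + J U g"
  by (simp add: J_def distrib_left sum.distrib)

lemma J_zero [simp]: "J U (\<lambda>p. 0) = 0"
  by (simp add: J_def)

lemma J_const_left: "J U (\<lambda>p. c \<cdot> f p) = c \<cdot> J U f"
  by (simp add: J_def sum_mul_left left_commute)

lemma J_const_right: "J U (\<lambda>p. f p \<cdot> c) = J U f \<cdot> c"
  by (simp add: J_def sum_mul_right assoc)

lemma J_swap: "J U (\<lambda>p. J V (\<lambda>q. f p q)) = J V (\<lambda>q. J U (\<lambda>p. f p q))"
  unfolding J_def sum_mul_left by (subst sum.swap) (simp only: left_commute)

lemma J_sum: "J U (\<lambda>p. \<Sum>x\<in>A. f p x) = (\<Sum>x\<in>A. J U (\<lambda>p. f p x))"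
  unfolding J_def sum_mul_left by (rule sum.swap)

lemma J_pair: "J (\<lambda>(p, q). U p \<cdot> V q) f = J U (\<lambda>p. J V (\<lambda>q. f (p, q)))"
  unfolding J_def UNIV_Times_UNIV[symmetric]
  by (simp add: sum.cartesian_product case_prod_unfold sum_mul_left assoc)

lemma J_axis: "J (\<lambda>p. if p = q then c else 0) f = c \<cdot> f q"
proof -
  have "J (\<lambda>p. if p = q then c else 0) f = (\<Sum>p\<in>UNIV. if p = q then c \<cdot> f p else 0)"
    unfolding J_def by (rule sum.cong) auto
  then show ?thesis by simp
qed

end

section \<open>The group of points of a cocommutative Hopf algebra\<close>

text \<open>\<open>H\<close> together with a commutative algebra \<open>K\<close>.  A family \<open>g :: 'n \<Rightarrow> 'c\<close> is read as the element
  \<open>\<Sum>\<^sub>i g\<^sub>i b\<^sub>i\<close> of \<open>K \<otimes> H\<close>, and \<open>I g F\<close> below is the value at it of the \<open>K\<close>-linear extension of \<open>F\<close>.\<close>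

locale hopf_points = cocommutative_hopf_algebra scale b mult one \<Delta> \<epsilon> S +
    comm_alg mul unit emb
  for scale :: "'k::field \<Rightarrow> 'a::ab_group_add \<Rightarrow> 'a" and b :: "'n::finite \<Rightarrow> 'a"
    and mult :: "'a \<Rightarrow> 'a \<Rightarrow> 'a" (infixl "\<odot>" 70) and one :: 'a
    and \<Delta> :: "'a \<Rightarrow> 'k ^ ('n \<times> 'n)" and \<epsilon> :: "'a \<Rightarrow> 'k" and S :: "'a \<Rightarrow> 'a"
    and mul :: "'c::ab_group_add \<Rightarrow> 'c \<Rightarrow> 'c" (infixl "\<cdot>" 70) and unit :: 'c ("\<one>")
    and emb :: "'k \<Rightarrow> 'c"
begin

definition lin :: "('a \<Rightarrow> 'c) \<Rightarrow> bool" where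
  "lin F \<longleftrightarrow> (\<forall>x y. F (x + y) = F x + F y) \<and> (\<forall>c x. F (scale c x) = emb c \<cdot> F x)"

lemma linD: "lin F \<Longrightarrow> F (x + y) = F x + F y" "lin F \<Longrightarrow> F (scale c x) = emb c \<cdot> F x"
  by (simp_all add: lin_def)

lemma lin_zero: "lin F \<Longrightarrow> F 0 = 0"
  using linD(1)[of F 0 0] by simp

lemma lin_sum: "lin F \<Longrightarrow> F (sum f A) = (\<Sum>x\<in>A. F (f x))"
  by (induction A rule: infinite_finite_induct) (simp_all add: lin_zero linD)

lemma lin_expand: "lin F \<Longrightarrow> F x = (\<Sum>i\<in>UNIV. emb (coord i x) \<cdot> F (b i))"
  by (subst sum_coord[of x, symmetric]) (simp only: lin_sum linD)

lemma lin_emb: "Vector_Spaces.linear scale (*) f \<Longrightarrow> lin (\<lambda>x. emb (f x))"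
  unfolding lin_def Vector_Spaces.linear_iff by (simp add: emb_add emb_mult)

lemma lin_const_right: "lin F \<Longrightarrow> lin (\<lambda>x. F x \<cdot> c)"
  unfolding lin_def by (simp add: distrib_right assoc)

lemma lin_J: "(\<And>p. lin (\<lambda>x. F x p)) \<Longrightarrow> lin (\<lambda>x. J U (F x))"
proof -
  assume F: "\<And>p. lin (\<lambda>x. F x p)"
  have "F (x + y) = (\<lambda>p. F x p + F y p)" "F (scale c x) = (\<lambda>p. emb c \<cdot> F x p)" for x y c
    using linD[OF F] by auto
  then show ?thesis by (simp add: lin_def J_add J_const_left)
qed

lemma coord_linear: "Vector_Spaces.linear scale (*) (coord i)"
proof -
  have "representation (range b) (x + y) (b i) =
      representation (range b) x (b i) + representation (range b) y (b i)" for x y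
    by (simp add: representation_add independent_Basis span_Basis)
  moreover have "representation (range b) (scale c x) (b i) = c * representation (range b) x (b i)" for c x
    by (simp add: representation_scale independent_Basis span_Basis)
  ultimately show ?thesis
    unfolding coord_def Vector_Spaces.linear_iff
    by (simp add: vector_space_axioms vector_space_over_itself.vector_space_axioms)
qed

lemma lin_coord: "lin (\<lambda>x. emb (coord i x))"
  by (rule lin_emb) (rule coord_linear)

text \<open>Sweedler notation with values in \<open>K\<close>.\<close>

definition swK :: "'a \<Rightarrow> ('a \<Rightarrow> 'a \<Rightarrow> 'c) \<Rightarrow> 'c" where
  "swK x F = (\<Sum>i\<in>UNIV. \<Sum>j\<in>UNIV. emb (\<Delta> x $ (i, j)) \<cdot> F (b i) (b j))"

lemma emb_sw2: "emb (sw2 (*) x F) = swK x (\<lambda>u v. emb (F u v))"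
  unfolding sw2_def lift2_def swK_def UNIV_Times_UNIV[symmetric]
  by (simp add: sum.cartesian_product case_prod_unfold emb_sum emb_mult)

lemma lin_sw2: "lin F \<Longrightarrow> F (sw2 scale x f) = swK x (\<lambda>u v. F (f u v))"
  unfolding sw2_def lift2_def swK_def UNIV_Times_UNIV[symmetric]
  by (simp add: sum.cartesian_product case_prod_unfold lin_sum linD)

lemma lin_swK: "lin (\<lambda>x. swK x F)"
proof -
  interpret d: Vector_Spaces.linear scale "(*s)" \<Delta> by (rule comult_linear)
  show ?thesis
    unfolding lin_def swK_def
    by (simp add: d.add d.scale emb_add emb_mult distrib_right sum.distrib sum_mul_left assoc)
qed

lemma swK_const_left: "swK x (\<lambda>u v. c \<cdot> F u v) = c \<cdot> swK x F"
  by (simp add: swK_def sum_mul_left left_commute)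

lemma J_swK: "J U (\<lambda>p. swK x (\<lambda>u v. F p u v)) = swK x (\<lambda>u v. J U (\<lambda>p. F p u v))"
  by (simp add: swK_def J_sum J_const_left)

definition I :: "('n \<Rightarrow> 'c) \<Rightarrow> ('a \<Rightarrow> 'c) \<Rightarrow> 'c" where
  "I g F = J g (\<lambda>i. F (b i))"

lemma I_const_left: "I g (\<lambda>a. c \<cdot> F a) = c \<cdot> I g F"
  and I_const_right: "I g (\<lambda>a. F a \<cdot> c) = I g F \<cdot> c"
  and I_swap: "I g (\<lambda>a. I h (\<lambda>d. H a d)) = I h (\<lambda>d. I g (\<lambda>a. H a d))"
  by (simp_all add: I_def J_const_left J_const_right) (rule J_swap)

lemma I_swK: "I g (\<lambda>a. swK x (\<lambda>u v. H a u v)) = swK x (\<lambda>u v. I g (\<lambda>a. H a u v))"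
  by (simp add: I_def J_swK)

lemma lin_I: "(\<And>a. lin (\<lambda>x. F x a)) \<Longrightarrow> lin (\<lambda>x. I g (F x))"
  unfolding I_def by (rule lin_J)

text \<open>The \<open>K\<close>-points of \<open>H\<close>: the group-like elements of \<open>K \<otimes> H\<close>.  For them Sweedler components may be
  replaced by copies of the element, which is what turns identities in \<open>H\<close> into identities in a
  group.  Only the values of \<open>F\<close> on the basis enter, so \<open>F\<close> may be an arbitrary function.\<close>

definition points :: "('n \<Rightarrow> 'c) set" where
  "points = {g. (\<forall>F. I g (\<lambda>a. swK a F) = I g (\<lambda>u. I g (\<lambda>v. F u v))) \<and> I g (\<lambda>a. emb (\<epsilon> a)) = \<one>}"

lemma I_split: "g \<in> points \<Longrightarrow> I g (\<lambda>a. swK a (\<lambda>u v. F u v)) = I g (\<lambda>u. I g (\<lambda>v. F u v))"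
  and I_counit: "g \<in> points \<Longrightarrow> I g (\<lambda>a. emb (\<epsilon> a)) = \<one>"
  by (auto simp: points_def)

text \<open>Any \<open>F\<close> agrees on the basis with its bilinear interpolation \<open>F'\<close>.\<close>

lemma pointsI:
  assumes "\<And>F. (\<And>u. lin (F u)) \<Longrightarrow> (\<And>v. lin (\<lambda>u. F u v)) \<Longrightarrow>
      I g (\<lambda>a. swK a F) = I g (\<lambda>u. I g (\<lambda>v. F u v))"
    and "I g (\<lambda>a. emb (\<epsilon> a)) = \<one>"
  shows "g \<in> points"
proof -
  have "I g (\<lambda>a. swK a F) = I g (\<lambda>u. I g (\<lambda>v. F u v))" for F
  proof -
    define F' where "F' u v = (\<Sum>i\<in>UNIV. \<Sum>j\<in>UNIV. emb (coord i u) \<cdot> emb (coord j v) \<cdot> F (b i) (b j))" for u v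
    have F'b: "F' (b i) (b j) = F (b i) (b j)" for i j
    proof -
      have "F' (b i) (b j) = (\<Sum>p\<in>UNIV. \<Sum>q\<in>UNIV. if p = i then (if q = j then F (b p) (b q) else 0) else 0)"
        unfolding F'_def by (rule sum.cong[OF refl], rule sum.cong[OF refl]) (simp add: coord_b)
      then show ?thesis by (simp add: sum.If_cases)
    qed
    have l: "lin (\<lambda>x. emb (coord i x) \<cdot> c)" for i c by (intro lin_const_right lin_coord)
    have add: "coord i (x + y) = coord i x + coord i y" and scl: "coord i (scale c x) = c * coord i x" for i x y c
      using coord_linear[of i] by (simp_all add: Vector_Spaces.linear_iff)
    have "lin (F' u)" for u
      unfolding F'_def lin_def
      by (simp add: add scl emb_add emb_mult distrib_left distrib_right sum.distrib sum_mul_left ac_simps)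
    moreover have "lin (\<lambda>u. F' u v)" for v
      unfolding F'_def lin_def
      by (simp add: add scl emb_add emb_mult distrib_left distrib_right sum.distrib sum_mul_left ac_simps)
    ultimately have "I g (\<lambda>a. swK a F') = I g (\<lambda>u. I g (\<lambda>v. F' u v))" by (rule assms(1))
    then show ?thesis by (simp add: I_def swK_def F'b)
  qed
  then show ?thesis using assms(2) by (simp add: points_def)
qed

lemma point_eqI:
  assumes "\<And>F. lin F \<Longrightarrow> I g F = I h F"
  shows "g = h"
proof
  fix i
  have "I g (\<lambda>x. emb (coord i x)) = g i" for g
  proof -
    have "I g (\<lambda>x. emb (coord i x)) = (\<Sum>p\<in>UNIV. if p = i then g p else 0)"
      unfolding I_def J_def by (rule sum.cong) (auto simp: coord_b)
    then show ?thesis by simp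
  qed
  then show "g i = h i" using assms[OF lin_coord[of i]] by simp
qed

definition pmul :: "('n \<Rightarrow> 'c) \<Rightarrow> ('n \<Rightarrow> 'c) \<Rightarrow> 'n \<Rightarrow> 'c" (infixl "\<otimes>" 70) where
  "(g \<otimes> h) i = I g (\<lambda>a. I h (\<lambda>d. emb (coord i (a \<odot> d))))"

definition pinv :: "('n \<Rightarrow> 'c) \<Rightarrow> 'n \<Rightarrow> 'c" where
  "pinv g i = I g (\<lambda>a. emb (coord i (S a)))"

definition pone :: "'n \<Rightarrow> 'c" where
  "pone i = emb (coord i one)"

lemma I_pmul: "lin F \<Longrightarrow> I (g \<otimes> h) F = I g (\<lambda>a. I h (\<lambda>d. F (a \<odot> d)))"
proof -
  assume F: "lin F"
  have "I (g \<otimes> h) F = (\<Sum>i\<in>UNIV. I g (\<lambda>a. I h (\<lambda>d. emb (coord i (a \<odot> d)) \<cdot> F (b i))))"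
    by (subst I_def) (simp add: pmul_def J_def I_const_right)
  also have "\<dots> = I g (\<lambda>a. I h (\<lambda>d. F (a \<odot> d)))"
    by (subst lin_expand[OF F, of "_ \<odot> _"]) (simp add: I_def J_sum)
  finally show ?thesis .
qed

lemma I_pinv: "lin F \<Longrightarrow> I (pinv g) F = I g (\<lambda>a. F (S a))"
proof -
  assume F: "lin F"
  have "I (pinv g) F = (\<Sum>i\<in>UNIV. I g (\<lambda>a. emb (coord i (S a)) \<cdot> F (b i)))"
    by (subst I_def) (simp add: pinv_def J_def I_const_right)
  also have "\<dots> = I g (\<lambda>a. F (S a))"
    by (subst lin_expand[OF F, of "S _"]) (simp add: I_def J_sum)
  finally show ?thesis .
qed

lemma I_pone: "lin F \<Longrightarrow> I pone F = F one"
  using lin_expand[of F one] by (simp add: I_def J_def pone_def)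

lemma counit_lin: "lin (\<lambda>x. emb (\<epsilon> x))"
  by (rule lin_emb) (rule counit_linear)

lemma mult_rules:
  "(x + y) \<odot> z = x \<odot> z + y \<odot> z" "z \<odot> (x + y) = z \<odot> x + z \<odot> y"
  "scale c x \<odot> z = scale c (x \<odot> z)" "z \<odot> scale c x = scale c (z \<odot> x)"
  "S (x + y) = S x + S y" "S (scale c x) = scale c (S x)"
  "\<epsilon> (x + y) = \<epsilon> x + \<epsilon> y" "\<epsilon> (scale c x) = c * \<epsilon> x"
  "coord i (x + y) = coord i x + coord i y" "coord i (scale c x) = c * coord i x"
  using mult_linear_left mult_linear_right antipode_linear counit_linear coord_linear[of i]
  by (simp_all add: Vector_Spaces.linear_iff)

lemma I_add: "I g (\<lambda>a. F a + F' a) = I g F + I g F'"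
  by (simp add: I_def J_add)

lemma swK_rules:
  "swK (x + y) F = swK x F + swK y F" "swK (scale c x) F = emb c \<cdot> swK x F"
  using lin_swK by (auto simp: lin_def)

lemma swK_add: "swK x (\<lambda>u v. F u v + F' u v) = swK x F + swK x F'"
  by (simp add: swK_def distrib_left sum.distrib)

text \<open>Rewriting with these rules decides whether an expression is linear in a variable.\<close>

lemmas lin_rules = lin_def mult_rules I_add I_const_left swK_rules swK_add swK_const_left
  emb_add emb_mult distrib_left distrib_right assoc left_commute

definition arr2 :: "'k ^ ('n \<times> 'n) \<Rightarrow> ('a \<Rightarrow> 'a \<Rightarrow> 'c) \<Rightarrow> 'c" where
  "arr2 t F = (\<Sum>p\<in>UNIV. emb (t $ p) \<cdot> F (b (fst p)) (b (snd p)))"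

lemma swK_arr2: "swK x F = arr2 (\<Delta> x) F"
  unfolding swK_def arr2_def UNIV_Times_UNIV[symmetric]
  by (simp add: sum.cartesian_product case_prod_unfold)

lemma arr2_tensor2:
  assumes "\<And>u. lin (F u)" "\<And>v. lin (\<lambda>u. F u v)"
  shows "arr2 (tensor2 u v) F = F u v"
proof -
  have "F u v = (\<Sum>i\<in>UNIV. emb (coord i u) \<cdot> (\<Sum>j\<in>UNIV. emb (coord j v) \<cdot> F (b i) (b j)))"
    by (simp add: lin_expand[OF assms(2), of u v] lin_expand[OF assms(1), of _ v, symmetric])
  then show ?thesis
    unfolding arr2_def UNIV_Times_UNIV[symmetric]
    by (simp add: sum.cartesian_product case_prod_unfold tensor2_def emb_mult sum_mul_left assoc)
qed

lemma arr2_lift2: "arr2 (lift2 (*s) t f) F = arr2 t (\<lambda>u v. arr2 (f u v) F)"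
proof -
  have "arr2 (lift2 (*s) t f) F
      = (\<Sum>p\<in>UNIV. \<Sum>q\<in>UNIV. emb (t $ q) \<cdot> (emb (f (b (fst q)) (b (snd q)) $ p) \<cdot> F (b (fst p)) (b (snd p))))"
    unfolding arr2_def lift2_def
    by (simp add: case_prod_unfold emb_sum emb_mult sum_mul_right assoc)
  also have "\<dots> = arr2 t (\<lambda>u v. arr2 (f u v) F)"
    unfolding arr2_def sum_mul_left by (rule sum.swap)
  finally show ?thesis .
qed

lemma swK_mult:
  assumes "\<And>u. lin (F u)" "\<And>v. lin (\<lambda>u. F u v)"
  shows "swK (x \<odot> y) F = swK x (\<lambda>u v. swK y (\<lambda>s t. F (u \<odot> s) (v \<odot> t)))"
  unfolding swK_arr2 comult_mult mult2_def arr2_lift2 using arr2_tensor2[OF assms] by simp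

lemma swK_one:
  assumes "\<And>u. lin (F u)" "\<And>v. lin (\<lambda>u. F u v)"
  shows "swK one F = F one one"
  unfolding swK_arr2 comult_one by (rule arr2_tensor2[OF assms])

lemma pmul_closed:
  assumes g: "g \<in> points" and h: "h \<in> points"
  shows "g \<otimes> h \<in> points"
proof (rule pointsI)
  fix F :: "'a \<Rightarrow> 'a \<Rightarrow> 'c"
  assume F: "\<And>u. lin (F u)" "\<And>v. lin (\<lambda>u. F u v)"
  have "I (g \<otimes> h) (\<lambda>a. swK a F) = I g (\<lambda>a. I h (\<lambda>d. swK a (\<lambda>u v. swK d (\<lambda>s t. F (u \<odot> s) (v \<odot> t)))))"
    by (simp add: I_pmul lin_swK swK_mult[OF F])
  also have "\<dots> = I g (\<lambda>u. I g (\<lambda>v. I h (\<lambda>s. I h (\<lambda>t. F (u \<odot> s) (v \<odot> t)))))"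
    by (simp add: I_swK I_split g h)
  also have "\<dots> = I g (\<lambda>u. I h (\<lambda>s. I g (\<lambda>v. I h (\<lambda>t. F (u \<odot> s) (v \<odot> t)))))"
    by (subst I_swap[of g h]) rule
  also have "\<dots> = I (g \<otimes> h) (\<lambda>u. I (g \<otimes> h) (F u))"
    by (simp add: I_pmul F lin_I)
  finally show "I (g \<otimes> h) (\<lambda>a. swK a F) = I (g \<otimes> h) (\<lambda>u. I (g \<otimes> h) (F u))" .
next
  show "I (g \<otimes> h) (\<lambda>a. emb (\<epsilon> a)) = \<one>"
    by (simp add: I_pmul counit_lin counit_mult emb_mult I_const_left I_counit g h)
qed

lemma I_inverse_left:
  assumes g: "g \<in> points" and F: "lin F"
  shows "I g (\<lambda>a. I g (\<lambda>d. F (S a \<odot> d))) = F one"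
proof -
  have "I g (\<lambda>a. I g (\<lambda>d. F (S a \<odot> d))) = I g (\<lambda>a. F (sw2 scale a (\<lambda>u v. S u \<odot> v)))"
    by (simp add: lin_sw2[OF F] I_split[OF g])
  also have "\<dots> = F one"
    by (simp add: sw2_def antipode_left linD[OF F] I_const_right I_counit[OF g])
  finally show ?thesis .
qed

lemma I_inverse_right:
  assumes g: "g \<in> points" and F: "lin F"
  shows "I g (\<lambda>a. I g (\<lambda>d. F (a \<odot> S d))) = F one"
proof -
  have "I g (\<lambda>a. I g (\<lambda>d. F (a \<odot> S d))) = I g (\<lambda>a. F (sw2 scale a (\<lambda>u v. u \<odot> S v)))"
    by (simp add: lin_sw2[OF F] I_split[OF g])
  also have "\<dots> = F one"
    by (simp add: sw2_def antipode_right linD[OF F] I_const_right I_counit[OF g])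
  finally show ?thesis .
qed

text \<open>For a group-like \<open>g\<close>, both \<open>\<Delta>(S g)\<close> and \<open>S g \<otimes> S g\<close> are inverse to \<open>\<Delta>(g) = g \<otimes> g\<close>.  The proof
  computes \<open>\<Delta>(S g) (g \<otimes> g) (S g \<otimes> S g)\<close> in two ways.\<close>

lemma pinv_closed:
  assumes g: "g \<in> points"
  shows "pinv g \<in> points"
proof (rule pointsI)
  fix F :: "'a \<Rightarrow> 'a \<Rightarrow> 'c"
  assume F: "\<And>u. lin (F u)" "\<And>v. lin (\<lambda>u. F u v)"
  note Fr = linD[OF F(1)] linD[OF F(2)]
  \<comment> \<open>the linear functional computing the product with \<open>S g \<otimes> S g\<close> on the right\<close>
  define f where "f z d e = swK z (\<lambda>u v. F (u \<odot> S d) (v \<odot> S e))" for z d e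
  have fl: "lin (\<lambda>z. I g (\<lambda>d. I g (\<lambda>e. f z d e)))"
    unfolding f_def by (simp add: lin_rules Fr)
  have "I g (\<lambda>a. I g (\<lambda>c. I g (\<lambda>d. I g (\<lambda>e. f (S a \<odot> c) d e)))) = I g (\<lambda>d. I g (\<lambda>e. f one d e))"
    by (rule I_inverse_left[OF g fl])
  also have "\<dots> = I g (\<lambda>d. I g (\<lambda>e. F (S d) (S e)))"
    unfolding f_def by (subst swK_one) (simp_all add: lin_rules Fr one_left)
  finally have 1: "I g (\<lambda>a. I g (\<lambda>c. I g (\<lambda>d. I g (\<lambda>e. f (S a \<odot> c) d e))))
    = I g (\<lambda>d. I g (\<lambda>e. F (S d) (S e)))" .
  have 2: "I g (\<lambda>c. I g (\<lambda>d. I g (\<lambda>e. f (S a \<odot> c) d e))) = swK (S a) F" for a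
  proof -
    have "f (x \<odot> y) d e = swK x (\<lambda>u v. swK y (\<lambda>s t. F (u \<odot> (s \<odot> S d)) (v \<odot> (t \<odot> S e))))" for x y d e
      unfolding f_def by (subst swK_mult) (simp_all add: lin_rules Fr mult_assoc)
    then have "I g (\<lambda>c. I g (\<lambda>d. I g (\<lambda>e. f (S a \<odot> c) d e)))
      = swK (S a) (\<lambda>u v. I g (\<lambda>c. swK c (\<lambda>s t. I g (\<lambda>d. I g (\<lambda>e. F (u \<odot> (s \<odot> S d)) (v \<odot> (t \<odot> S e)))))))"
      by (simp add: I_swK)
    also have "\<dots> = swK (S a) (\<lambda>u v. I g (\<lambda>s. I g (\<lambda>t. I g (\<lambda>d. I g (\<lambda>e. F (u \<odot> (s \<odot> S d)) (v \<odot> (t \<odot> S e)))))))"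
      by (simp add: I_split g)
    also have "\<dots> = swK (S a) (\<lambda>u v. I g (\<lambda>s. I g (\<lambda>d. I g (\<lambda>t. I g (\<lambda>e. F (u \<odot> (s \<odot> S d)) (v \<odot> (t \<odot> S e)))))))"
      by (subst I_swap) rule
    also have "\<dots> = swK (S a) F"
    proof -
      have "I g (\<lambda>t. I g (\<lambda>e. F u (v \<odot> (t \<odot> S e)))) = F u v" for u v
        using I_inverse_right[OF g, of "\<lambda>z. F u (v \<odot> z)"] by (simp add: lin_rules Fr one_right)
      moreover have "I g (\<lambda>t. I g (\<lambda>e. F (u \<odot> (t \<odot> S e)) v)) = F u v" for u v
        using I_inverse_right[OF g, of "\<lambda>z. F (u \<odot> z) v"] by (simp add: lin_rules Fr one_right)
      ultimately show ?thesis by simp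
    qed
    finally show ?thesis .
  qed
  have "I (pinv g) (\<lambda>a. swK a F) = I g (\<lambda>a. swK (S a) F)"
    by (simp add: I_pinv lin_swK)
  also have "\<dots> = I g (\<lambda>d. I g (\<lambda>e. F (S d) (S e)))"
    using 1 unfolding 2 .
  also have "\<dots> = I (pinv g) (\<lambda>u. I (pinv g) (F u))"
    by (simp add: I_pinv F lin_I)
  finally show "I (pinv g) (\<lambda>a. swK a F) = I (pinv g) (\<lambda>u. I (pinv g) (F u))" .
next
  have "I g (\<lambda>a. emb (\<epsilon> (S a))) = I g (\<lambda>a. I g (\<lambda>d. emb (\<epsilon> (S a \<odot> d))))"
    by (simp add: counit_mult emb_mult I_const_left I_counit g)
  also have "\<dots> = \<one>"
    by (simp add: I_inverse_left[OF g counit_lin] counit_one)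
  finally show "I (pinv g) (\<lambda>a. emb (\<epsilon> a)) = \<one>"
    by (simp add: I_pinv counit_lin)
qed

lemma pone_closed: "pone \<in> points"
  by (rule pointsI) (simp_all add: I_pone lin_swK swK_one lin_I counit_lin counit_one)

lemma pmul_assoc: "g \<otimes> h \<otimes> k = g \<otimes> (h \<otimes> k)"
proof (rule point_eqI)
  fix F assume F: "lin F"
  show "I (g \<otimes> h \<otimes> k) F = I (g \<otimes> (h \<otimes> k)) F"
    by (simp add: I_pmul lin_rules linD[OF F] mult_assoc)
qed

lemma pone_left: "pone \<otimes> g = g"
proof (rule point_eqI)
  fix F assume F: "lin F"
  show "I (pone \<otimes> g) F = I g F"
    by (simp add: I_pmul I_pone lin_rules linD[OF F] one_left)
qed

lemma pinv_left:
  assumes g: "g \<in> points"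
  shows "pinv g \<otimes> g = pone"
proof (rule point_eqI)
  fix F assume F: "lin F"
  show "I (pinv g \<otimes> g) F = I pone F"
    by (simp add: I_pmul I_pinv I_pone lin_rules linD[OF F] I_inverse_left[OF g F])
qed

end

section \<open>The cocycle at points\<close>

text \<open>\<open>K\<close> is assumed to contain four points that are generic: the products of one coordinate of each
  are linearly independent over \<open>k\<close>.  Multilinear identities in \<open>H\<close> can then be tested at points.\<close>

locale generic_points = normalized_3cocycle scale b mult one \<Delta> \<epsilon> S \<omega> +
    hopf_points scale b mult one \<Delta> \<epsilon> S mul unit emb
  for scale :: "'k::field \<Rightarrow> 'a::ab_group_add \<Rightarrow> 'a" and b :: "'n::finite \<Rightarrow> 'a"
    and mult :: "'a \<Rightarrow> 'a \<Rightarrow> 'a" (infixl "\<odot>" 70) and one :: 'a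
    and \<Delta> :: "'a \<Rightarrow> 'k ^ ('n \<times> 'n)" and \<epsilon> :: "'a \<Rightarrow> 'k" and S :: "'a \<Rightarrow> 'a"
    and \<omega> :: "'a \<Rightarrow> 'a \<Rightarrow> 'a \<Rightarrow> 'k"
    and mul :: "'c::ab_group_add \<Rightarrow> 'c \<Rightarrow> 'c" (infixl "\<cdot>" 70) and unit :: 'c ("\<one>")
    and emb :: "'k \<Rightarrow> 'c" +
  fixes \<xi>1 \<xi>2 \<xi>3 \<xi>4 :: "'n \<Rightarrow> 'c"
  assumes generic_closed [simp]: "\<xi>1 \<in> points" "\<xi>2 \<in> points" "\<xi>3 \<in> points" "\<xi>4 \<in> points"
    and generic4: "J \<xi>1 (\<lambda>i. J \<xi>2 (\<lambda>j. J \<xi>3 (\<lambda>l. J \<xi>4 (\<lambda>m. emb (f i j l m))))) =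
      J \<xi>1 (\<lambda>i. J \<xi>2 (\<lambda>j. J \<xi>3 (\<lambda>l. J \<xi>4 (\<lambda>m. emb (f' i j l m))))) \<Longrightarrow> f i j l m = f' i j l m"
begin

lemma J_sum_point: "g \<in> points \<Longrightarrow> J g (\<lambda>i. emb (\<epsilon> (b i)) \<cdot> c) = c"
  using I_counit[of g] by (simp add: J_const_right I_def)

lemma counit_basis_nonzero: obtains m where "\<epsilon> (b m) \<noteq> 0"
proof (rule ccontr)
  assume "\<not> thesis"
  then have "\<epsilon> (b m) = 0" for m using that by blast
  then have "\<epsilon> one = 0" using linear_expand[OF counit_linear, of one] by simp
  then show False by (simp add: counit_one)
qed

text \<open>A dummy factor \<open>\<epsilon>\<close> reduces fewer generic points to four.\<close>

lemma generic3:
  assumes "J \<xi>1 (\<lambda>i. J \<xi>2 (\<lambda>j. J \<xi>3 (\<lambda>l. emb (f i j l)))) =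
      J \<xi>1 (\<lambda>i. J \<xi>2 (\<lambda>j. J \<xi>3 (\<lambda>l. emb (f' i j l))))"
  shows "f i j l = f' i j l"
proof -
  obtain m where m: "\<epsilon> (b m) \<noteq> 0" by (rule counit_basis_nonzero)
  have "\<epsilon> (b m) * f i j l = \<epsilon> (b m) * f' i j l"
    by (rule generic4[where f = "\<lambda>i j l m. \<epsilon> (b m) * f i j l" and f' = "\<lambda>i j l m. \<epsilon> (b m) * f' i j l"])
       (simp add: emb_mult J_sum_point assms)
  then show ?thesis using m by simp
qed

text \<open>The value of a trilinear form at three points.\<close>

definition at3 :: "('a \<Rightarrow> 'a \<Rightarrow> 'a \<Rightarrow> 'k) \<Rightarrow> ('n \<Rightarrow> 'c) \<Rightarrow> ('n \<Rightarrow> 'c) \<Rightarrow> ('n \<Rightarrow> 'c) \<Rightarrow> 'c" where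
  "at3 f g h k = I g (\<lambda>a. I h (\<lambda>c. I k (\<lambda>d. emb (f a c d))))"

lemma trilinear_rules:
  assumes "trilinear f"
  shows "f (x + x') y z = f x y z + f x' y z" "f (scale c x) y z = c * f x y z"
    "f x (y + y') z = f x y z + f x y' z" "f x (scale c y) z = c * f x y z"
    "f x y (z + z') = f x y z + f x y z'" "f x y (scale c z) = c * f x y z"
  using assms unfolding trilinear_def Vector_Spaces.linear_iff by simp_all

lemma trilinear_eqI:
  assumes "trilinear f" "trilinear f'" "at3 f \<xi>1 \<xi>2 \<xi>3 = at3 f' \<xi>1 \<xi>2 \<xi>3"
  shows "f = f'"
proof -
  have e: "f (b i) (b j) (b l) = f' (b i) (b j) (b l)" for i j l
    by (rule generic3[of "\<lambda>i j l. f (b i) (b j) (b l)" "\<lambda>i j l. f' (b i) (b j) (b l)"])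
       (use assms(3) in \<open>unfold at3_def I_def\<close>)
  have exp: "f x y z = (\<Sum>i\<in>UNIV. coord i x * (\<Sum>j\<in>UNIV. coord j y * (\<Sum>l\<in>UNIV. coord l z * f (b i) (b j) (b l))))"
    if "trilinear f" for f x y z
  proof -
    have 1: "f x y z = (\<Sum>i\<in>UNIV. coord i x * f (b i) y z)" for x y z
      by (rule linear_expand[of "(*)" "\<lambda>x. f x y z"]) (use that in \<open>simp add: trilinear_def\<close>)
    have 2: "f x y z = (\<Sum>i\<in>UNIV. coord i y * f x (b i) z)" for x y z
      by (rule linear_expand[of "(*)" "\<lambda>y. f x y z"]) (use that in \<open>simp add: trilinear_def\<close>)
    have 3: "f x y z = (\<Sum>i\<in>UNIV. coord i z * f x y (b i))" for x y z
      by (rule linear_expand[of "(*)" "\<lambda>z. f x y z"]) (use that in \<open>simp add: trilinear_def\<close>)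
    show ?thesis by (simp only: 3[symmetric] 2[symmetric] 1[symmetric])
  qed
  show ?thesis
    by (intro ext, subst exp[OF assms(1)], subst exp[OF assms(2)]) (simp only: e)
qed

lemma at3_conv3: "x \<in> points \<Longrightarrow> y \<in> points \<Longrightarrow> z \<in> points \<Longrightarrow>
    at3 (conv3 f f') x y z = at3 f x y z \<cdot> at3 f' x y z"
  unfolding at3_def conv3_def
  by (simp add: emb_sw2 I_swK I_split emb_mult I_const_left I_const_right)

lemma at3_counit: "x \<in> points \<Longrightarrow> y \<in> points \<Longrightarrow> z \<in> points \<Longrightarrow>
    at3 (\<lambda>x y z. \<epsilon> x * \<epsilon> y * \<epsilon> z) x y z = \<one>"
  unfolding at3_def by (simp add: emb_mult I_const_left I_const_right I_counit)

lemma at3_inverse: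
  assumes "conv_inverse3 f f'" "x \<in> points" "y \<in> points" "z \<in> points"
  shows "at3 f x y z \<cdot> at3 f' x y z = \<one>"
proof -
  have "conv3 f f' = (\<lambda>x y z. \<epsilon> x * \<epsilon> y * \<epsilon> z)"
    using assms(1) by (intro ext) (simp add: conv_inverse3_def)
  then show ?thesis using at3_conv3[OF assms(2-4)] at3_counit[OF assms(2-4)] by metis
qed

text \<open>At points a convolution inverse is an inverse in \<open>K\<close>, hence unique; by genericity it is unique
  as a form.  So the definite description \<open>omega_inv\<close> denotes it.\<close>

lemma omega_inv: "conv_inverse3 \<omega> omega_inv"
proof -
  obtain f where f: "conv_inverse3 \<omega> f" using omega_invertible by blast
  have "f' = f" if f': "conv_inverse3 \<omega> f'" for f'
  proof (rule trilinear_eqI)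
    show "trilinear f'" "trilinear f" using f f' by (auto simp: conv_inverse3_def)
    have 1: "at3 \<omega> \<xi>1 \<xi>2 \<xi>3 \<cdot> at3 f \<xi>1 \<xi>2 \<xi>3 = \<one>" by (rule at3_inverse[OF f]) simp_all
    have 2: "at3 \<omega> \<xi>1 \<xi>2 \<xi>3 \<cdot> at3 f' \<xi>1 \<xi>2 \<xi>3 = \<one>" by (rule at3_inverse[OF f']) simp_all
    have "at3 f' \<xi>1 \<xi>2 \<xi>3 = at3 f' \<xi>1 \<xi>2 \<xi>3 \<cdot> (at3 \<omega> \<xi>1 \<xi>2 \<xi>3 \<cdot> at3 f \<xi>1 \<xi>2 \<xi>3)"
      by (simp add: 1)
    also have "\<dots> = at3 f \<xi>1 \<xi>2 \<xi>3"
      using 2 by (metis assoc commute left_neutral)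
    finally show "at3 f' \<xi>1 \<xi>2 \<xi>3 = at3 f \<xi>1 \<xi>2 \<xi>3" .
  qed
  then show ?thesis unfolding omega_inv_def using f by (metis the_equality)
qed

abbreviation "W \<equiv> at3 \<omega>"
abbreviation "W' \<equiv> at3 omega_inv"

lemmas omega_rules = trilinear_rules[OF omega_trilinear]
lemma omega_inv_trilinear: "trilinear omega_inv"
  using omega_inv by (simp add: conv_inverse3_def)
lemmas omega_inv_rules = trilinear_rules[OF omega_inv_trilinear]

lemma W_cocycle:
  assumes "x \<in> points" "y \<in> points" "z \<in> points" "t \<in> points"
  shows "W x y (z \<otimes> t) \<cdot> W (x \<otimes> y) z t = W y z t \<cdot> W x (y \<otimes> z) t \<cdot> W x y z"
proof -
  let ?L = "\<lambda>x y z t. sw2 (*) x (\<lambda>x1 x2. sw2 (*) y (\<lambda>y1 y2. sw2 (*) z (\<lambda>z1 z2. sw2 (*) t (\<lambda>t1 t2.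
         \<omega> x1 y1 (z1 \<odot> t1) * \<omega> (x2 \<odot> y2) z2 t2))))"
  let ?R = "\<lambda>x y z t. sw2 (*) x (\<lambda>x1 x2. sw3 (*) y (\<lambda>y1 y2 y3. sw3 (*) z (\<lambda>z1 z2 z3. sw2 (*) t (\<lambda>t1 t2.
         \<omega> y1 z1 t1 * \<omega> x1 (y2 \<odot> z2) t2 * \<omega> x2 y3 z3))))"
  have "I x (\<lambda>a. I y (\<lambda>c. I z (\<lambda>d. I t (\<lambda>e. emb (?L a c d e)))))
    = I x (\<lambda>a. I y (\<lambda>c. I z (\<lambda>d. I t (\<lambda>e. emb (\<omega> a c (d \<odot> e))))))
      \<cdot> I x (\<lambda>a. I y (\<lambda>c. I z (\<lambda>d. I t (\<lambda>e. emb (\<omega> (a \<odot> c) d e)))))"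
    by (simp add: emb_sw2 I_swK I_split assms emb_mult I_const_left I_const_right)
  also have "\<dots> = W x y (z \<otimes> t) \<cdot> W (x \<otimes> y) z t"
    by (simp add: at3_def I_pmul lin_rules omega_rules)
  finally have 1: "I x (\<lambda>a. I y (\<lambda>c. I z (\<lambda>d. I t (\<lambda>e. emb (?L a c d e)))))
    = W x y (z \<otimes> t) \<cdot> W (x \<otimes> y) z t" .
  have "I x (\<lambda>a. I y (\<lambda>c. I z (\<lambda>d. I t (\<lambda>e. emb (?R a c d e)))))
    = I y (\<lambda>c. I z (\<lambda>d. I t (\<lambda>e. emb (\<omega> c d e))))
      \<cdot> I x (\<lambda>a. I y (\<lambda>c. I z (\<lambda>d. I t (\<lambda>e. emb (\<omega> a (c \<odot> d) e)))))
      \<cdot> I x (\<lambda>a. I y (\<lambda>c. I z (\<lambda>d. emb (\<omega> a c d))))"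
    by (simp add: sw3_def emb_sw2 I_swK I_split assms emb_mult I_const_left I_const_right)
  also have "\<dots> = W y z t \<cdot> W x (y \<otimes> z) t \<cdot> W x y z"
    by (simp add: at3_def I_pmul lin_rules omega_rules)
  finally show ?thesis unfolding omega_cocycle 1[symmetric] .
qed

lemma W_one:
  assumes "x \<in> points" "y \<in> points"
  shows "W pone x y = \<one>" "W x pone y = \<one>" "W x y pone = \<one>"
  by (simp_all add: at3_def I_pone lin_rules omega_rules omega_one1 omega_one2 omega_one3
      I_const_right I_counit assms)

sublocale group_3cocycle mul unit points pmul pinv pone W W'
  by unfold_locales
     (simp_all add: pmul_closed pinv_closed pone_closed pmul_assoc pone_left pinv_left W_one
       at3_inverse[OF omega_inv] W_cocycle)

notation cj (infixl "\<triangleleft>" 71)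

text \<open>Conjugation of points is the action \<open>\<lhd>\<close> of \<open>H\<close>.\<close>

lemma I_cj:
  assumes "lin F" and x: "x \<in> points"
  shows "I (g \<triangleleft> x) F = I g (\<lambda>a. I x (\<lambda>c. F (a \<lhd> c)))"
proof -
  note F = linD[OF assms(1)]
  have "I (g \<triangleleft> x) F = I x (\<lambda>u. I g (\<lambda>a. I x (\<lambda>v. F (S u \<odot> a \<odot> v))))"
    by (simp add: cj_def I_pmul I_pinv lin_rules F mult_assoc)
  also have "\<dots> = I g (\<lambda>a. I x (\<lambda>c. F (a \<lhd> c)))"
    unfolding conj_act_def by (subst I_swap) (simp add: lin_sw2[OF assms(1)] I_split x)
  finally show ?thesis .
qed

lemma conj_act_rules:
  "(g + h) \<lhd> x = g \<lhd> x + h \<lhd> x" "scale c g \<lhd> x = scale c (g \<lhd> x)"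
  "g \<lhd> (x + y) = g \<lhd> x + g \<lhd> y" "g \<lhd> scale c x = scale c (g \<lhd> x)"
proof -
  interpret d: Vector_Spaces.linear scale "(*s)" \<Delta> by (rule comult_linear)
  show "(g + h) \<lhd> x = g \<lhd> x + h \<lhd> x" "scale c g \<lhd> x = scale c (g \<lhd> x)"
    "g \<lhd> (x + y) = g \<lhd> x + g \<lhd> y" "g \<lhd> scale c x = scale c (g \<lhd> x)"
    unfolding conj_act_def sw2_def lift2_def
    by (simp_all add: case_prod_unfold mult_rules scale_right_distrib scale_left_distrib sum.distrib scale_sum_right
        d.add d.scale mult.commute)
qed

lemma at3_conj_product:
  assumes f: "trilinear f" and G: "g \<in> points" "x \<in> points" "y \<in> points"
  shows "at3 (\<lambda>g x y. sw2 (*) x (\<lambda>x1 x2. sw2 (*) y (\<lambda>y1 y2. f x1 y1 (g \<lhd> (x2 \<odot> y2))))) g x y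
    = at3 f x y (g \<triangleleft> (x \<otimes> y))"
proof -
  note fr = trilinear_rules[OF f]
  have "at3 (\<lambda>g x y. sw2 (*) x (\<lambda>x1 x2. sw2 (*) y (\<lambda>y1 y2. f x1 y1 (g \<lhd> (x2 \<odot> y2))))) g x y
    = I g (\<lambda>a. I x (\<lambda>c. I x (\<lambda>c'. I y (\<lambda>d. I y (\<lambda>d'. emb (f c d (a \<lhd> (c' \<odot> d'))))))))"
    by (simp add: at3_def emb_sw2 I_swK I_split G)
  also have "\<dots> = I g (\<lambda>a. I x (\<lambda>c. I y (\<lambda>d. I x (\<lambda>c'. I y (\<lambda>d'. emb (f c d (a \<lhd> (c' \<odot> d'))))))))"
    by (subst (2) I_swap) rule
  also have "\<dots> = I g (\<lambda>a. I x (\<lambda>c. I y (\<lambda>d. I (x \<otimes> y) (\<lambda>e. emb (f c d (a \<lhd> e))))))"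
    by (simp add: I_pmul lin_rules conj_act_rules fr)
  also have "\<dots> = I x (\<lambda>c. I y (\<lambda>d. I g (\<lambda>a. I (x \<otimes> y) (\<lambda>e. emb (f c d (a \<lhd> e))))))"
    by (subst I_swap, subst (2) I_swap) rule
  also have "\<dots> = at3 f x y (g \<triangleleft> (x \<otimes> y))"
    by (simp add: at3_def I_cj lin_rules fr G)
  finally show ?thesis .
qed

lemma at3_conj2:
  assumes f: "trilinear f" and G: "g \<in> points" "x \<in> points" "y \<in> points"
  shows "at3 (\<lambda>g x y. sw2 (*) x (\<lambda>x1 x2. f x1 (g \<lhd> x2) y)) g x y = at3 f x (g \<triangleleft> x) y"
proof -
  have "at3 (\<lambda>g x y. sw2 (*) x (\<lambda>x1 x2. f x1 (g \<lhd> x2) y)) g x y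
    = I g (\<lambda>a. I x (\<lambda>c. I x (\<lambda>c'. I y (\<lambda>d. emb (f c (a \<lhd> c') d)))))"
    by (simp add: at3_def emb_sw2 I_swK I_split G)
  also have "\<dots> = I x (\<lambda>c. I g (\<lambda>a. I x (\<lambda>c'. I y (\<lambda>d. emb (f c (a \<lhd> c') d)))))"
    by (subst I_swap) rule
  also have "\<dots> = at3 f x (g \<triangleleft> x) y"
    by (simp add: at3_def I_cj lin_rules trilinear_rules[OF f] G)
  finally show ?thesis .
qed

lemma at3_theta:
  assumes G: "g \<in> points" "x \<in> points" "y \<in> points"
  shows "at3 theta g x y = th g x y"
proof -
  have "at3 theta g x y = W g x y
    \<cdot> at3 (\<lambda>g x y. sw2 (*) x (\<lambda>x1 x2. sw2 (*) y (\<lambda>y1 y2. \<omega> x1 y1 (g \<lhd> (x2 \<odot> y2))))) g x y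
    \<cdot> at3 (\<lambda>g x y. sw2 (*) x (\<lambda>x1 x2. omega_inv x1 (g \<lhd> x2) y)) g x y"
    unfolding at3_def theta_def
    by (simp add: sw3_def sw4_def sw5_def emb_sw2 I_swK I_split G emb_mult I_const_left I_const_right)
  then show ?thesis
    by (simp only: th_def at3_conj_product[OF omega_trilinear G] at3_conj2[OF omega_inv_trilinear G])
qed

lemma sw2_rules:
  "sw2 (*) (x + y) F = sw2 (*) x F + sw2 (*) y F"
  "sw2 (*) (scale c x) F = c * sw2 (*) x F"
  "sw2 (*) x (\<lambda>u v. F u v + F' u v) = sw2 (*) x F + sw2 (*) x F'"
  "sw2 (*) x (\<lambda>u v. c * F u v) = c * sw2 (*) x F"
proof -
  interpret d: Vector_Spaces.linear scale "(*s)" \<Delta> by (rule comult_linear)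
  show "sw2 (*) (x + y) F = sw2 (*) x F + sw2 (*) y F"
    "sw2 (*) (scale c x) F = c * sw2 (*) x F"
    "sw2 (*) x (\<lambda>u v. F u v + F' u v) = sw2 (*) x F + sw2 (*) x F'"
    "sw2 (*) x (\<lambda>u v. c * F u v) = c * sw2 (*) x F"
    unfolding sw2_def lift2_def
    by (simp_all add: case_prod_unfold d.add d.scale algebra_simps sum.distrib sum_distrib_left)
qed

lemma trilinearI:
  assumes "\<And>x x' y z. f (x + x') y z = f x y z + f x' y z" "\<And>c x y z. f (scale c x) y z = c * f x y z"
    "\<And>x y y' z. f x (y + y') z = f x y z + f x y' z" "\<And>c x y z. f x (scale c y) z = c * f x y z"
    "\<And>x y z z'. f x y (z + z') = f x y z + f x y z'" "\<And>c x y z. f x y (scale c z) = c * f x y z"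
  shows "trilinear f"
proof -
  have "vector_space ((*) :: 'k \<Rightarrow> 'k \<Rightarrow> 'k)" by unfold_locales (simp_all add: algebra_simps)
  then show ?thesis
    unfolding trilinear_def Vector_Spaces.linear_iff using vector_space_axioms by (simp add: assms)
qed

lemma conv3_trilinear: "trilinear (conv3 f f')"
  by (rule trilinearI) (simp_all add: conv3_def sw2_rules)

lemma theta_trilinear: "trilinear theta"
  by (rule trilinearI) (simp_all add: theta_def sw3_def sw4_def sw5_def sw2_rules)

text \<open>Forms on \<open>H\<close> whose values at points are the scalars \<open>th'\<close>, \<open>ga\<close>, \<open>ga'\<close> and \<open>ka\<close>.  The convolution
  product becomes the product of \<open>K\<close> at points, so each form is built factor by factor.\<close>

definition theta' :: "'a \<Rightarrow> 'a \<Rightarrow> 'a \<Rightarrow> 'k" where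
  "theta' = conv3 (conv3 omega_inv
      (\<lambda>g x y. sw2 (*) x (\<lambda>x1 x2. sw2 (*) y (\<lambda>y1 y2. omega_inv x1 y1 (g \<lhd> (x2 \<odot> y2))))))
      (\<lambda>g x y. sw2 (*) x (\<lambda>x1 x2. \<omega> x1 (g \<lhd> x2) y))"

definition gamma :: "'a \<Rightarrow> 'a \<Rightarrow> 'a \<Rightarrow> 'k" where
  "gamma = conv3 (conv3 (\<lambda>x g h. \<omega> g h x)
      (\<lambda>x g h. sw3 (*) x (\<lambda>x1 x2 x3. \<omega> x1 (g \<lhd> x2) (h \<lhd> x3))))
      (\<lambda>x g h. sw2 (*) x (\<lambda>x1 x2. omega_inv g x1 (h \<lhd> x2)))"

definition gamma' :: "'a \<Rightarrow> 'a \<Rightarrow> 'a \<Rightarrow> 'k" where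
  "gamma' = conv3 (conv3 (\<lambda>x g h. omega_inv g h x)
      (\<lambda>x g h. sw3 (*) x (\<lambda>x1 x2 x3. omega_inv x1 (g \<lhd> x2) (h \<lhd> x3))))
      (\<lambda>x g h. sw2 (*) x (\<lambda>x1 x2. \<omega> g x1 (h \<lhd> x2)))"

lemma theta'_trilinear: "trilinear theta'" and gamma_trilinear: "trilinear gamma"
  and gamma'_trilinear: "trilinear gamma'"
  by (simp_all add: theta'_def gamma_def gamma'_def conv3_trilinear)

lemmas gamma_rules = trilinear_rules[OF theta_trilinear] trilinear_rules[OF theta'_trilinear]
  trilinear_rules[OF gamma_trilinear] trilinear_rules[OF gamma'_trilinear]

lemma at3_theta':
  assumes "g \<in> points" "x \<in> points" "y \<in> points"
  shows "at3 theta' g x y = th' g x y"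
  unfolding theta'_def th'_def
  by (simp only: at3_conv3 assms at3_conj_product at3_conj2 omega_trilinear omega_inv_trilinear)

lemma at3_rotate:
  "at3 (\<lambda>x g h. f g h x) x g h = at3 f g h x"
  unfolding at3_def by (subst I_swap, subst (2) I_swap) rule

lemma at3_conj23:
  assumes "trilinear f" and x: "x \<in> points" and "g \<in> points" "h \<in> points"
  shows "at3 (\<lambda>x g h. sw3 (*) x (\<lambda>x1 x2 x3. f x1 (g \<lhd> x2) (h \<lhd> x3))) x g h
    = at3 f x (g \<triangleleft> x) (h \<triangleleft> x)"
proof -
  have "at3 (\<lambda>x g h. sw3 (*) x (\<lambda>x1 x2 x3. f x1 (g \<lhd> x2) (h \<lhd> x3))) x g h
    = I x (\<lambda>c. I x (\<lambda>c'. I x (\<lambda>c''. I g (\<lambda>a. I h (\<lambda>d. emb (f c (a \<lhd> c') (d \<lhd> c'')))))))"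
    by (simp add: at3_def sw3_def emb_sw2 I_swK I_split x)
  also have "\<dots> = I x (\<lambda>c. I g (\<lambda>a. I x (\<lambda>c'. I h (\<lambda>d. I x (\<lambda>c''. emb (f c (a \<lhd> c') (d \<lhd> c'')))))))"
    by (simp only: I_swap[of g x] I_swap[of h x])
  also have "\<dots> = at3 f x (g \<triangleleft> x) (h \<triangleleft> x)"
    by (simp add: at3_def I_cj lin_rules trilinear_rules[OF assms(1)] assms conj_act_rules)
  finally show ?thesis .
qed

lemma at3_conj3:
  assumes "trilinear f" and x: "x \<in> points" and "g \<in> points" "h \<in> points"
  shows "at3 (\<lambda>x g h. sw2 (*) x (\<lambda>x1 x2. f g x1 (h \<lhd> x2))) x g h = at3 f g x (h \<triangleleft> x)"
proof -
  have "at3 (\<lambda>x g h. sw2 (*) x (\<lambda>x1 x2. f g x1 (h \<lhd> x2))) x g h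
    = I x (\<lambda>c. I x (\<lambda>c'. I g (\<lambda>a. I h (\<lambda>d. emb (f a c (d \<lhd> c'))))))"
    by (simp add: at3_def emb_sw2 I_swK I_split x)
  also have "\<dots> = I g (\<lambda>a. I x (\<lambda>c. I h (\<lambda>d. I x (\<lambda>c'. emb (f a c (d \<lhd> c'))))))"
    by (simp only: I_swap[of g x] I_swap[of h x])
  also have "\<dots> = at3 f g x (h \<triangleleft> x)"
    by (simp add: at3_def I_cj lin_rules trilinear_rules[OF assms(1)] assms conj_act_rules)
  finally show ?thesis .
qed

lemma at3_gamma:
  assumes "x \<in> points" "g \<in> points" "h \<in> points"
  shows "at3 gamma x g h = ga x g h" "at3 gamma' x g h = ga' x g h"
  unfolding gamma_def gamma'_def ga_def ga'_def
  by (simp_all only: at3_conv3 assms at3_rotate[of \<omega>] at3_rotate[of omega_inv] at3_conj23 at3_conj3 omega_trilinear omega_inv_trilinear)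

definition at2 :: "('a \<Rightarrow> 'a \<Rightarrow> 'k) \<Rightarrow> ('n \<Rightarrow> 'c) \<Rightarrow> ('n \<Rightarrow> 'c) \<Rightarrow> 'c" where
  "at2 f g x = I g (\<lambda>a. I x (\<lambda>c. emb (f a c)))"

definition kappa1 :: "'a \<Rightarrow> 'a \<Rightarrow> 'k" where
  "kappa1 g x = sw2 (*) g (\<lambda>g1 g2. sw5 (*) x (\<lambda>x1 x2 x3 x4 x5.
     gamma' x1 (x2 \<odot> S g1 \<odot> S x3) (x4 \<odot> g2 \<odot> S x5)))"

definition kappa2 :: "'a \<Rightarrow> 'a \<Rightarrow> 'k" where
  "kappa2 g x = sw2 (*) x (\<lambda>x1 x2. theta' g (S x1) x2)"

definition kappa :: "'a \<Rightarrow> 'a \<Rightarrow> 'k" where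
  "kappa g x = sw2 (*) g (\<lambda>g1 g2. sw2 (*) x (\<lambda>x1 x2. kappa1 g1 x1 * kappa2 g2 x2))"

lemma at2_kappa:
  assumes g: "g \<in> points" and x: "x \<in> points"
  shows "at2 kappa g x = ga' x (pinv g \<triangleleft> pinv x) (g \<triangleleft> pinv x) \<cdot> th' g (pinv x) x"
proof -
  have 1: "at2 kappa1 g x = ga' x (pinv g \<triangleleft> pinv x) (g \<triangleleft> pinv x)"
  proof -
    have "at3 gamma' x (x \<otimes> pinv g \<otimes> pinv x) (x \<otimes> g \<otimes> pinv x)
      = I x (\<lambda>c1. I x (\<lambda>c2. I g (\<lambda>a1. I x (\<lambda>c3. I x (\<lambda>c4. I g (\<lambda>a2. I x (\<lambda>c5.
         emb (gamma' c1 (c2 \<odot> S a1 \<odot> S c3) (c4 \<odot> a2 \<odot> S c5)))))))))"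
      by (simp add: at3_def I_pmul I_pinv lin_rules gamma_rules)
    also have "\<dots> = at2 kappa1 g x"
      unfolding at2_def kappa1_def
      by (simp add: sw3_def sw4_def sw5_def emb_sw2 I_swK I_split g x I_swap[of g x])
    finally show ?thesis using g x at3_gamma(2) by (simp add: cj_def)
  qed
  have 2: "at2 kappa2 g x = th' g (pinv x) x"
  proof -
    have "at2 kappa2 g x = at3 theta' g (pinv x) x"
      unfolding at2_def kappa2_def
      by (simp add: emb_sw2 I_split x at3_def I_pinv lin_rules gamma_rules)
    then show ?thesis by (simp add: at3_theta' g x)
  qed
  have "at2 kappa g x = at2 kappa1 g x \<cdot> at2 kappa2 g x"
    unfolding at2_def kappa_def
    by (simp add: emb_sw2 I_swK I_split g x emb_mult I_const_left I_const_right)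
  then show ?thesis by (simp only: 1 2)
qed

end

section \<open>Arrays over a commutative algebra\<close>

lemma vec_expand_sum: "(\<Sum>p\<in>UNIV. (u $ p) * axis p (1::'k::field) $ q) = u $ q"
proof -
  have "(\<Sum>p\<in>UNIV. (u $ p) * axis p (1::'k) $ q) = (\<Sum>p\<in>UNIV. if p = q then u $ p else 0)"
    by (rule sum.cong) (auto simp: axis_def)
  then show ?thesis by simp
qed

text \<open>All spaces from here on are spaces of arrays \<open>k\<^sup>p\<close>, and tensor products multiply the index types.\<close>

definition tens :: "'k::field ^ 'p::finite \<Rightarrow> 'k ^ 'q::finite \<Rightarrow> 'k ^ ('p \<times> 'q)" where
  "tens u v = (\<chi> r. u $ fst r * v $ snd r)"

text \<open>(Bi)linearity of maps between spaces of arrays, expressed through the values on the basis.\<close>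

definition vlin :: "('k::field ^ 'p::finite \<Rightarrow> 'k ^ 'q::finite) \<Rightarrow> bool" where
  "vlin T \<longleftrightarrow> (\<forall>u q. T u $ q = (\<Sum>p\<in>UNIV. u $ p * T (axis p 1) $ q))"

definition vbil :: "('k::field ^ 'p::finite \<Rightarrow> 'k ^ 'q::finite \<Rightarrow> 'k ^ 'r::finite) \<Rightarrow> bool" where
  "vbil m \<longleftrightarrow> (\<forall>u v r. m u v $ r = (\<Sum>p\<in>UNIV. \<Sum>q\<in>UNIV. u $ p * v $ q * m (axis p 1) (axis q 1) $ r))"

lemma vlinD: "vlin T \<Longrightarrow> T u $ q = (\<Sum>p\<in>UNIV. u $ p * T (axis p 1) $ q)"
  unfolding vlin_def by blast

lemma vbilD:
  "vbil m \<Longrightarrow> m u v $ r = (\<Sum>p\<in>UNIV. \<Sum>q\<in>UNIV. u $ p * v $ q * m (axis p 1) (axis q 1) $ r)"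
  unfolding vbil_def by blast

lemma vlin_eqI:
  assumes "vlin T" "vlin T'" "\<And>p. T (axis p 1) = T' (axis p 1)"
  shows "T u = T' u"
  unfolding vec_eq_iff
proof
  fix q
  have "T u $ q = (\<Sum>p\<in>UNIV. u $ p * T (axis p 1) $ q)" by (rule vlinD[OF assms(1)])
  also have "\<dots> = (\<Sum>p\<in>UNIV. u $ p * T' (axis p 1) $ q)" by (simp only: assms(3))
  also have "\<dots> = T' u $ q" by (rule vlinD[OF assms(2), symmetric])
  finally show "T u $ q = T' u $ q" .
qed

lemma vlinI:
  fixes T :: "'k::field ^ 'p::finite \<Rightarrow> 'k ^ 'q::finite"
  assumes "\<And>u v. T (u + v) = T u + T v" "\<And>c u. T (c *s u) = c *s T u"
  shows "vlin T"
  unfolding vlin_def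
proof (intro allI)
  fix u q
  have z: "T 0 = 0" using assms(2)[of 0 0] by (simp add: vec_eq_iff)
  have s: "T (sum f A) = (\<Sum>p\<in>A. T (f p))" for f :: "'p \<Rightarrow> _" and A
    by (induction A rule: infinite_finite_induct) (simp_all add: z assms(1))
  have "T u = T (\<Sum>p\<in>UNIV. (u $ p) *s axis p 1)" by (simp add: basis_expansion)
  also have "\<dots> = (\<Sum>p\<in>UNIV. (u $ p) *s T (axis p 1))" by (simp only: s assms(2))
  finally show "T u $ q = (\<Sum>p\<in>UNIV. u $ p * T (axis p 1) $ q)" by simp
qed

lemma vlin_add: "vlin T \<Longrightarrow> T (u + v) = T u + T v"
proof -
  assume a: "vlin T"
  have e: "T u $ q = (\<Sum>p\<in>UNIV. u $ p * T (axis p 1) $ q)" for u q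
    by (rule vlinD[OF a])
  show ?thesis unfolding vec_eq_iff
    by (intro allI) (simp add: e[of "u + v"] e[of u] e[of v] distrib_right sum.distrib)
qed

lemma vlin_scale: "vlin T \<Longrightarrow> T (c *s u) = c *s T u"
proof -
  assume a: "vlin T"
  have e: "T u $ q = (\<Sum>p\<in>UNIV. u $ p * T (axis p 1) $ q)" for u q
    by (rule vlinD[OF a])
  show ?thesis unfolding vec_eq_iff
    by (intro allI) (simp add: e[of "c *s u"] e[of u] sum_distrib_left mult.assoc)
qed

lemma vlin_comp: "vlin T \<Longrightarrow> vlin T' \<Longrightarrow> vlin (\<lambda>u. T (T' u))"
  by (rule vlinI) (simp_all add: vlin_add vlin_scale)

lemma vbil_vlin: "vbil m \<Longrightarrow> vlin (m u)" "vbil m \<Longrightarrow> vlin (\<lambda>u. m u v)"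
proof -
  assume m: "vbil m"
  have e: "m u v $ r = (\<Sum>p\<in>UNIV. \<Sum>q\<in>UNIV. u $ p * v $ q * m (axis p 1) (axis q 1) $ r)" for u v r
    by (rule vbilD[OF m])
  show "vlin (m u)"
  proof (rule vlinI)
    show "m u (v + v') = m u v + m u v'" for v v'
      unfolding vec_eq_iff by (simp add: e[of u] algebra_simps sum.distrib)
    show "m u (c *s v) = c *s m u v" for c v
      unfolding vec_eq_iff by (simp add: e[of u] algebra_simps sum_distrib_left)
  qed
  show "vlin (\<lambda>u. m u v)"
  proof (rule vlinI)
    show "m (u + u') v = m u v + m u' v" for u u'
      unfolding vec_eq_iff by (simp add: e[of _ v] algebra_simps sum.distrib)
    show "m (c *s u) v = c *s m u v" for c u
      unfolding vec_eq_iff by (simp add: e[of _ v] algebra_simps sum_distrib_left)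
  qed
qed

lemma vbilI:
  assumes "\<And>u. vlin (m u)" "\<And>v. vlin (\<lambda>u. m u v)"
  shows "vbil m"
  unfolding vbil_def
proof (intro allI)
  fix u v r
  have "m u v $ r = (\<Sum>p\<in>UNIV. u $ p * m (axis p 1) v $ r)"
    by (rule vlinD[OF assms(2)])
  also have "\<dots> = (\<Sum>p\<in>UNIV. u $ p * (\<Sum>q\<in>UNIV. v $ q * m (axis p 1) (axis q 1) $ r))"
  proof -
    have "m (axis p 1) v $ r = (\<Sum>q\<in>UNIV. v $ q * m (axis p 1) (axis q 1) $ r)" for p
      by (rule vlinD[OF assms(1)])
    then show ?thesis by (simp only:)
  qed
  finally show "m u v $ r = (\<Sum>p\<in>UNIV. \<Sum>q\<in>UNIV. u $ p * v $ q * m (axis p 1) (axis q 1) $ r)"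
    by (simp add: sum_distrib_left mult.assoc)
qed

lemma vbil_eqI:
  assumes "vbil m" "vbil m'" "\<And>p q. m (axis p 1) (axis q 1) = m' (axis p 1) (axis q 1)"
  shows "m u v = m' u v"
proof -
  have "m u (axis q 1) = m' u (axis q 1)" for q
    by (rule vlin_eqI[OF vbil_vlin(2)[OF assms(1)] vbil_vlin(2)[OF assms(2)]]) (rule assms(3))
  then show ?thesis by (rule vlin_eqI[OF vbil_vlin(1)[OF assms(1)] vbil_vlin(1)[OF assms(2)]])
qed

text \<open>Associativity has to be checked only on the basis.\<close>

lemma vbil_assocI:
  assumes m: "vbil m"
    and a: "\<And>p q r. m (m (axis p 1) (axis q 1)) (axis r 1) = m (axis p 1) (m (axis q 1) (axis r 1))"
  shows "m (m u v) w = m u (m v w)"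
proof -
  note l = vbil_vlin[OF m]
  have 1: "m (m (axis p 1) (axis q 1)) w = m (axis p 1) (m (axis q 1) w)" for p q w
    by (rule vlin_eqI[OF l(1) vlin_comp[OF l(1) l(1)]]) (rule a)
  have 2: "m (m (axis p 1) v) w = m (axis p 1) (m v w)" for p v w
    by (rule vlin_eqI[OF vlin_comp[OF l(2) l(1)] vlin_comp[OF l(1) l(2)]]) (rule 1)
  show ?thesis
    by (rule vlin_eqI[OF vlin_comp[OF l(2) l(2)] l(2)]) (rule 2)
qed

context comm_alg begin

lemma J_scale: "J (\<lambda>a. c \<cdot> x a) f = c \<cdot> J x f"
  by (simp add: J_def sum_mul_left assoc)

lemma J_J: "J (\<lambda>r. J U (\<lambda>p. f p r)) h = J U (\<lambda>p. J (f p) h)"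
  unfolding J_def sum_mul_right sum_mul_left by (subst sum.swap) (simp only: assoc)

lemma J_prod_mul: "J (\<lambda>(p, q). U p \<cdot> V q) (\<lambda>(p, q). f p \<cdot> h q) = J U f \<cdot> J V h"
  by (simp add: J_pair J_const_left J_const_right)

text \<open>Arrays with entries in \<open>K\<close> are the elements of the scalar extension of \<open>k\<^sup>p\<close>.  Here \<open>cst\<close>
  embeds \<open>k\<^sup>p\<close>, \<open>av x u\<close> is the combination of the family \<open>u\<close> with coefficients \<open>x\<close> in \<open>K\<close>, and \<open>linK\<close>
  and \<open>biK\<close> extend scalars of a linear and of a bilinear map.\<close>

definition cst :: "'k ^ 'p::finite \<Rightarrow> 'p \<Rightarrow> 'c" where
  "cst t p = emb (t $ p)"

definition av :: "('j::finite \<Rightarrow> 'c) \<Rightarrow> ('j \<Rightarrow> 'k ^ 'p::finite) \<Rightarrow> 'p \<Rightarrow> 'c" where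
  "av x u p = J x (\<lambda>j. emb (u j $ p))"

definition linK :: "('k ^ 'p::finite \<Rightarrow> 'k ^ 'q::finite) \<Rightarrow> ('p \<Rightarrow> 'c) \<Rightarrow> 'q \<Rightarrow> 'c" where
  "linK T U q = J U (\<lambda>p. cst (T (axis p 1)) q)"

definition biK :: "('k ^ 'p::finite \<Rightarrow> 'k ^ 'q::finite \<Rightarrow> 'k ^ 'r::finite) \<Rightarrow> ('p \<Rightarrow> 'c) \<Rightarrow> ('q \<Rightarrow> 'c) \<Rightarrow> 'r \<Rightarrow> 'c" where
  "biK m U V r = J U (\<lambda>p. J V (\<lambda>q. cst (m (axis p 1) (axis q 1)) r))"

lemma cst_axis: "J (cst (axis p 1)) f = f p"
proof -
  have "J (cst (axis p 1)) f = (\<Sum>q\<in>UNIV. if q = p then f q else 0)"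
    unfolding J_def by (rule sum.cong) (auto simp: cst_def axis_def)
  then show ?thesis by simp
qed

lemma cst_tens: "cst (tens u v) = (\<lambda>(p, q). cst u p \<cdot> cst v q)"
  by (auto simp: cst_def tens_def emb_mult)

lemma cst_lin: "vlin T \<Longrightarrow> cst (T t) = linK T (cst t)"
proof
  fix q assume T: "vlin T"
  show "cst (T t) q = linK T (cst t) q"
    unfolding cst_def linK_def J_def by (subst vlinD[OF T]) (simp only: emb_sum emb_mult)
qed

lemma J_linK: "J (linK T U) f = J U (\<lambda>p. J (cst (T (axis p 1))) f)"
  unfolding linK_def by (rule J_J)

lemma J_biK: "J (biK m U V) f = J U (\<lambda>p. J V (\<lambda>q. J (cst (m (axis p 1) (axis q 1))) f))"
  unfolding biK_def J_J by (simp only: J_J)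

lemma cst_bil: "vbil m \<Longrightarrow> cst (m u v) = biK m (cst u) (cst v)"
proof
  fix r assume m: "vbil m"
  have "m u v $ r = (\<Sum>p\<in>UNIV. \<Sum>q\<in>UNIV. u $ p * v $ q * m (axis p 1) (axis q 1) $ r)"
    by (rule vbilD[OF m])
  then show "cst (m u v) r = biK m (cst u) (cst v) r"
    by (simp add: cst_def biK_def J_def emb_sum emb_mult sum_mul_left assoc)
qed

lemma J_av: "J (av x u) f = J x (\<lambda>j. J (cst (u j)) f)"
  unfolding av_def J_J cst_def[abs_def] ..

text \<open>Elements of \<open>D\<^sup>\<omega>(H)\<close> are functions on \<open>G\<close> with values in the group algebra of \<open>G\<close>, morally
  speaking.  The family \<open>E g\<close> describes evaluation at the object \<open>g\<close>, with values in \<open>K\<^sup>o\<close>, and \<open>V x\<close> is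
  the vector of the group element \<open>x\<close>.  Thus \<open>mon E V U g c x\<close> says that \<open>U(g) = c x\<close>.  All elements
  that matter have monomial values.\<close>

definition mon :: "('g \<Rightarrow> 'p::finite \<Rightarrow> 'o \<Rightarrow> 'c) \<Rightarrow> ('x \<Rightarrow> 'o \<Rightarrow> 'c) \<Rightarrow> ('p \<Rightarrow> 'c) \<Rightarrow> 'g \<Rightarrow> 'c \<Rightarrow> 'x \<Rightarrow> bool" where
  "mon E V U g c x \<longleftrightarrow> (\<forall>k. J U (\<lambda>p. E g p k) = c \<cdot> V x k)"

text \<open>Evaluation at pairs, for tensor products.\<close>

definition tE :: "('g \<Rightarrow> 'p \<Rightarrow> 'o \<Rightarrow> 'c) \<Rightarrow> ('h \<Rightarrow> 'q \<Rightarrow> 'o' \<Rightarrow> 'c) \<Rightarrow> 'g \<times> 'h \<Rightarrow> 'p \<times> 'q \<Rightarrow> 'o \<times> 'o' \<Rightarrow> 'c" where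
  "tE E E' = (\<lambda>(g, h) (p, q) (k, l). E g p k \<cdot> E' h q l)"

definition tV :: "('x \<Rightarrow> 'o \<Rightarrow> 'c) \<Rightarrow> ('y \<Rightarrow> 'o' \<Rightarrow> 'c) \<Rightarrow> 'x \<times> 'y \<Rightarrow> 'o \<times> 'o' \<Rightarrow> 'c" where
  "tV V V' = (\<lambda>(x, y) (k, l). V x k \<cdot> V' y l)"

text \<open>A condition on a bilinear product ensuring that monomial values multiply as in an action
  groupoid with multiplier: if \<open>U(g) = c x\<close> and \<open>U'(g x) = d y\<close>, where \<open>g x\<close> is \<open>act g x\<close>, then
  \<open>(U U')(g) = c d T(g; x, y) x y\<close>.  It is stated as a factorization of the structure constants:
  evaluating the product at \<open>g\<close> evaluates the left factor at \<open>g\<close> (first equation); if its value is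
  \<open>x\<close>, then the right factor is evaluated at \<open>g x\<close> (second); if that value is \<open>y\<close>, the result is the
  multiplier times \<open>x y\<close> (third).  Each equation is inherited by tensor products.\<close>

definition multiplicative ::
  "'g set \<Rightarrow> 'x set \<Rightarrow> ('k ^ 'p::finite \<Rightarrow> 'k ^ 'p \<Rightarrow> 'k ^ 'p) \<Rightarrow> ('g \<Rightarrow> 'p \<Rightarrow> 'o::finite \<Rightarrow> 'c) \<Rightarrow>
   ('x \<Rightarrow> 'o \<Rightarrow> 'c) \<Rightarrow> ('g \<Rightarrow> 'x \<Rightarrow> 'g) \<Rightarrow> ('g \<Rightarrow> 'x \<Rightarrow> 'x \<Rightarrow> 'c) \<Rightarrow> ('x \<Rightarrow> 'x \<Rightarrow> 'x) \<Rightarrow> bool" where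
  "multiplicative X Y m E V act T mu \<longleftrightarrow> (\<exists>M N.
    (\<forall>g\<in>X. \<forall>p q k. J (cst (m (axis p 1) (axis q 1))) (\<lambda>r. E g r k) = J (E g p) (\<lambda>a. M g a q k)) \<and>
    (\<forall>g\<in>X. \<forall>x\<in>Y. \<forall>q k. J (V x) (\<lambda>a. M g a q k) = J (E (act g x) q) (\<lambda>e. N g x e k)) \<and>
    (\<forall>g\<in>X. \<forall>x\<in>Y. \<forall>y\<in>Y. \<forall>k. J (V y) (\<lambda>e. N g x e k) = T g x y \<cdot> V (mu x y) k))"

lemma mon_biK:
  assumes m: "multiplicative X Y m E V act T mu" and "g \<in> X" "x \<in> Y" "y \<in> Y"
    and U: "mon E V U g c x" and U': "mon E V U' (act g x) d y"
  shows "mon E V (biK m U U') g (c \<cdot> d \<cdot> T g x y) (mu x y)"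
proof -
  from m obtain M N where
    M: "\<And>p q k. J (cst (m (axis p 1) (axis q 1))) (\<lambda>r. E g r k) = J (E g p) (\<lambda>a. M g a q k)" and
    N: "\<And>q k. J (V x) (\<lambda>a. M g a q k) = J (E (act g x) q) (\<lambda>e. N g x e k)" and
    T: "\<And>k. J (V y) (\<lambda>e. N g x e k) = T g x y \<cdot> V (mu x y) k"
    unfolding multiplicative_def using assms(2-4) by metis
  have u: "(\<lambda>a. J U (\<lambda>p. E g p a)) = (\<lambda>a. c \<cdot> V x a)" using U by (auto simp: mon_def)
  have u': "(\<lambda>e. J U' (\<lambda>q. E (act g x) q e)) = (\<lambda>e. d \<cdot> V y e)" using U' by (auto simp: mon_def)
  have "J (biK m U U') (\<lambda>r. E g r k) = (c \<cdot> d \<cdot> T g x y) \<cdot> V (mu x y) k" for k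
  proof -
    have "J (biK m U U') (\<lambda>r. E g r k) = J U (\<lambda>p. J U' (\<lambda>q. J (E g p) (\<lambda>a. M g a q k)))"
      by (simp only: J_biK M)
    also have "\<dots> = J U' (\<lambda>q. J U (\<lambda>p. J (E g p) (\<lambda>a. M g a q k)))"
      by (rule J_swap)
    also have "\<dots> = c \<cdot> J U' (\<lambda>q. J (E (act g x) q) (\<lambda>e. N g x e k))"
      by (simp only: J_J[symmetric] u J_scale N J_const_left)
    also have "\<dots> = (c \<cdot> d \<cdot> T g x y) \<cdot> V (mu x y) k"
      by (simp only: J_J[symmetric] u' J_scale T assoc)
    finally show ?thesis .
  qed
  then show ?thesis unfolding mon_def by blast
qed

text \<open>The factorizing arrays of the tensor product are the products of those of the factors.\<close>

lemma multiplicative_tens: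
  assumes m: "multiplicative X Y m E V act T mu" and m': "multiplicative X' Y' m' E' V' act' T' mu'"
    and m'': "\<And>p q r s. m'' (axis (p, q) 1) (axis (r, s) 1) =
      tens (m (axis p 1) (axis r 1)) (m' (axis q 1) (axis s 1))"
  shows "multiplicative (X \<times> X') (Y \<times> Y') m'' (tE E E') (tV V V')
    (\<lambda>(g, h) (x, y). (act g x, act' h y)) (\<lambda>(g, h) (x, x') (y, y'). T g x y \<cdot> T' h x' y')
    (\<lambda>(x, x') (y, y'). (mu x y, mu' x' y'))"
proof -
  from m obtain M N where
    M: "\<And>g p q k. g \<in> X \<Longrightarrow> J (cst (m (axis p 1) (axis q 1))) (\<lambda>r. E g r k) = J (E g p) (\<lambda>a. M g a q k)" and
    N: "\<And>g x q k. g \<in> X \<Longrightarrow> x \<in> Y \<Longrightarrow> J (V x) (\<lambda>a. M g a q k) = J (E (act g x) q) (\<lambda>e. N g x e k)" and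
    T: "\<And>g x y k. g \<in> X \<Longrightarrow> x \<in> Y \<Longrightarrow> y \<in> Y \<Longrightarrow> J (V y) (\<lambda>e. N g x e k) = T g x y \<cdot> V (mu x y) k"
    unfolding multiplicative_def by metis
  from m' obtain M' N' where
    M': "\<And>g p q k. g \<in> X' \<Longrightarrow> J (cst (m' (axis p 1) (axis q 1))) (\<lambda>r. E' g r k) = J (E' g p) (\<lambda>a. M' g a q k)" and
    N': "\<And>g x q k. g \<in> X' \<Longrightarrow> x \<in> Y' \<Longrightarrow> J (V' x) (\<lambda>a. M' g a q k) = J (E' (act' g x) q) (\<lambda>e. N' g x e k)" and
    T': "\<And>g x y k. g \<in> X' \<Longrightarrow> x \<in> Y' \<Longrightarrow> y \<in> Y' \<Longrightarrow> J (V' y) (\<lambda>e. N' g x e k) = T' g x y \<cdot> V' (mu' x y) k"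
    unfolding multiplicative_def by metis
  let ?M = "\<lambda>(g, h) (a, a') (q, q') (k, k'). M g a q k \<cdot> M' h a' q' k'"
  let ?N = "\<lambda>(g, h) (x, x') (e, e') (k, k'). N g x e k \<cdot> N' h x' e' k'"
  have s: "(\<lambda>r. case r of (x, y) \<Rightarrow> f x y) = (\<lambda>(x, y). f x y)" for f :: "'u \<Rightarrow> 'v \<Rightarrow> 'w" ..
  have "J (cst (m'' (axis p 1) (axis q 1))) (\<lambda>r. tE E E' g r k) = J (tE E E' g p) (\<lambda>a. ?M g a q k)"
    if "g \<in> X \<times> X'" for g p q k
    using that
    by (cases g, cases p, cases q, cases k)
       (simp add: m'' cst_tens tE_def J_prod_mul M M' case_prod_app flip: case_prod_beta)
  moreover have "J (tV V V' x) (\<lambda>a. ?M g a q k) = J (tE E E' ((\<lambda>(g, h) (x, y). (act g x, act' h y)) g x) q) (\<lambda>e. ?N g x e k)"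
    if "g \<in> X \<times> X'" "x \<in> Y \<times> Y'" for g x q k
    using that
    by (cases g, cases x, cases q, cases k)
       (simp add: tV_def tE_def J_prod_mul N N' case_prod_app flip: case_prod_beta)
  moreover have "J (tV V V' y) (\<lambda>e. ?N g x e k) =
      (\<lambda>(g, h) (x, x') (y, y'). T g x y \<cdot> T' h x' y') g x y \<cdot> tV V V' ((\<lambda>(x, x') (y, y'). (mu x y, mu' x' y')) x y) k"
    if "g \<in> X \<times> X'" "x \<in> Y \<times> Y'" "y \<in> Y \<times> Y'" for g x y k
    using that
    by (cases g, cases x, cases y, cases k)
       (simp add: tV_def J_prod_mul T T' case_prod_app flip: case_prod_beta, simp add: ac_simps)
  ultimately show ?thesis
    unfolding multiplicative_def by (intro exI[of _ ?M] exI[of _ ?N]) blast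
qed

end

text \<open>Every space of arrays with its standard basis is a space in the sense of \<open>fd_space\<close>; its tensor
  operations are those of \<open>tens\<close>.\<close>

interpretation arr: fd_space "(*s)" "\<lambda>p::'p::finite. axis p (1::'k::field)"
proof -
  have r: "range (\<lambda>p::'p. axis p (1::'k)) = cart_basis"
    by (auto simp: cart_basis_def)
  show "fd_space (*s) (\<lambda>p::'p. axis p (1::'k))"
  proof (unfold_locales, unfold r)
    show "finite (cart_basis :: ('k ^ 'p) set)" by (rule finite_cart_basis)
    show "vec.independent (cart_basis :: ('k ^ 'p) set)" by (rule independent_cart_basis)
    show "vec.span (cart_basis :: ('k ^ 'p) set) = UNIV" by (rule span_cart_basis)
    show "inj (\<lambda>p::'p. axis p (1::'k))" by (auto simp: inj_def axis_eq_axis)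
  qed
qed

lemma arr_coord: "arr.coord p u = u $ p"
proof -
  have "u $ p = (\<Sum>q\<in>UNIV. arr.coord q u *s axis q 1) $ p"
    by (simp only: arr.sum_coord)
  also have "\<dots> = arr.coord p u"
    by (simp add: vec_expand_sum[of "\<chi> q. arr.coord q u" p, simplified])
  finally show ?thesis ..
qed

lemma arr_tensor: "arr.tensor2 u v = tens u v" "arr.tensor3 u v w = tens u (tens v w)"
  "arr.tensor4 u v w z = tens u (tens v (tens w z))"
  by (simp_all add: vec_eq_iff arr.tensor2_def arr.tensor3_def arr.tensor4_def tens_def arr_coord mult.assoc)

lemma tens_axis: "tens (axis p 1) (axis q 1) = axis (p, q) (1::'k::field)"
  by (auto simp: vec_eq_iff tens_def axis_def)

lemma arr_lift_axis:
  "arr.lift2 (*s) (axis (p, q) 1) F = F (axis p 1) (axis q 1)"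
  "arr.lift3 (*s) (axis (p, q, r) 1) G = G (axis p 1) (axis q 1) (axis r 1)"
  "arr.lift4 (*s) (axis (p, q, r, s) 1) H = H (axis p 1) (axis q 1) (axis r 1) (axis s 1)"
proof -
  have "arr.lift2 (*s) (axis (p, q) 1) F
      = (\<Sum>r\<in>UNIV. if r = (p, q) then (case r of (i, j) \<Rightarrow> F (axis i 1) (axis j 1)) else 0)"
    unfolding arr.lift2_def by (rule sum.cong) (auto simp: axis_def split: if_splits)
  then show "arr.lift2 (*s) (axis (p, q) 1) F = F (axis p 1) (axis q 1)" by simp
  have "arr.lift3 (*s) (axis (p, q, r) 1) G
      = (\<Sum>s\<in>UNIV. if s = (p, q, r) then (case s of (i, j, l) \<Rightarrow> G (axis i 1) (axis j 1) (axis l 1)) else 0)"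
    unfolding arr.lift3_def by (rule sum.cong) (auto simp: axis_def split: if_splits)
  then show "arr.lift3 (*s) (axis (p, q, r) 1) G = G (axis p 1) (axis q 1) (axis r 1)" by simp
  have "arr.lift4 (*s) (axis (p, q, r, s) 1) H
      = (\<Sum>t\<in>UNIV. if t = (p, q, r, s) then (case t of (i, j, l, m) \<Rightarrow> H (axis i 1) (axis j 1) (axis l 1) (axis m 1)) else 0)"
    unfolding arr.lift4_def by (rule sum.cong) (auto simp: axis_def split: if_splits)
  then show "arr.lift4 (*s) (axis (p, q, r, s) 1) H = H (axis p 1) (axis q 1) (axis r 1) (axis s 1)" by simp
qed

lemma vlin_lift: "vlin (\<lambda>t. arr.lift2 (*s) t F)" "vlin (\<lambda>t. arr.lift3 (*s) t G)" "vlin (\<lambda>t. arr.lift4 (*s) t K)"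
  by (rule vlinI; simp add: arr.lift2_def arr.lift3_def arr.lift4_def case_prod_unfold
     vec.scale_left_distrib sum.distrib vec.scale_sum_right)+

lemma vlin_lift2_arg:
  assumes "\<And>x y. vlin (\<lambda>u. F u x y)"
  shows "vlin (\<lambda>u. arr.lift2 (*s) t (F u))"
  by (rule vlinI) (simp_all add: arr.lift2_def case_prod_unfold vlin_add[OF assms] vlin_scale[OF assms]
     vec.scale_right_distrib sum.distrib vec.scale_sum_right mult.commute)

lemma vlin_lift3_arg:
  assumes "\<And>x y z. vlin (\<lambda>u. F u x y z)"
  shows "vlin (\<lambda>u. arr.lift3 (*s) t (F u))"
  by (rule vlinI) (simp_all add: arr.lift3_def case_prod_unfold vlin_add[OF assms] vlin_scale[OF assms]
     vec.scale_right_distrib sum.distrib vec.scale_sum_right mult.commute)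

lemma vlin_lift4_arg:
  assumes "\<And>x y z w. vlin (\<lambda>u. F u x y z w)"
  shows "vlin (\<lambda>u. arr.lift4 (*s) t (F u))"
  by (rule vlinI) (simp_all add: arr.lift4_def case_prod_unfold vlin_add[OF assms] vlin_scale[OF assms]
     vec.scale_right_distrib sum.distrib vec.scale_sum_right mult.commute)

lemma vlin_tens: "vlin (tens u)" "vlin (\<lambda>u. tens u v)"
  by (rule vlinI; simp add: vec_eq_iff tens_def algebra_simps)+

lemma sum_UNIV_pair: "(\<Sum>p\<in>UNIV. f p) = (\<Sum>i\<in>UNIV. \<Sum>j\<in>UNIV. f (i, j))"
  unfolding UNIV_Times_UNIV[symmetric] sum.cartesian_product by simp

lemma vlin_id: "vlin (\<lambda>u. u)"
  by (rule vlinI) simp_all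

context comm_alg begin

lemma J_delta: "J x (\<lambda>j. if j = k then c else 0) = x k \<cdot> c"
proof -
  have "J x (\<lambda>j. if j = k then c else 0) = (\<Sum>j\<in>UNIV. if j = k then x j \<cdot> c else 0)"
    unfolding J_def by (rule sum.cong) auto
  then show ?thesis by simp
qed

lemma biK_J_left: "biK m (\<lambda>p. J x (\<lambda>j. U j p)) V = (\<lambda>r. J x (\<lambda>j. biK m (U j) V r))"
  unfolding biK_def J_J ..

lemma biK_J_right: "biK m U (\<lambda>p. J x (\<lambda>j. V j p)) = (\<lambda>r. J x (\<lambda>j. biK m U (V j) r))"
  unfolding biK_def J_J by (subst J_swap) rule

lemma linK_J: "linK T (\<lambda>p. J x (\<lambda>j. U j p)) = (\<lambda>r. J x (\<lambda>j. linK T (U j) r))"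
  unfolding linK_def J_J ..

lemma av_cst: "av x u = (\<lambda>p. J x (\<lambda>j. cst (u j) p))"
  by (simp add: av_def cst_def fun_eq_iff)

text \<open>Evaluation of elements of \<open>H\<^sup>* \<otimes> H\<close> at the point \<open>g\<close> in the first factor.\<close>

definition EE :: "('n \<Rightarrow> 'c) \<Rightarrow> 'n \<times> 'n \<Rightarrow> 'n \<Rightarrow> 'c" where
  "EE g = (\<lambda>(i, j) k. if j = k then g i else 0)"

lemma J_EE: "J U (\<lambda>p. EE g p k) = J g (\<lambda>i. U (i, k))" for g :: "'n::finite \<Rightarrow> 'c"
proof -
  have "J U (\<lambda>p. EE g p k) = (\<Sum>i\<in>UNIV. \<Sum>j\<in>UNIV. if j = k then U (i, j) \<cdot> g i else 0)"
    unfolding J_def sum_UNIV_pair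
    by (intro sum.cong refl) (auto simp: EE_def)
  then show ?thesis by (simp add: J_def commute)
qed

lemma J_EE_left: "J (EE g (i, j)) f = g i \<cdot> f j" for g :: "'n::finite \<Rightarrow> 'c"
  unfolding EE_def by (simp, subst J_axis[symmetric]) (simp add: eq_commute)

lemma J_tE: "J U (\<lambda>p. tE EE E (g, h) p (k, l)) = J g (\<lambda>i. J (\<lambda>q. U ((i, k), q)) (\<lambda>q. E h q l))"
  for g :: "'n::finite \<Rightarrow> 'c" and E :: "'h \<Rightarrow> 'q::finite \<Rightarrow> 'o \<Rightarrow> 'c"
proof -
  have "J U (\<lambda>p. tE EE E (g, h) p (k, l))
      = (\<Sum>p\<in>UNIV. \<Sum>q\<in>UNIV. U (p, q) \<cdot> (EE g p k \<cdot> E h q l))"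
    unfolding J_def by (subst sum_UNIV_pair)
       (simp add: tE_def)
  also have "\<dots> = J (\<lambda>p. J (\<lambda>q. U (p, q)) (\<lambda>q. E h q l)) (\<lambda>p. EE g p k)"
    by (simp add: J_def sum_mul_right sum_mul_left ac_simps)
  also have "\<dots> = J g (\<lambda>i. J (\<lambda>q. U ((i, k), q)) (\<lambda>q. E h q l))"
    by (rule J_EE)
  finally show ?thesis .
qed

end

section \<open>The algebra at points\<close>

context generic_points begin

text \<open>Evaluation on the tensor powers of \<open>H\<^sup>* \<otimes> H\<close>, and the vectors of tuples of points.\<close>

abbreviation "E1 \<equiv> (EE :: ('n \<Rightarrow> 'c) \<Rightarrow> 'n \<times> 'n \<Rightarrow> 'n \<Rightarrow> 'c)"
abbreviation "E2 \<equiv> tE E1 E1"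
abbreviation "E3 \<equiv> tE E1 E2"
abbreviation "E4 \<equiv> tE E1 E3"
abbreviation (input) "V1 \<equiv> (\<lambda>x. x) :: ('n \<Rightarrow> 'c) \<Rightarrow> 'n \<Rightarrow> 'c"
abbreviation "V2 \<equiv> tV V1 V1"
abbreviation "V3 \<equiv> tV V1 V2"
abbreviation "V4 \<equiv> tV V1 V3"

text \<open>The element \<open>coord i # x\<close> of the scalar extension, for a point \<open>x\<close>.\<close>

abbreviation (input) dl :: "('n \<Rightarrow> 'c) \<Rightarrow> 'n \<Rightarrow> 'n \<times> 'n \<Rightarrow> 'c" where
  "dl x i \<equiv> av x (\<lambda>j. axis (i, j) 1)"

lemma mon_dl: "mon E1 V1 (dl x i) g (g i) x"
  unfolding mon_def
proof
  fix k
  have "J (dl x i) (\<lambda>p. E1 g p k) = J x (\<lambda>j. if j = k then g i else 0)"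
    by (simp only: J_av cst_axis EE_def prod.case)
  then show "J (dl x i) (\<lambda>p. E1 g p k) = g i \<cdot> V1 x k"
    by (simp only: J_delta commute)
qed

text \<open>The separation principle.  Two families of tensors agree if, at points, their combinations have
  the same monomial values.  The digits count the parameters of the family and the tensor factors;
  each uses up one generic point.\<close>

lemma sep31:
  assumes "\<And>x y z g. x \<in> points \<Longrightarrow> y \<in> points \<Longrightarrow> z \<in> points \<Longrightarrow> g \<in> points \<Longrightarrow> \<exists>c w.
     mon E1 V1 (\<lambda>p. J x (\<lambda>j. J y (\<lambda>l. J z (\<lambda>m. cst (t j l m) p)))) g c w \<and>
     mon E1 V1 (\<lambda>p. J x (\<lambda>j. J y (\<lambda>l. J z (\<lambda>m. cst (t' j l m) p)))) g c w"
  shows "t j l m = t' j l m"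
proof -
  have "t j l m $ (i, k) = t' j l m $ (i, k)" for i k
    by (rule generic4[where f = "\<lambda>j l m i. t j l m $ (i, k)" and f' = "\<lambda>j l m i. t' j l m $ (i, k)"])
       (use assms[of \<xi>1 \<xi>2 \<xi>3 \<xi>4] in \<open>auto simp: mon_def J_J J_EE cst_def\<close>)
  then show ?thesis by (simp add: vec_eq_iff)
qed

lemma sep22:
  assumes "\<And>x y g h. x \<in> points \<Longrightarrow> y \<in> points \<Longrightarrow> g \<in> points \<Longrightarrow> h \<in> points \<Longrightarrow> \<exists>c w.
     mon E2 V2 (\<lambda>p. J x (\<lambda>j. J y (\<lambda>l. cst (t j l) p))) (g, h) c w \<and>
     mon E2 V2 (\<lambda>p. J x (\<lambda>j. J y (\<lambda>l. cst (t' j l) p))) (g, h) c w"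
  shows "t j l = t' j l"
proof -
  have "t j l $ ((i, k), (i', k')) = t' j l $ ((i, k), (i', k'))" for i k i' k'
    by (rule generic4[where f = "\<lambda>j l i i'. t j l $ ((i, k), (i', k'))" and f' = "\<lambda>j l i i'. t' j l $ ((i, k), (i', k'))"])
       (use assms[of \<xi>1 \<xi>2 \<xi>3 \<xi>4] in \<open>auto simp: mon_def J_J J_tE J_EE cst_def\<close>)
  then show ?thesis by (simp add: vec_eq_iff)
qed

lemma sep13:
  assumes "\<And>x g h k. x \<in> points \<Longrightarrow> g \<in> points \<Longrightarrow> h \<in> points \<Longrightarrow> k \<in> points \<Longrightarrow> \<exists>c w.
     mon E3 V3 (\<lambda>p. J x (\<lambda>j. cst (t j) p)) (g, h, k) c w \<and>
     mon E3 V3 (\<lambda>p. J x (\<lambda>j. cst (t' j) p)) (g, h, k) c w"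
  shows "t j = t' j"
proof -
  have "t j $ ((i, k), (i', k'), (i'', k'')) = t' j $ ((i, k), (i', k'), (i'', k''))" for i k i' k' i'' k''
    by (rule generic4[where f = "\<lambda>j i i' i''. t j $ ((i, k), (i', k'), (i'', k''))"
          and f' = "\<lambda>j i i' i''. t' j $ ((i, k), (i', k'), (i'', k''))"])
       (use assms[of \<xi>1 \<xi>2 \<xi>3 \<xi>4] in \<open>auto simp: mon_def J_J J_tE J_EE cst_def\<close>)
  then show ?thesis by (simp add: vec_eq_iff)
qed

lemma sep04:
  assumes "\<And>g h k l. g \<in> points \<Longrightarrow> h \<in> points \<Longrightarrow> k \<in> points \<Longrightarrow> l \<in> points \<Longrightarrow> \<exists>c w.
     mon E4 V4 (cst t) (g, h, k, l) c w \<and> mon E4 V4 (cst t') (g, h, k, l) c w"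
  shows "t = t'"
proof -
  have "t $ ((i, k), (i', k'), (i'', k''), (j, l)) = t' $ ((i, k), (i', k'), (i'', k''), (j, l))" for i k i' k' i'' k'' j l
    by (rule generic4[where f = "\<lambda>i i' i'' j. t $ ((i, k), (i', k'), (i'', k''), (j, l))"
          and f' = "\<lambda>i i' i'' j. t' $ ((i, k), (i', k'), (i'', k''), (j, l))"])
       (use assms[of \<xi>1 \<xi>2 \<xi>3 \<xi>4] in \<open>auto simp: mon_def J_tE J_EE cst_def\<close>)
  then show ?thesis by (simp add: vec_eq_iff)
qed

lemma sep21:
  assumes "\<And>x y g. x \<in> points \<Longrightarrow> y \<in> points \<Longrightarrow> g \<in> points \<Longrightarrow> \<exists>c w.
     mon E1 V1 (\<lambda>p. J x (\<lambda>j. J y (\<lambda>l. cst (t j l) p))) g c w \<and>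
     mon E1 V1 (\<lambda>p. J x (\<lambda>j. J y (\<lambda>l. cst (t' j l) p))) g c w"
  shows "t j l = t' j l"
proof -
  have "t j l $ (i, k) = t' j l $ (i, k)" for i k
    by (rule generic3[where f = "\<lambda>j l i. t j l $ (i, k)" and f' = "\<lambda>j l i. t' j l $ (i, k)"])
       (use assms[of \<xi>1 \<xi>2 \<xi>3] in \<open>auto simp: mon_def J_J J_EE cst_def\<close>)
  then show ?thesis by (simp add: vec_eq_iff)
qed

lemma sep12:
  assumes "\<And>x g h. x \<in> points \<Longrightarrow> g \<in> points \<Longrightarrow> h \<in> points \<Longrightarrow> \<exists>c w.
     mon E2 V2 (\<lambda>p. J x (\<lambda>j. cst (t j) p)) (g, h) c w \<and>
     mon E2 V2 (\<lambda>p. J x (\<lambda>j. cst (t' j) p)) (g, h) c w"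
  shows "t j = t' j"
proof -
  have "t j $ ((i, k), (i', k')) = t' j $ ((i, k), (i', k'))" for i k i' k'
    by (rule generic3[where f = "\<lambda>j i i'. t j $ ((i, k), (i', k'))" and f' = "\<lambda>j i i'. t' j $ ((i, k), (i', k'))"])
       (use assms[of \<xi>1 \<xi>2 \<xi>3] in \<open>auto simp: mon_def J_J J_tE J_EE cst_def\<close>)
  then show ?thesis by (simp add: vec_eq_iff)
qed

lemma sep03:
  assumes "\<And>g h k. g \<in> points \<Longrightarrow> h \<in> points \<Longrightarrow> k \<in> points \<Longrightarrow> \<exists>c w.
     mon E3 V3 (cst t) (g, h, k) c w \<and> mon E3 V3 (cst t') (g, h, k) c w"
  shows "t = t'"
proof -
  have "t $ ((i, k), (i', k'), (i'', k'')) = t' $ ((i, k), (i', k'), (i'', k''))" for i k i' k' i'' k''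
    by (rule generic3[where f = "\<lambda>i i' i''. t $ ((i, k), (i', k'), (i'', k''))"
          and f' = "\<lambda>i i' i''. t' $ ((i, k), (i', k'), (i'', k''))"])
       (use assms[of \<xi>1 \<xi>2 \<xi>3] in \<open>auto simp: mon_def J_tE J_EE cst_def\<close>)
  then show ?thesis by (simp add: vec_eq_iff)
qed

lemma generic2:
  assumes "J \<xi>1 (\<lambda>i. J \<xi>2 (\<lambda>j. emb (f i j))) = J \<xi>1 (\<lambda>i. J \<xi>2 (\<lambda>j. emb (f' i j)))"
  shows "f i j = f' i j"
proof -
  obtain m where m: "\<epsilon> (b m) \<noteq> 0" by (rule counit_basis_nonzero)
  have "\<epsilon> (b m) * f i j = \<epsilon> (b m) * f' i j"
    by (rule generic3[where f = "\<lambda>i j m. \<epsilon> (b m) * f i j" and f' = "\<lambda>i j m. \<epsilon> (b m) * f' i j"])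
       (simp add: emb_mult J_sum_point assms)
  then show ?thesis using m by simp
qed

lemma generic1:
  assumes "J \<xi>1 (\<lambda>i. emb (f i)) = J \<xi>1 (\<lambda>i. emb (f' i))"
  shows "f i = f' i"
proof -
  obtain m where m: "\<epsilon> (b m) \<noteq> 0" by (rule counit_basis_nonzero)
  have "\<epsilon> (b m) * f i = \<epsilon> (b m) * f' i"
    by (rule generic2[where f = "\<lambda>i m. \<epsilon> (b m) * f i" and f' = "\<lambda>i m. \<epsilon> (b m) * f' i"])
       (simp add: emb_mult J_sum_point assms)
  then show ?thesis using m by simp
qed

lemma sep02:
  assumes "\<And>g h. g \<in> points \<Longrightarrow> h \<in> points \<Longrightarrow> \<exists>c w.
     mon E2 V2 (cst t) (g, h) c w \<and> mon E2 V2 (cst t') (g, h) c w"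
  shows "t = t'"
proof -
  have "t $ ((i, k), (i', k')) = t' $ ((i, k), (i', k'))" for i k i' k'
    by (rule generic2[where f = "\<lambda>i i'. t $ ((i, k), (i', k'))" and f' = "\<lambda>i i'. t' $ ((i, k), (i', k'))"])
       (use assms[of \<xi>1 \<xi>2] in \<open>auto simp: mon_def J_tE J_EE cst_def\<close>)
  then show ?thesis by (simp add: vec_eq_iff)
qed

lemma sep11:
  assumes "\<And>x g. x \<in> points \<Longrightarrow> g \<in> points \<Longrightarrow> \<exists>c w.
     mon E1 V1 (\<lambda>p. J x (\<lambda>j. cst (t j) p)) g c w \<and>
     mon E1 V1 (\<lambda>p. J x (\<lambda>j. cst (t' j) p)) g c w"
  shows "t j = t' j"
proof -
  have "t j $ (i, k) = t' j $ (i, k)" for i k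
    by (rule generic2[where f = "\<lambda>j i. t j $ (i, k)" and f' = "\<lambda>j i. t' j $ (i, k)"])
       (use assms[of \<xi>1 \<xi>2] in \<open>auto simp: mon_def J_J J_EE cst_def\<close>)
  then show ?thesis by (simp add: vec_eq_iff)
qed

lemma sep01:
  assumes "\<And>g. g \<in> points \<Longrightarrow> \<exists>c w. mon E1 V1 (cst t) g c w \<and> mon E1 V1 (cst t') g c w"
  shows "t = t'"
proof -
  have "t $ (i, k) = t' $ (i, k)" for i k
    by (rule generic1[where f = "\<lambda>i. t $ (i, k)" and f' = "\<lambda>i. t' $ (i, k)"])
       (use assms[of \<xi>1] in \<open>auto simp: mon_def J_EE cst_def\<close>)
  then show ?thesis by (simp add: vec_eq_iff)
qed

lemma sw2_vec_component: "sw2 (*s) x F $ p = sw2 (*) x (\<lambda>u v. F u v $ p)"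
  unfolding sw2_def lift2_def by (simp add: case_prod_unfold)

lemma smash_axis: "coord i \<sharp> b j = axis (i, j) 1"
  by (auto simp: vec_eq_iff smash_def axis_def coord_b)

lemma D_mult_axis: "D_mult (axis (i, j) 1) (axis (l, m) 1) = smash_mult (coord i) (b j) (coord l) (b m)"
  by (simp only: smash_axis[symmetric] D_mult_smash[OF coord_linear coord_linear])

lemma vbil_D_mult: "vbil D_mult"
  unfolding vbil_def
proof (intro allI)
  fix u v r
  have "D_mult u v $ r = (\<Sum>p\<in>UNIV. \<Sum>q\<in>UNIV. u $ p * v $ q *
      smash_mult (coord (fst p)) (b (snd p)) (coord (fst q)) (b (snd q)) $ r)"
    unfolding D_mult_def by (simp add: case_prod_unfold)
  also have "\<dots> = (\<Sum>p\<in>UNIV. \<Sum>q\<in>UNIV. u $ p * v $ q * D_mult (axis p 1) (axis q 1) $ r)"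
    by (intro sum.cong refl) (simp flip: D_mult_axis)
  finally show "D_mult u v $ r = (\<Sum>p\<in>UNIV. \<Sum>q\<in>UNIV. u $ p * v $ q * D_mult (axis p 1) (axis q 1) $ r)" .
qed

lemma I_coord: "I g (\<lambda>x. emb (coord i x)) = g i"
proof -
  have "I g (\<lambda>x. emb (coord i x)) = (\<Sum>p\<in>UNIV. if p = i then g p else 0)"
    unfolding I_def J_def by (rule sum.cong) (auto simp: coord_b)
  then show ?thesis by simp
qed

text \<open>The product of \<open>D\<^sup>\<omega>(H)\<close> at points:
  \<open>((\<phi> # x) (\<psi> # y))(g) = \<phi>(g) \<psi>(g \<triangleleft> x) \<theta>(g; x, y) x y\<close>.  In \<open>N\<close> the first argument has already
  become a point, in \<open>M\<close> it is still an element of \<open>H\<close>.\<close>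

lemma D_multiplicative: "multiplicative points points D_mult E1 V1 cj th pmul"
proof -
  define N where "N g x m k = swK m (\<lambda>h1' h2'.
      I g (\<lambda>a. I x (\<lambda>h3. emb (theta a h3 h1'))) \<cdot> I x (\<lambda>h4. emb (coord k (h4 \<odot> h2'))))" for g x m k
  define M where "M g h l m k = swK h (\<lambda>h1 y. swK y (\<lambda>h2 y. swK y (\<lambda>h3 h4. swK m (\<lambda>h1' h2'.
      I g (\<lambda>a. emb (coord l (S h2 \<odot> (a \<odot> h1)))) \<cdot> (I g (\<lambda>a. emb (theta a h3 h1'))) \<cdot> emb (coord k (h4 \<odot> h2'))))))" for g h l m k
  have 1: "J (cst (D_mult (axis p 1) (axis q 1))) (\<lambda>r. E1 g r k) = J (E1 g p) (\<lambda>j. M g (b j) (fst q) (b (snd q)) k)"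
    if g: "g \<in> points" for g p q k
  proof -
    obtain i j where p: "p = (i, j)" by (cases p)
    obtain l m where q: "q = (l, m)" by (cases q)
    have "J (cst (D_mult (axis p 1) (axis q 1))) (\<lambda>r. E1 g r k)
      = I g (\<lambda>a. swK (b j) (\<lambda>h1 y. swK y (\<lambda>h2 y. swK y (\<lambda>h3 h4. swK (b m) (\<lambda>h1' h2'.
          swK a (\<lambda>y a3. swK y (\<lambda>a1 a2. emb (coord i a1) \<cdot> emb (coord l (S h2 \<odot> (a2 \<odot> h1))))
            \<cdot> emb (theta a3 h3 h1')) \<cdot> emb (coord k (h4 \<odot> h2')))))))"
      by (simp add: p q D_mult_axis J_EE cst_def smash_mult_def sw4_def sw3_def sw2_vec_component smash_def
        emb_sw2 emb_mult dual_mult_def left_hit_def right_hit_def sigma_def I_def)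
    also have "\<dots> = g i \<cdot> M g (b j) l (b m) k"
      unfolding M_def
      by (simp add: I_swK I_const_right I_const_left I_split g I_coord swK_const_left assoc)
    finally show ?thesis by (simp add: p q J_EE_left)
  qed
  have 2: "J (V1 x) (\<lambda>j. M g (b j) (fst q) (b (snd q)) k) = J (E1 (cj g x) q) (\<lambda>e. N g x (b e) k)"
    if g: "g \<in> points" and x: "x \<in> points" for g x q k
  proof -
    obtain l m where q: "q = (l, m)" by (cases q)
    have c: "I x (\<lambda>h1. I x (\<lambda>h2. I g (\<lambda>a. emb (coord l (S h2 \<odot> (a \<odot> h1)))))) = (cj g x) l"
    proof -
      have "(cj g x) l = I (cj g x) (\<lambda>e. emb (coord l e))" by (simp add: I_coord)
      also have "\<dots> = I x (\<lambda>h2. I g (\<lambda>a. I x (\<lambda>h1. emb (coord l (S h2 \<odot> (a \<odot> h1))))))"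
        by (simp add: cj_def I_pmul I_pinv lin_rules mult_assoc)
      also have "\<dots> = I x (\<lambda>h1. I x (\<lambda>h2. I g (\<lambda>a. emb (coord l (S h2 \<odot> (a \<odot> h1))))))"
        by (subst (2) I_swap, subst I_swap) rule
      finally show ?thesis by simp
    qed
    have "J (V1 x) (\<lambda>j. M g (b j) l (b m) k) = I x (\<lambda>h. M g h l (b m) k)"
      by (simp add: I_def)
    also have "\<dots> = (cj g x) l \<cdot> N g x (b m) k"
      unfolding M_def N_def
      by (simp add: I_swK I_split x I_const_left I_const_right swK_const_left c[symmetric] assoc) (simp add: I_swap[of x g])
    finally show ?thesis by (simp add: q J_EE_left)
  qed
  have 3: "J (V1 y) (\<lambda>e. N g x (b e) k) = th g x y \<cdot> V1 (x \<otimes> y) k"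
    if g: "g \<in> points" and x: "x \<in> points" and y: "y \<in> points" for g x y k
  proof -
    have "J (V1 y) (\<lambda>e. N g x (b e) k) = I y (\<lambda>e. N g x e k)"
      by (simp add: I_def)
    also have "\<dots> = I y (\<lambda>h. I g (\<lambda>a. I x (\<lambda>h3. emb (theta a h3 h)))) \<cdot> I y (\<lambda>h. I x (\<lambda>h4. emb (coord k (h4 \<odot> h))))"
      unfolding N_def by (simp add: I_split y I_const_left I_const_right)
    also have "I y (\<lambda>h. I g (\<lambda>a. I x (\<lambda>h3. emb (theta a h3 h)))) = th g x y"
      using at3_theta[OF g x y] unfolding at3_def by (simp add: I_swap[of y g] I_swap[of y x])
    also have "I y (\<lambda>h. I x (\<lambda>h4. emb (coord k (h4 \<odot> h)))) = (x \<otimes> y) k"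
      by (simp add: pmul_def I_swap[of y x])
    finally show ?thesis .
  qed
  show ?thesis
    unfolding multiplicative_def
    by (intro exI[of _ "\<lambda>g j q k. M g (b j) (fst q) (b (snd q)) k"] exI[of _ "\<lambda>g x e k. N g x (b e) k"])
       (use 1 2 3 in blast)
qed

lemma vlin_D_mult: "vlin (D_mult u)" "vlin (\<lambda>u. D_mult u v)"
  by (rule vbil_vlin[OF vbil_D_mult])+

lemmas mon1_mult = mon_biK[OF D_multiplicative]

lemma vlin_D_mult_comp:
  "vlin T \<Longrightarrow> vlin (\<lambda>u. D_mult (T u) v)" "vlin T \<Longrightarrow> vlin (\<lambda>u. D_mult v (T u))"
  by (rule vlin_comp[OF vlin_D_mult(2)], assumption) (rule vlin_comp[OF vlin_D_mult(1)], assumption)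

text \<open>Associativity is the two-cocycle condition for \<open>\<theta>\<close>.\<close>

lemma D_assoc_basis:
  "D_mult (D_mult (axis (i, j) 1) (axis (i', l) 1)) (axis (i'', m) 1) =
   D_mult (axis (i, j) 1) (D_mult (axis (i', l) 1) (axis (i'', m) 1))"
proof (rule sep31[of "\<lambda>j l m. D_mult (D_mult (axis (i, j) 1) (axis (i', l) 1)) (axis (i'', m) 1)"])
  fix x y z g assume G: "x \<in> points" "y \<in> points" "z \<in> points" "g \<in> points"
  have "mon E1 V1 (biK D_mult (biK D_mult (dl x i) (dl y i')) (dl z i'')) g
    (g i \<cdot> (cj g x) i' \<cdot> th g x y \<cdot> (cj g (x \<otimes> y)) i'' \<cdot> th g (x \<otimes> y) z) (x \<otimes> y \<otimes> z)"
    using G by (intro mon1_mult mon_dl gmul_closed)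
  moreover have "mon E1 V1 (biK D_mult (dl x i) (biK D_mult (dl y i') (dl z i''))) g
    (g i \<cdot> ((cj g x) i' \<cdot> (cj (cj g x) y) i'' \<cdot> th (cj g x) y z) \<cdot> th g x (y \<otimes> z)) (x \<otimes> (y \<otimes> z))"
    using G by (intro mon1_mult mon_dl gmul_closed cj_closed)
  moreover have "g i \<cdot> (cj g x) i' \<cdot> th g x y \<cdot> (cj g (x \<otimes> y)) i'' \<cdot> th g (x \<otimes> y) z
    = g i \<cdot> ((cj g x) i' \<cdot> (cj (cj g x) y) i'' \<cdot> th (cj g x) y z) \<cdot> th g x (y \<otimes> z)"
  proof -
    have "g i \<cdot> (cj g x) i' \<cdot> th g x y \<cdot> (cj g (x \<otimes> y)) i'' \<cdot> th g (x \<otimes> y) z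
      = g i \<cdot> (cj g x) i' \<cdot> (cj g (x \<otimes> y)) i'' \<cdot> (th g x y \<cdot> th g (x \<otimes> y) z)" by (simp only: ac_simps)
    also have "\<dots> = g i \<cdot> ((cj g x) i' \<cdot> (cj (cj g x) y) i'' \<cdot> th (cj g x) y z) \<cdot> th g x (y \<otimes> z)"
      using G by (simp only: th_cocycle cj_cj ac_simps)
    finally show ?thesis .
  qed
  ultimately show "\<exists>c w. mon E1 V1 (\<lambda>p. J x (\<lambda>j. J y (\<lambda>l. J z (\<lambda>m.
      cst (D_mult (D_mult (axis (i, j) 1) (axis (i', l) 1)) (axis (i'', m) 1)) p)))) g c w \<and>
    mon E1 V1 (\<lambda>p. J x (\<lambda>j. J y (\<lambda>l. J z (\<lambda>m.
      cst (D_mult (axis (i, j) 1) (D_mult (axis (i', l) 1) (axis (i'', m) 1))) p)))) g c w"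
    using G by (simp only: av_cst biK_J_left biK_J_right cst_bil[OF vbil_D_mult] gassoc) blast
qed

lemma D_assoc: "D_mult (D_mult u v) w = D_mult u (D_mult v w)"
proof (rule vbil_assocI[OF vbil_D_mult])
  show "D_mult (D_mult (axis p 1) (axis q 1)) (axis r 1) = D_mult (axis p 1) (D_mult (axis q 1) (axis r 1))"
    for p q r by (cases p, cases q, cases r) (simp only: D_assoc_basis)
qed

text \<open>The functions on \<open>G\<close> as a subalgebra.\<close>

definition fn :: "('a \<Rightarrow> 'k) \<Rightarrow> 'k ^ ('n \<times> 'n)" where
  "fn \<phi> = \<phi> \<sharp> one"

lemma mon_fn:
  "mon E1 V1 (cst (fn \<phi>)) g (I g (\<lambda>a. emb (\<phi> a))) pone"
  unfolding mon_def
proof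
  fix k
  have "J (cst (fn \<phi>)) (\<lambda>p. E1 g p k) = I g (\<lambda>a. emb (\<phi> a) \<cdot> pone k)"
    by (simp add: J_EE cst_def fn_def smash_def I_def emb_mult pone_def)
  then show "J (cst (fn \<phi>)) (\<lambda>p. E1 g p k) = I g (\<lambda>a. emb (\<phi> a)) \<cdot> V1 pone k"
    by (simp only: I_const_right)
qed

lemma mon_one: "g \<in> points \<Longrightarrow> mon E1 V1 (cst D_one) g \<one> pone"
  using mon_fn[of \<epsilon> g] by (simp add: fn_def D_one_def I_counit)

lemma D_one_left: "D_mult D_one u = u"
proof -
  have 1: "D_mult D_one (axis (i, j) 1) = axis (i, j) 1" for i j
  proof (rule sep11[of "\<lambda>j. D_mult D_one (axis (i, j) 1)"])
    fix x g assume G: "x \<in> points" "g \<in> points"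
    have "mon E1 V1 (biK D_mult (cst D_one) (dl x i)) g (\<one> \<cdot> (cj g pone) i \<cdot> th g pone x) (pone \<otimes> x)"
      using G by (intro mon1_mult mon_one mon_dl gone_closed)
    then have "mon E1 V1 (biK D_mult (cst D_one) (dl x i)) g (g i) x" using G by simp
    then show "\<exists>c w. mon E1 V1 (\<lambda>p. J x (\<lambda>j. cst (D_mult D_one (axis (i, j) 1)) p)) g c w \<and>
        mon E1 V1 (\<lambda>p. J x (\<lambda>j. cst (axis (i, j) 1) p)) g c w"
      using mon_dl[of x i g] by (simp only: av_cst biK_J_left biK_J_right cst_bil[OF vbil_D_mult]) blast
  qed
  show ?thesis
    by (rule vlin_eqI[OF vlin_D_mult(1) vlin_id]) (use 1 in auto)
qed

lemma D_one_right: "D_mult u D_one = u"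
proof -
  have 1: "D_mult (axis (i, j) 1) D_one = axis (i, j) 1" for i j
  proof (rule sep11[of "\<lambda>j. D_mult (axis (i, j) 1) D_one"])
    fix x g assume G: "x \<in> points" "g \<in> points"
    have "mon E1 V1 (biK D_mult (dl x i) (cst D_one)) g (g i \<cdot> \<one> \<cdot> th g x pone) (x \<otimes> pone)"
      using G by (intro mon1_mult mon_one mon_dl gone_closed cj_closed)
    then have "mon E1 V1 (biK D_mult (dl x i) (cst D_one)) g (g i) x" using G by simp
    then show "\<exists>c w. mon E1 V1 (\<lambda>p. J x (\<lambda>j. cst (D_mult (axis (i, j) 1) D_one) p)) g c w \<and>
        mon E1 V1 (\<lambda>p. J x (\<lambda>j. cst (axis (i, j) 1) p)) g c w"
      using mon_dl[of x i g] by (simp only: av_cst biK_J_left biK_J_right cst_bil[OF vbil_D_mult]) blast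
  qed
  show ?thesis
    by (rule vlin_eqI[OF vlin_D_mult(2) vlin_id]) (use 1 in auto)
qed

lemma vlin_linear: "vlin T \<Longrightarrow> Vector_Spaces.linear (*s) (*s) T"
  unfolding Vector_Spaces.linear_iff by (simp add: vlin_add vlin_scale vec.vector_space_axioms)

sublocale D: fd_algebra "(*s)" "\<lambda>p::'n \<times> 'n. axis p (1::'k)" D_mult D_one
  by unfold_locales (simp_all add: D_assoc D_one_left D_one_right
      vlin_add[OF vlin_D_mult(1)] vlin_add[OF vlin_D_mult(2)]
      vlin_scale[OF vlin_D_mult(1)] vlin_scale[OF vlin_D_mult(2)])

end

text \<open>The reassociation of a triple tensor product, and the tensor product of two linear maps.\<close>

definition amap :: "'k::field ^ (('p::finite \<times> 'q::finite) \<times> 'r::finite) \<Rightarrow> 'k ^ ('p \<times> 'q \<times> 'r)" where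
  "amap t = (\<chi> r. t $ ((fst r, fst (snd r)), snd (snd r)))"

definition tmap :: "('k::field ^ 'p::finite \<Rightarrow> 'k ^ 'q::finite) \<Rightarrow> ('k ^ 'r::finite \<Rightarrow> 'k ^ 's::finite) \<Rightarrow>
    'k ^ ('p \<times> 'r) \<Rightarrow> 'k ^ ('q \<times> 's)" where
  "tmap T T' t = (\<Sum>p\<in>UNIV. \<Sum>q\<in>UNIV. (t $ (p, q)) *s tens (T (axis p 1)) (T' (axis q 1)))"

lemma tmap_axis: "tmap T T' (axis (p, q) 1) = tens (T (axis p 1)) (T' (axis q 1))"
proof -
  have "tmap T T' (axis (p, q) 1) = (\<Sum>i\<in>UNIV. \<Sum>j\<in>UNIV.
      if i = p then (if j = q then tens (T (axis i 1)) (T' (axis j 1)) else 0) else 0)"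
    unfolding tmap_def by (intro sum.cong refl) (auto simp: axis_def)
  also have "\<dots> = (\<Sum>i\<in>UNIV. if i = p then tens (T (axis i 1)) (T' (axis q 1)) else 0)"
    by (intro sum.cong refl) auto
  finally show ?thesis by simp
qed

lemma lift2_tens:
  "arr.lift2 (*s) t (\<lambda>a c. tens a c) = t"
  "arr.lift2 (*s) t (\<lambda>a c. tens a (tens c w)) = amap (tens t w)"
proof -
  show "arr.lift2 (*s) t (\<lambda>a c. tens a c) = t"
    using arr.tensor2_spans[of t] by (simp add: arr_tensor[abs_def])
  show "arr.lift2 (*s) t (\<lambda>a c. tens a (tens c w)) = amap (tens t w)"
  proof (rule vlin_eqI[of "\<lambda>t. arr.lift2 (*s) t (\<lambda>a c. tens a (tens c w))" "\<lambda>t. amap (tens t w)"])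
    show "vlin (\<lambda>t. arr.lift2 (*s) t (\<lambda>a c. tens a (tens c w)))" by (rule vlin_lift)
    show "vlin (\<lambda>t. amap (tens t w))" by (rule vlin_comp) (simp_all add: vlin_tens, rule vlinI, simp_all add: vec_eq_iff amap_def)
    show "arr.lift2 (*s) (axis p 1) (\<lambda>a c. tens a (tens c w)) = amap (tens (axis p 1) w)" for p
      by (cases p) (simp add: arr_lift_axis, auto simp: amap_def tens_def vec_eq_iff axis_def)
  qed
qed

lemma lift2_vlin:
  assumes "vlin T"
  shows "arr.lift2 (*s) t (\<lambda>a c. T (F a c)) = T (arr.lift2 (*s) t F)"
  by (rule vlin_eqI[of "\<lambda>t. arr.lift2 (*s) t (\<lambda>a c. T (F a c))" "\<lambda>t. T (arr.lift2 (*s) t F)"])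
     (auto intro: vlin_lift vlin_comp[OF assms] simp: arr_lift_axis)

lemma lift3_vlin:
  assumes "vlin T"
  shows "arr.lift3 (*s) t (\<lambda>a c d. T (F a c d)) = T (arr.lift3 (*s) t F)"
  by (rule vlin_eqI[of "\<lambda>t. arr.lift3 (*s) t (\<lambda>a c d. T (F a c d))" "\<lambda>t. T (arr.lift3 (*s) t F)"])
     (auto intro: vlin_lift vlin_comp[OF assms] simp: arr_lift_axis)

context comm_alg begin

lemma mon_tens:
  assumes "mon E V (cst t) g c x" "mon E' V' (cst u) h d y"
  shows "mon (tE E E') (tV V V') (cst (tens t u)) (g, h) (c \<cdot> d) (x, y)"
  using assms unfolding mon_def
  by (auto simp: cst_tens tE_def tV_def case_prod_app J_prod_mul simp flip: case_prod_beta) (simp only: ac_simps)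

text \<open>A linear map \<open>T\<close> such that \<open>U(g) = c x\<close> implies \<open>T(U)(G) = c d y\<close>.  Like \<open>multiplicative\<close> this is a
  factorization through evaluation, here by an array \<open>F\<close>, which makes it stable under tensor products.\<close>

definition mor where
  "mor T E V E' V' g x G y d \<longleftrightarrow> (\<exists>F.
     (\<forall>p k. J (cst (T (axis p 1))) (\<lambda>r. E' G r k) = J (E g p) (\<lambda>a. F a k)) \<and>
     (\<forall>k. J (V x) (\<lambda>a. F a k) = d \<cdot> V' y k))"

lemma mon_linK:
  assumes "mor T E V E' V' g x G y d" and U: "mon E V U g c x"
  shows "mon E' V' (linK T U) G (c \<cdot> d) y"
proof -
  obtain F where F: "\<And>p k. J (cst (T (axis p 1))) (\<lambda>r. E' G r k) = J (E g p) (\<lambda>a. F a k)"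
    "\<And>k. J (V x) (\<lambda>a. F a k) = d \<cdot> V' y k"
    using assms(1) unfolding mor_def by blast
  have u: "(\<lambda>a. J U (\<lambda>p. E g p a)) = (\<lambda>a. c \<cdot> V x a)" using U by (auto simp: mon_def)
  have "J (linK T U) (\<lambda>r. E' G r k) = (c \<cdot> d) \<cdot> V' y k" for k
    by (simp only: J_linK F J_J[symmetric] u J_scale assoc)
  then show ?thesis unfolding mon_def by blast
qed

lemma mor_id: "(\<And>p. T (axis p 1) = axis p 1) \<Longrightarrow> mor T E V E V g x g x \<one>"
  unfolding mor_def
  by (rule exI[of _ "\<lambda>a k. if a = k then \<one> else 0"]) (simp add: cst_axis J_delta)

lemma mor_tens:
  assumes "mor T E V E1 V1 g x G y c" "mor T' E' V' E2 V2 h x' H y' d"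
    and T: "\<And>p q. T'' (axis (p, q) 1) = tens (T (axis p 1)) (T' (axis q 1))"
  shows "mor T'' (tE E E') (tV V V') (tE E1 E2) (tV V1 V2) (g, h) (x, x') (G, H) (y, y') (c \<cdot> d)"
proof -
  obtain F where F: "\<And>p k. J (cst (T (axis p 1))) (\<lambda>r. E1 G r k) = J (E g p) (\<lambda>a. F a k)"
    "\<And>k. J (V x) (\<lambda>a. F a k) = c \<cdot> V1 y k"
    using assms(1) unfolding mor_def by blast
  obtain F' where F': "\<And>p k. J (cst (T' (axis p 1))) (\<lambda>r. E2 H r k) = J (E' h p) (\<lambda>a. F' a k)"
    "\<And>k. J (V' x') (\<lambda>a. F' a k) = d \<cdot> V2 y' k"
    using assms(2) unfolding mor_def by blast
  let ?F = "\<lambda>(a, a') (k, k'). F a k \<cdot> F' a' k'"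
  have "J (cst (T'' (axis p 1))) (\<lambda>r. tE E1 E2 (G, H) r k) = J (tE E E' (g, h) p) (\<lambda>a. ?F a k)" for p k
    by (cases p, cases k)
       (simp add: T cst_tens tE_def J_prod_mul F F' case_prod_app flip: case_prod_beta)
  moreover have "J (tV V V' (x, x')) (\<lambda>a. ?F a k) = (c \<cdot> d) \<cdot> tV V1 V2 (y, y') k" for k
    by (cases k) (simp add: tV_def J_prod_mul F F' case_prod_app flip: case_prod_beta, simp add: ac_simps)
  ultimately show ?thesis unfolding mor_def by (intro exI[of _ ?F]) blast
qed

lemma J_amap:
  fixes f :: "'p::finite \<times> 'q::finite \<times> 'r::finite \<Rightarrow> 'c"
  shows "J (cst (amap t)) f = J (cst t) (\<lambda>((p, q), r). f (p, q, r))"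
  unfolding J_def sum_UNIV_pair by (simp add: cst_def amap_def)

lemma mor_amap:
  assumes "mor T E V (tE (tE E1 E2) E3) (tV (tV V1 V2) V3) g x ((G, H), K) ((y, z), w) d"
    and T: "\<And>p. T' (axis p 1) = amap (T (axis p 1))"
  shows "mor T' E V (tE E1 (tE E2 E3)) (tV V1 (tV V2 V3)) g x (G, H, K) (y, z, w) d"
proof -
  obtain F where F: "\<And>p k. J (cst (T (axis p 1))) (\<lambda>r. tE (tE E1 E2) E3 ((G, H), K) r k) = J (E g p) (\<lambda>a. F a k)"
    "\<And>k. J (V x) (\<lambda>a. F a k) = d \<cdot> tV (tV V1 V2) V3 ((y, z), w) k"
    using assms(1) unfolding mor_def by blast
  let ?F = "\<lambda>a (k, l, m). F a ((k, l), m)"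
  have "J (cst (T' (axis p 1))) (\<lambda>r. tE E1 (tE E2 E3) (G, H, K) r k) = J (E g p) (\<lambda>a. ?F a k)" for p k
  proof -
    obtain k1 k2 k3 where k: "k = (k1, k2, k3)" by (cases k)
    have "J (cst (T' (axis p 1))) (\<lambda>r. tE E1 (tE E2 E3) (G, H, K) r k)
      = J (cst (T (axis p 1))) (\<lambda>r. tE (tE E1 E2) E3 ((G, H), K) r ((k1, k2), k3))"
      unfolding T J_amap k
      by (rule arg_cong[where f = "J _"]) (auto simp: tE_def fun_eq_iff assoc)
    then show ?thesis by (simp add: F k)
  qed
  moreover have "J (V x) (\<lambda>a. ?F a k) = d \<cdot> tV V1 (tV V2 V3) (y, z, w) k" for k
    by (cases k) (simp add: F tV_def assoc)
  ultimately show ?thesis unfolding mor_def by (intro exI[of _ ?F]) blast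
qed

end

section \<open>The quasi-bialgebra structure\<close>

context generic_points begin

lemma D_mult2_axis: "D.mult2 (axis (p, q) 1) (axis (r, s) 1) =
    tens (D_mult (axis p 1) (axis r 1)) (D_mult (axis q 1) (axis s 1))"
  by (simp add: D.mult2_def arr_lift_axis arr_tensor)

lemma D_mult3_axis: "D.mult3 (axis (p, q) 1) (axis (r, s) 1) =
    tens (D_mult (axis p 1) (axis r 1)) (D.mult2 (axis q 1) (axis s 1))"
  by (cases q, cases s) (simp add: D.mult3_def D_mult2_axis arr_lift_axis arr_tensor)

lemma D_mult4_axis: "D.mult4 (axis (p, q) 1) (axis (r, s) 1) =
    tens (D_mult (axis p 1) (axis r 1)) (D.mult3 (axis q 1) (axis s 1))"
  by (cases q, cases s) (simp add: D.mult4_def D_mult3_axis D_mult2_axis arr_lift_axis arr_tensor)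

lemma vbil_D_mults: "vbil D.mult2" "vbil D.mult3" "vbil D.mult4"
  unfolding D.mult2_def[abs_def] D.mult3_def[abs_def] D.mult4_def[abs_def]
  by (rule vbilI; intro vlin_lift2_arg vlin_lift3_arg vlin_lift4_arg vlin_lift)+

lemmas D2_multiplicative = multiplicative_tens[OF D_multiplicative D_multiplicative D_mult2_axis]
lemmas D3_multiplicative = multiplicative_tens[OF D_multiplicative D2_multiplicative D_mult3_axis]
lemmas D4_multiplicative = multiplicative_tens[OF D_multiplicative D3_multiplicative D_mult4_axis]

lemma mon2_mult:
  assumes "mon E2 V2 U (g1, g2) c (x1, x2)" "mon E2 V2 U' (cj g1 x1, cj g2 x2) d (y1, y2)"
    and "g1 \<in> points" "g2 \<in> points" "x1 \<in> points" "x2 \<in> points" "y1 \<in> points" "y2 \<in> points"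
  shows "mon E2 V2 (biK D.mult2 U U') (g1, g2) (c \<cdot> d \<cdot> (th g1 x1 y1 \<cdot> th g2 x2 y2)) (x1 \<otimes> y1, x2 \<otimes> y2)"
  using mon_biK[OF D2_multiplicative _ _ _ assms(1), where U' = U' and d = d and y = "(y1, y2)"] assms by simp

lemma mon3_mult:
  assumes "mon E3 V3 U (g1, g2, g3) c (x1, x2, x3)" "mon E3 V3 U' (cj g1 x1, cj g2 x2, cj g3 x3) d (y1, y2, y3)"
    and "g1 \<in> points" "g2 \<in> points" "g3 \<in> points" "x1 \<in> points" "x2 \<in> points" "x3 \<in> points"
      "y1 \<in> points" "y2 \<in> points" "y3 \<in> points"
  shows "mon E3 V3 (biK D.mult3 U U') (g1, g2, g3)
    (c \<cdot> d \<cdot> (th g1 x1 y1 \<cdot> (th g2 x2 y2 \<cdot> th g3 x3 y3))) (x1 \<otimes> y1, x2 \<otimes> y2, x3 \<otimes> y3)"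
  using mon_biK[OF D3_multiplicative _ _ _ assms(1), where U' = U' and d = d and y = "(y1, y2, y3)"] assms by simp

lemma mon4_mult:
  assumes "mon E4 V4 U (g1, g2, g3, g4) c (x1, x2, x3, x4)"
      "mon E4 V4 U' (cj g1 x1, cj g2 x2, cj g3 x3, cj g4 x4) d (y1, y2, y3, y4)"
    and "g1 \<in> points" "g2 \<in> points" "g3 \<in> points" "g4 \<in> points"
      "x1 \<in> points" "x2 \<in> points" "x3 \<in> points" "x4 \<in> points"
      "y1 \<in> points" "y2 \<in> points" "y3 \<in> points" "y4 \<in> points"
  shows "mon E4 V4 (biK D.mult4 U U') (g1, g2, g3, g4)
    (c \<cdot> d \<cdot> (th g1 x1 y1 \<cdot> (th g2 x2 y2 \<cdot> (th g3 x3 y3 \<cdot> th g4 x4 y4))))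
    (x1 \<otimes> y1, x2 \<otimes> y2, x3 \<otimes> y3, x4 \<otimes> y4)"
  using mon_biK[OF D4_multiplicative _ _ _ assms(1), where U' = U' and d = d and y = "(y1, y2, y3, y4)"] assms by simp

text \<open>At points \<open>\<Delta>(\<phi> # x)(g, h) = \<phi>(g h) \<gamma>\<^sub>x(g, h) x \<otimes> x\<close>; the coefficient below is
  \<open>\<phi>(a\<^sub>1 c\<^sub>1) \<gamma>(x; a\<^sub>2, c\<^sub>2)\<close> for \<open>\<phi> = coord i\<close>.\<close>

definition comult_coeff :: "'a \<Rightarrow> 'n \<Rightarrow> 'a \<Rightarrow> 'a \<Rightarrow> 'k" where
  "comult_coeff x i a c = sw2 (*) a (\<lambda>a1 a2. sw2 (*) c (\<lambda>c1 c2. coord i (a1 \<odot> c1) * gamma x a2 c2))"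

definition D_comult :: "'k ^ ('n \<times> 'n) \<Rightarrow> 'k ^ (('n \<times> 'n) \<times> ('n \<times> 'n))" where
  "D_comult u = (\<Sum>p\<in>UNIV. (u $ p) *s (\<chi> r. case (p, r) of ((i, j), (a, m), (c, n)) \<Rightarrow>
     sw3 (*) (b j) (\<lambda>x1 x2 x3. comult_coeff x1 i (b a) (b c) * (coord m x2 * coord n x3))))"

lemma vlin_D_comult: "vlin D_comult"
  unfolding D_comult_def
  by (rule vlinI) (simp_all add: vec.scale_left_distrib sum.distrib vec.scale_sum_right)

lemma sum_axis: "(\<Sum>p\<in>UNIV. (axis q 1 $ p) *s F p) = (F q :: 'k ^ 'r::finite)" for q :: "'p::finite"
proof -
  have "(\<Sum>p\<in>UNIV. (axis q 1 $ p) *s F p) = (\<Sum>p\<in>UNIV. if p = q then F p else 0)"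
    by (intro sum.cong refl) (auto simp: axis_def)
  then show ?thesis by simp
qed

lemma D_comult_axis: "D_comult (axis (i, j) 1) $ ((a, m), (c, n)) =
   sw3 (*) (b j) (\<lambda>x1 x2 x3. comult_coeff x1 i (b a) (b c) * (coord m x2 * coord n x3))"
  unfolding D_comult_def sum_axis by simp

lemma emb_comult_coeff:
  assumes "g \<in> points" "h \<in> points"
  shows "I g (\<lambda>a. I h (\<lambda>c. emb (comult_coeff x i a c)))
    = (g \<otimes> h) i \<cdot> I g (\<lambda>a. I h (\<lambda>c. emb (gamma x a c)))"
  unfolding comult_coeff_def
  by (simp add: emb_sw2 I_swK I_split assms emb_mult I_const_left I_const_right pmul_def)

lemma mor_comult:
  assumes g: "g \<in> points" and h: "h \<in> points" and x: "x \<in> points"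
  shows "mor D_comult E1 V1 E2 V2 (g \<otimes> h) x (g, h) (x, x) (ga x g h)"
proof -
  define F where "F y = (\<lambda>(k, l). swK y (\<lambda>x1 y. swK y (\<lambda>x2 x3.
     I g (\<lambda>a. I h (\<lambda>c. emb (gamma x1 a c))) \<cdot> (emb (coord k x2) \<cdot> emb (coord l x3)))))" for y
  have "J (cst (D_comult (axis p 1))) (\<lambda>r. E2 (g, h) r k) = J (E1 (g \<otimes> h) p) (\<lambda>j. F (b j) k)" for p k
  proof -
    obtain i j where p: "p = (i, j)" by (cases p)
    obtain k1 k2 where k: "k = (k1, k2)" by (cases k)
    have "J (cst (D_comult (axis p 1))) (\<lambda>r. E2 (g, h) r k)
      = I g (\<lambda>a. I h (\<lambda>c. swK (b j) (\<lambda>x1 y. swK y (\<lambda>x2 x3.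
          emb (comult_coeff x1 i a c) \<cdot> (emb (coord k1 x2) \<cdot> emb (coord k2 x3))))))"
      by (simp add: p k J_tE J_EE cst_def D_comult_axis sw3_def emb_sw2 emb_mult I_def)
    also have "\<dots> = (g \<otimes> h) i \<cdot> F (b j) k"
      by (simp add: I_swK I_const_right emb_comult_coeff g h k F_def swK_const_left assoc)
    finally show ?thesis by (simp add: p J_EE_left)
  qed
  moreover have "J (V1 x) (\<lambda>j. F (b j) k) = ga x g h \<cdot> V2 (x, x) k" for k
  proof -
    obtain k1 k2 where k: "k = (k1, k2)" by (cases k)
    have "J (V1 x) (\<lambda>j. F (b j) k) = I x (\<lambda>y. F y k)" by (simp add: I_def)
    also have "\<dots> = at3 gamma x g h \<cdot> (x k1 \<cdot> x k2)"
      by (simp add: k F_def I_split x I_const_left I_const_right I_coord at3_def)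
    finally show ?thesis by (simp add: k tV_def at3_gamma g h x)
  qed
  ultimately show ?thesis
    unfolding mor_def by (intro exI[of _ "\<lambda>j. F (b j)"]) blast
qed

lemmas mon_comult = mon_linK[OF mor_comult]

lemma mon_cong: "mon E V U g c x \<Longrightarrow> c = d \<Longrightarrow> x = y \<Longrightarrow> mon E V U g d y"
  by simp

lemma D_comult_mult_basis:
  "D_comult (D_mult (axis (i, j) 1) (axis (i', l) 1)) =
   D.mult2 (D_comult (axis (i, j) 1)) (D_comult (axis (i', l) 1))"
proof (rule sep22[of "\<lambda>j l. D_comult (D_mult (axis (i, j) 1) (axis (i', l) 1))"])
  fix x y g h assume G: "x \<in> points" "y \<in> points" "g \<in> points" "h \<in> points"
  have "mon E2 V2 (linK D_comult (biK D_mult (dl x i) (dl y i'))) (g, h)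
    (((g \<otimes> h) i \<cdot> (cj (g \<otimes> h) x) i' \<cdot> th (g \<otimes> h) x y) \<cdot> ga (x \<otimes> y) g h) (x \<otimes> y, x \<otimes> y)"
    using G by (intro mon_comult mon1_mult mon_dl gmul_closed)
  moreover have "mon E2 V2 (biK D.mult2 (linK D_comult (dl x i)) (linK D_comult (dl y i'))) (g, h)
    (((g \<otimes> h) i \<cdot> ga x g h) \<cdot> ((cj g x \<otimes> cj h x) i' \<cdot> ga y (cj g x) (cj h x)) \<cdot> (th g x y \<cdot> th h x y))
    (x \<otimes> y, x \<otimes> y)"
    using G by (intro mon_comult mon2_mult mon_dl gmul_closed cj_closed)
  moreover have "((g \<otimes> h) i \<cdot> ga x g h) \<cdot> ((cj g x \<otimes> cj h x) i' \<cdot> ga y (cj g x) (cj h x)) \<cdot> (th g x y \<cdot> th h x y)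
    = ((g \<otimes> h) i \<cdot> (cj (g \<otimes> h) x) i' \<cdot> th (g \<otimes> h) x y) \<cdot> ga (x \<otimes> y) g h"
  proof -
    have "((g \<otimes> h) i \<cdot> ga x g h) \<cdot> ((cj g x \<otimes> cj h x) i' \<cdot> ga y (cj g x) (cj h x)) \<cdot> (th g x y \<cdot> th h x y)
      = (g \<otimes> h) i \<cdot> (cj (g \<otimes> h) x) i' \<cdot> (th g x y \<cdot> th h x y \<cdot> ga x g h \<cdot> ga y (cj g x) (cj h x))"
      using G by (simp only: gmul_cj ac_simps)
    also have "\<dots> = ((g \<otimes> h) i \<cdot> (cj (g \<otimes> h) x) i' \<cdot> th (g \<otimes> h) x y) \<cdot> ga (x \<otimes> y) g h"
      unfolding th_ga_compatible[OF G(3,4,1,2)] by (simp only: ac_simps)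
    finally show ?thesis .
  qed
  ultimately show "\<exists>c w.
      mon E2 V2 (\<lambda>p. J x (\<lambda>j. J y (\<lambda>l. cst (D_comult (D_mult (axis (i, j) 1) (axis (i', l) 1))) p))) (g, h) c w \<and>
      mon E2 V2 (\<lambda>p. J x (\<lambda>j. J y (\<lambda>l. cst (D.mult2 (D_comult (axis (i, j) 1)) (D_comult (axis (i', l) 1))) p))) (g, h) c w"
    by (simp only: av_cst biK_J_left biK_J_right linK_J cst_bil[OF vbil_D_mult] cst_bil[OF vbil_D_mults(1)]
        cst_lin[OF vlin_D_comult]) blast
qed

lemma D_comult_mult: "D_comult (D_mult u v) = D.mult2 (D_comult u) (D_comult v)"
proof (rule vbil_eqI[of "\<lambda>u v. D_comult (D_mult u v)" "\<lambda>u v. D.mult2 (D_comult u) (D_comult v)"])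
  show "vbil (\<lambda>u v. D_comult (D_mult u v))"
    by (intro vbilI vlin_comp[OF vlin_D_comult] vlin_D_mult)
  show "vbil (\<lambda>u v. D.mult2 (D_comult u) (D_comult v))"
    by (intro vbilI vlin_comp[OF vbil_vlin(1)[OF vbil_D_mults(1)] vlin_D_comult]
        vlin_comp[OF vbil_vlin(2)[OF vbil_D_mults(1)] vlin_D_comult])
  show "D_comult (D_mult (axis p 1) (axis q 1)) = D.mult2 (D_comult (axis p 1)) (D_comult (axis q 1))" for p q
    by (cases p, cases q) (simp only: D_comult_mult_basis)
qed

lemma D_comult_one: "D_comult D_one = tens D_one D_one"
proof (rule sep02)
  fix g h assume G: "g \<in> points" "h \<in> points"
  have "mon E2 V2 (cst (D_comult D_one)) (g, h) (\<one> \<cdot> ga pone g h) (pone, pone)"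
    unfolding cst_lin[OF vlin_D_comult] using G by (intro mon_comult mon_one gmul_closed gone_closed)
  moreover have "mon E2 V2 (cst (tens D_one D_one)) (g, h) (\<one> \<cdot> \<one>) (pone, pone)"
    using G by (intro mon_tens mon_one)
  ultimately show "\<exists>c w. mon E2 V2 (cst (D_comult D_one)) (g, h) c w \<and> mon E2 V2 (cst (tens D_one D_one)) (g, h) c w"
    using G by simp blast
qed

definition D_counit :: "'k ^ ('n \<times> 'n) \<Rightarrow> 'k" where
  "D_counit u = (\<Sum>p\<in>UNIV. u $ p * (coord (fst p) one * \<epsilon> (b (snd p))))"

text \<open>The scalar extension of the counit, which is evaluation at the unit point followed by \<open>\<epsilon>\<close>.\<close>

definition counitK :: "('n \<times> 'n \<Rightarrow> 'c) \<Rightarrow> 'c" where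
  "counitK U = J U (\<lambda>p. J (E1 pone p) (\<lambda>k. emb (\<epsilon> (b k))))"

lemma emb_D_counit: "emb (D_counit u) = counitK (cst u)"
  unfolding D_counit_def counitK_def emb_sum J_def[of "cst u"]
  by (rule sum.cong[OF refl]) (auto simp: cst_def emb_mult J_EE_left pone_def)

lemma counitK_mon: "x \<in> points \<Longrightarrow> mon E1 V1 U pone c x \<Longrightarrow> counitK U = c"
proof -
  assume x: "x \<in> points" and "mon E1 V1 U pone c x"
  then have "(\<lambda>a. J U (\<lambda>p. E1 pone p a)) = (\<lambda>a. c \<cdot> x a)" by (auto simp: mon_def)
  then have "counitK U = c \<cdot> I x (\<lambda>a. emb (\<epsilon> a))"
    unfolding counitK_def J_J[symmetric] by (simp add: J_scale I_def)
  then show ?thesis by (simp add: I_counit x)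
qed

lemma counitK_J: "counitK (\<lambda>p. J x (\<lambda>j. U j p)) = J x (\<lambda>j. counitK (U j))"
  unfolding counitK_def J_J ..

lemma D_counit_axis: "D_counit (axis p 1) = coord (fst p) one * \<epsilon> (b (snd p))"
proof -
  have "D_counit (axis p 1) = (\<Sum>q\<in>UNIV. if q = p then coord (fst q) one * \<epsilon> (b (snd q)) else 0)"
    unfolding D_counit_def by (rule sum.cong) (auto simp: axis_def)
  then show ?thesis by simp
qed

lemma D_counit_linear: "Vector_Spaces.linear (*s) (*) D_counit"
proof -
  have "vector_space ((*) :: 'k \<Rightarrow> 'k \<Rightarrow> 'k)" by unfold_locales (simp_all add: algebra_simps)
  then show ?thesis
    unfolding Vector_Spaces.linear_iff
    by (simp add: vec.vector_space_axioms D_counit_def algebra_simps sum.distrib sum_distrib_left)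
qed

lemma D_counit_mult: "D_counit (D_mult u v) = D_counit u * D_counit v"
proof -
  interpret l: Vector_Spaces.linear "(*s)" "(*)" D_counit by (rule D_counit_linear)
  have 1: "D_counit (D_mult (axis (i, j) 1) (axis (i', l) 1)) = D_counit (axis (i, j) 1) * D_counit (axis (i', l) 1)"
    for i j i' l
  proof (rule generic2[where f = "\<lambda>j l. D_counit (D_mult (axis (i, j) 1) (axis (i', l) 1))"
        and f' = "\<lambda>j l. D_counit (axis (i, j) 1) * D_counit (axis (i', l) 1)"])
    have "mon E1 V1 (biK D_mult (dl \<xi>1 i) (dl \<xi>2 i')) pone (pone i \<cdot> (cj pone \<xi>1) i' \<cdot> th pone \<xi>1 \<xi>2) (\<xi>1 \<otimes> \<xi>2)"
      by (intro mon1_mult mon_dl gone_closed generic_closed)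
    then have "counitK (biK D_mult (dl \<xi>1 i) (dl \<xi>2 i')) = pone i \<cdot> pone i'"
      by (subst counitK_mon[of "\<xi>1 \<otimes> \<xi>2"]) simp_all
    moreover have "counitK (dl \<xi>1 i) = pone i" "counitK (dl \<xi>2 i') = pone i'"
      using mon_dl counitK_mon generic_closed by blast+
    ultimately have "counitK (biK D_mult (dl \<xi>1 i) (dl \<xi>2 i')) = counitK (dl \<xi>1 i) \<cdot> counitK (dl \<xi>2 i')"
      by simp
    then show "J \<xi>1 (\<lambda>j. J \<xi>2 (\<lambda>l. emb (D_counit (D_mult (axis (i, j) 1) (axis (i', l) 1))))) =
      J \<xi>1 (\<lambda>j. J \<xi>2 (\<lambda>l. emb (D_counit (axis (i, j) 1) * D_counit (axis (i', l) 1))))"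
      by (simp add: emb_D_counit emb_mult av_cst biK_J_left biK_J_right counitK_J
          cst_bil[OF vbil_D_mult] J_const_left J_const_right)
  qed
  have e: "D_mult u v = (\<Sum>p\<in>UNIV. (u $ p) *s (\<Sum>q\<in>UNIV. (v $ q) *s D_mult (axis p 1) (axis q 1)))"
    by (simp add: vec_eq_iff vbilD[OF vbil_D_mult, of u v] sum_distrib_left mult.assoc)
  have 2: "D_counit (D_mult (axis p 1) (axis q 1)) = D_counit (axis p 1) * D_counit (axis q 1)" for p q
    by (cases p, cases q) (simp only: 1)
  have d: "D_counit u = (\<Sum>p\<in>UNIV. u $ p * D_counit (axis p 1))" for u
    by (simp only: D_counit_axis) (simp only: D_counit_def)
  have "D_counit (D_mult u v) = (\<Sum>p\<in>UNIV. u $ p * (\<Sum>q\<in>UNIV. v $ q * (D_counit (axis p 1) * D_counit (axis q 1))))"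
    unfolding e by (simp only: l.sum l.scale 2)
  also have "\<dots> = D_counit u * D_counit v"
    unfolding d[of u] d[of v] sum_product by (simp add: sum_distrib_left ac_simps)
  finally show ?thesis .
qed

lemma D_counit_one: "D_counit D_one = 1"
proof -
  have "D_counit D_one = (\<Sum>i\<in>UNIV. coord i one * \<epsilon> (b i)) * (\<Sum>j\<in>UNIV. coord j one * \<epsilon> (b j))"
    unfolding D_counit_def D_one_def sum_UNIV_pair
    by (simp add: smash_def sum_distrib_left sum_distrib_right ac_simps)
  then show ?thesis
    by (simp add: linear_expand[OF counit_linear, of one, symmetric] counit_one)
qed

lemma emb_D_counit_axis: "emb (D_counit (axis p 1)) = J (E1 pone p) (\<lambda>k. emb (\<epsilon> (b k)))"
  by (simp only: emb_D_counit counitK_def cst_axis)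

lemma cst_scale: "cst (c *s t) = (\<lambda>p. emb c \<cdot> cst t p)"
  by (simp add: cst_def emb_mult fun_eq_iff)

lemma J_counit: "x \<in> points \<Longrightarrow> J x (\<lambda>k. emb (\<epsilon> (b k))) = \<one>"
  using I_counit[of x] by (simp add: I_def)

text \<open>Applying the counit to one tensor factor evaluates that factor at the unit point.\<close>

lemma mor_counit_right:
  assumes "\<And>p q. T (axis (p, q) 1) = D_counit (axis q 1) *s axis p 1" "y \<in> points"
  shows "mor T E2 V2 E1 V1 (g, pone) (x, y) g x \<one>"
proof -
  let ?F = "\<lambda>(a, a') k. (if a = k then \<one> else 0) \<cdot> emb (\<epsilon> (b a'))"
  have "J (cst (T (axis p 1))) (\<lambda>r. E1 g r k) = J (E2 (g, pone) p) (\<lambda>a. ?F a k)" for p k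
    by (cases p) (simp add: assms(1) cst_scale J_scale cst_axis emb_D_counit_axis tE_def
        case_prod_app, subst J_prod_mul, simp add: J_delta, simp only: J_def sum_mul_right commute)
  moreover have "J (V2 (x, y)) (\<lambda>a. ?F a k) = \<one> \<cdot> V1 x k" for k
    by (simp add: tV_def case_prod_app J_prod_mul J_delta J_counit assms(2))
  ultimately show ?thesis unfolding mor_def by (intro exI[of _ ?F]) blast
qed

lemma mor_counit_left:
  assumes "\<And>p q. T (axis (p, q) 1) = D_counit (axis p 1) *s axis q 1" "x \<in> points"
  shows "mor T (tE E1 E) (tV V1 V) E V (pone, g) (x, y) g y \<one>"
proof -
  let ?F = "\<lambda>(a', a) k. emb (\<epsilon> (b a')) \<cdot> (if a = k then \<one> else 0)"
  have "J (cst (T (axis p 1))) (\<lambda>r. E g r k) = J (tE E1 E (pone, g) p) (\<lambda>a. ?F a k)" for p k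
    by (cases p) (simp add: assms(1) cst_scale J_scale cst_axis emb_D_counit_axis tE_def
        case_prod_app J_prod_mul J_delta)
  moreover have "J (tV V1 V (x, y)) (\<lambda>a. ?F a k) = \<one> \<cdot> V y k" for k
    by (simp add: tV_def case_prod_app J_prod_mul J_delta J_counit assms(2))
  ultimately show ?thesis unfolding mor_def by (intro exI[of _ ?F]) blast
qed

lemma D_counit_right: "D.lift2 (*s) (D_comult u) (\<lambda>x1 x2. D_counit x2 *s x1) = u"
proof -
  let ?T = "\<lambda>t. D.lift2 (*s) t (\<lambda>x1 x2. D_counit x2 *s x1)"
  have T: "?T (axis (p, q) 1) = D_counit (axis q 1) *s axis p 1" for p q
    by (simp add: arr_lift_axis)
  have 1: "?T (D_comult (axis (i, j) 1)) = axis (i, j) 1" for i j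
  proof (rule sep11[of "\<lambda>j. ?T (D_comult (axis (i, j) 1))"])
    fix x g assume G: "x \<in> points" "g \<in> points"
    have "mon E1 V1 (linK ?T (linK D_comult (dl x i))) g ((g \<otimes> pone) i \<cdot> ga x g pone \<cdot> \<one>) x"
      by (rule mon_linK[OF mor_counit_right[OF T G(1)] mon_comult[OF G(2) gone_closed G(1) mon_dl]])
    then have "mon E1 V1 (linK ?T (linK D_comult (dl x i))) g (g i) x" using G by simp
    then show "\<exists>c w. mon E1 V1 (\<lambda>p. J x (\<lambda>j. cst (?T (D_comult (axis (i, j) 1))) p)) g c w \<and>
        mon E1 V1 (\<lambda>p. J x (\<lambda>j. cst (axis (i, j) 1) p)) g c w"
      using mon_dl[of x i g]
      by (simp only: av_cst linK_J cst_lin[OF vlin_D_comult] cst_lin[OF vlin_lift(1)]) blast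
  qed
  show ?thesis
    by (rule vlin_eqI[of "\<lambda>u. ?T (D_comult u)" "\<lambda>u. u"])
       (use 1 in \<open>auto intro: vlin_id vlin_comp[OF vlin_lift(1) vlin_D_comult]\<close>)
qed

lemma D_counit_left: "D.lift2 (*s) (D_comult u) (\<lambda>x1 x2. D_counit x1 *s x2) = u"
proof -
  let ?T = "\<lambda>t. D.lift2 (*s) t (\<lambda>x1 x2. D_counit x1 *s x2)"
  have T: "?T (axis (p, q) 1) = D_counit (axis p 1) *s axis q 1" for p q
    by (simp add: arr_lift_axis)
  have 1: "?T (D_comult (axis (i, j) 1)) = axis (i, j) 1" for i j
  proof (rule sep11[of "\<lambda>j. ?T (D_comult (axis (i, j) 1))"])
    fix x g assume G: "x \<in> points" "g \<in> points"
    have "mon E1 V1 (linK ?T (linK D_comult (dl x i))) g ((pone \<otimes> g) i \<cdot> ga x pone g \<cdot> \<one>) x"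
      by (rule mon_linK[OF mor_counit_left[OF T G(1)] mon_comult[OF gone_closed G(2) G(1) mon_dl]])
    then have "mon E1 V1 (linK ?T (linK D_comult (dl x i))) g (g i) x" using G by simp
    then show "\<exists>c w. mon E1 V1 (\<lambda>p. J x (\<lambda>j. cst (?T (D_comult (axis (i, j) 1))) p)) g c w \<and>
        mon E1 V1 (\<lambda>p. J x (\<lambda>j. cst (axis (i, j) 1) p)) g c w"
      using mon_dl[of x i g]
      by (simp only: av_cst linK_J cst_lin[OF vlin_D_comult] cst_lin[OF vlin_lift(1)]) blast
  qed
  show ?thesis
    by (rule vlin_eqI[of "\<lambda>u. ?T (D_comult u)" "\<lambda>u. u"])
       (use 1 in \<open>auto intro: vlin_id vlin_comp[OF vlin_lift(1) vlin_D_comult]\<close>)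
qed

sublocale D: fd_algebra_comult "(*s)" "\<lambda>p::'n \<times> 'n. axis p (1::'k)" D_mult D_one D_comult D_counit
  by (rule fd_algebra_comult.intro[OF D.fd_algebra_axioms], unfold_locales)
     (simp_all add: vlin_add[OF vlin_D_comult] vlin_scale[OF vlin_D_comult] D_comult_mult D_comult_one
       arr_tensor D_counit_linear[unfolded Vector_Spaces.linear_iff] D_counit_mult D_counit_one D_counit_left D_counit_right)

text \<open>A trilinear form on \<open>H\<close> as an element of the third tensor power of the functions on \<open>G\<close>.\<close>

definition tri :: "('a \<Rightarrow> 'a \<Rightarrow> 'a \<Rightarrow> 'k) \<Rightarrow> 'k ^ (('n \<times> 'n) \<times> ('n \<times> 'n) \<times> ('n \<times> 'n))" where
  "tri f = (\<chi> r. case r of ((i, p), (j, q), (l, s)) \<Rightarrow>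
     f (b i) (b j) (b l) * (coord p one * (coord q one * coord s one)))"

lemma mon_tri: "mon E3 V3 (cst (tri f)) (g, h, k) (at3 f g h k) (pone, pone, pone)"
  unfolding mon_def
  by (auto simp: tri_def J_tE J_EE cst_def emb_mult J_const_right at3_def I_def tV_def pone_def)

text \<open>With this coproduct the reassociator is the inverse of \<open>\<omega>\<close>, not \<open>\<omega>\<close> itself.\<close>

abbreviation "D_Phi \<equiv> tri omega_inv"
abbreviation "D_Psi \<equiv> tri \<omega>"

lemma mon_Phi: "mon E3 V3 (cst D_Phi) (g, h, k) (W' g h k) (pone, pone, pone)"
  and mon_Psi: "mon E3 V3 (cst D_Psi) (g, h, k) (W g h k) (pone, pone, pone)"
  by (rule mon_tri)+

lemma mon_ones: "g \<in> points \<Longrightarrow> h \<in> points \<Longrightarrow> mon E2 V2 (cst (tens D_one D_one)) (g, h) \<one> (pone, pone)"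
  "g \<in> points \<Longrightarrow> h \<in> points \<Longrightarrow> k \<in> points \<Longrightarrow>
    mon E3 V3 (cst (tens D_one (tens D_one D_one))) (g, h, k) \<one> (pone, pone, pone)"
  using mon_tens[OF mon_one mon_one, of g h]
    mon_tens[OF mon_one mon_tens[OF mon_one mon_one], of g h k] by simp_all

lemma W'_W: "g \<in> points \<Longrightarrow> h \<in> points \<Longrightarrow> k \<in> points \<Longrightarrow> W' g h k \<cdot> W g h k = \<one>"
  using w_inverse[of g h k] by (simp add: commute)

lemma D_reassociator_inverse: "D.inverses3 D_Phi D_Psi"
  unfolding D.inverses3_def arr_tensor
proof (intro conjI sep03)
  fix g h k assume G: "g \<in> points" "h \<in> points" "k \<in> points"
  have "mon E3 V3 (biK D.mult3 (cst D_Phi) (cst D_Psi)) (g, h, k)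
    (W' g h k \<cdot> W g h k \<cdot> (th g pone pone \<cdot> (th h pone pone \<cdot> th k pone pone)))
    (pone \<otimes> pone, pone \<otimes> pone, pone \<otimes> pone)"
    using G by (intro mon3_mult mon_Phi) (simp_all add: mon_Psi)
  then have 1: "mon E3 V3 (biK D.mult3 (cst D_Phi) (cst D_Psi)) (g, h, k) \<one> (pone, pone, pone)"
    using G by (simp add: W'_W)
  have "mon E3 V3 (biK D.mult3 (cst D_Psi) (cst D_Phi)) (g, h, k)
    (W g h k \<cdot> W' g h k \<cdot> (th g pone pone \<cdot> (th h pone pone \<cdot> th k pone pone)))
    (pone \<otimes> pone, pone \<otimes> pone, pone \<otimes> pone)"
    using G by (intro mon3_mult mon_Psi) (simp_all add: mon_Phi)
  then have 2: "mon E3 V3 (biK D.mult3 (cst D_Psi) (cst D_Phi)) (g, h, k) \<one> (pone, pone, pone)"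
    using G by (simp add: w_inverse)
  show "\<exists>c w. mon E3 V3 (cst (D.mult3 D_Phi D_Psi)) (g, h, k) c w \<and>
      mon E3 V3 (cst (tens D_one (tens D_one D_one))) (g, h, k) c w"
    "\<exists>c w. mon E3 V3 (cst (D.mult3 D_Psi D_Phi)) (g, h, k) c w \<and>
      mon E3 V3 (cst (tens D_one (tens D_one D_one))) (g, h, k) c w"
    using 1 2 mon_ones(2)[OF G] unfolding cst_bil[OF vbil_D_mults(2)] by blast+
qed

abbreviation (input) "id_comult t \<equiv> D.lift2 (*s) t (\<lambda>h1 h2. D.lift2 (*s) (D_comult h2) (\<lambda>a c. D.tensor3 h1 a c))"
abbreviation (input) "comult_id t \<equiv> D.lift2 (*s) t (\<lambda>h1 h2. D.lift2 (*s) (D_comult h1) (\<lambda>a c. D.tensor3 a c h2))"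

lemma mor_id_comult:
  assumes "h \<in> points" "k \<in> points" "y \<in> points"
  shows "mor (\<lambda>t. id_comult t) E2 V2 E3 V3 (g, h \<otimes> k) (x, y) (g, h, k) (x, y, y) (\<one> \<cdot> ga y h k)"
proof (rule mor_tens)
  show "mor (\<lambda>u. u) E1 V1 E1 V1 g x g x \<one>" by (rule mor_id) rule
  show "mor D_comult E1 V1 E2 V2 (h \<otimes> k) y (h, k) (y, y) (ga y h k)" using assms by (rule mor_comult)
  show "id_comult (axis (p, q) 1) = tens (axis p 1) (D_comult (axis q 1))" for p q
    by (simp add: arr_lift_axis arr_tensor lift2_vlin[OF vlin_tens(1)] lift2_tens)
qed

lemma mor_comult_id:
  assumes "g \<in> points" "h \<in> points" "x \<in> points"
  shows "mor (\<lambda>t. comult_id t) E2 V2 E3 V3 (g \<otimes> h, k) (x, y) (g, h, k) (x, x, y) (ga x g h \<cdot> \<one>)"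
proof (rule mor_amap)
  show "mor (tmap D_comult (\<lambda>u. u)) E2 V2 (tE E2 E1) (tV V2 V1) (g \<otimes> h, k) (x, y) ((g, h), k) ((x, x), y) (ga x g h \<cdot> \<one>)"
    by (rule mor_tens[OF mor_comult[OF assms] mor_id tmap_axis]) rule
  show "comult_id (axis p 1) = amap (tmap D_comult (\<lambda>u. u) (axis p 1))" for p
    by (cases p) (simp add: arr_lift_axis arr_tensor lift2_tens tmap_axis)
qed

lemma D_quasi_coassoc:
  "id_comult (D_comult u) = D.mult3 (D.mult3 D_Phi (comult_id (D_comult u))) D_Psi"
proof -
  have 1: "id_comult (D_comult (axis (i, j) 1)) =
     D.mult3 (D.mult3 D_Phi (comult_id (D_comult (axis (i, j) 1)))) D_Psi" for i j
  proof (rule sep13[of "\<lambda>j. id_comult (D_comult (axis (i, j) 1))"])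
    fix x g h k assume G: "x \<in> points" "g \<in> points" "h \<in> points" "k \<in> points"
    have 1: "mon E3 V3 (linK (\<lambda>t. id_comult t) (linK D_comult (dl x i))) (g, h, k)
      ((g \<otimes> (h \<otimes> k)) i \<cdot> ga x g (h \<otimes> k) \<cdot> (\<one> \<cdot> ga x h k)) (x, x, x)"
      using G by (intro mon_linK[OF mor_id_comult] mon_comult mon_dl gmul_closed)
    have "mon E3 V3 (linK (\<lambda>t. comult_id t) (linK D_comult (dl x i))) (g, h, k)
      ((g \<otimes> h \<otimes> k) i \<cdot> ga x (g \<otimes> h) k \<cdot> (ga x g h \<cdot> \<one>)) (x, x, x)"
      using G by (intro mon_linK[OF mor_comult_id] mon_comult mon_dl gmul_closed)
    then have "mon E3 V3 (biK D.mult3 (cst D_Phi) (linK (\<lambda>t. comult_id t) (linK D_comult (dl x i)))) (g, h, k)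
      (W' g h k \<cdot> ((g \<otimes> h \<otimes> k) i \<cdot> ga x (g \<otimes> h) k \<cdot> (ga x g h \<cdot> \<one>)) \<cdot>
        (th g pone x \<cdot> (th h pone x \<cdot> th k pone x))) (pone \<otimes> x, pone \<otimes> x, pone \<otimes> x)"
      using G by (intro mon3_mult mon_Phi) simp_all
    then have "mon E3 V3 (biK D.mult3 (cst D_Phi) (linK (\<lambda>t. comult_id t) (linK D_comult (dl x i)))) (g, h, k)
      (W' g h k \<cdot> ((g \<otimes> h \<otimes> k) i \<cdot> ga x (g \<otimes> h) k \<cdot> ga x g h)) (x, x, x)"
      using G by simp
    then have "mon E3 V3 (biK D.mult3 (biK D.mult3 (cst D_Phi) (linK (\<lambda>t. comult_id t) (linK D_comult (dl x i)))) (cst D_Psi)) (g, h, k)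
      (W' g h k \<cdot> ((g \<otimes> h \<otimes> k) i \<cdot> ga x (g \<otimes> h) k \<cdot> ga x g h) \<cdot> W (cj g x) (cj h x) (cj k x) \<cdot>
        (th g x pone \<cdot> (th h x pone \<cdot> th k x pone))) (x \<otimes> pone, x \<otimes> pone, x \<otimes> pone)"
      using G by (intro mon3_mult mon_Psi gone_closed)
    moreover have "W' g h k \<cdot> ((g \<otimes> h \<otimes> k) i \<cdot> ga x (g \<otimes> h) k \<cdot> ga x g h) \<cdot> W (cj g x) (cj h x) (cj k x)
      = (g \<otimes> (h \<otimes> k)) i \<cdot> ga x g (h \<otimes> k) \<cdot> (\<one> \<cdot> ga x h k)"
    proof -
      have "W' g h k \<cdot> ((g \<otimes> h \<otimes> k) i \<cdot> ga x (g \<otimes> h) k \<cdot> ga x g h) \<cdot> W (cj g x) (cj h x) (cj k x)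
        = (g \<otimes> (h \<otimes> k)) i \<cdot> W' g h k \<cdot> (ga x g h \<cdot> ga x (g \<otimes> h) k \<cdot> W (cj g x) (cj h x) (cj k x))"
        using G by (simp only: ac_simps gassoc)
      also have "\<dots> = (g \<otimes> (h \<otimes> k)) i \<cdot> ga x g (h \<otimes> k) \<cdot> ga x h k \<cdot> (W' g h k \<cdot> W g h k)"
        unfolding ga_coassoc[OF G] by (simp only: ac_simps)
      finally show ?thesis using G by (simp add: W'_W)
    qed
    ultimately show "\<exists>c w. mon E3 V3 (\<lambda>p. J x (\<lambda>j. cst (id_comult (D_comult (axis (i, j) 1))) p)) (g, h, k) c w \<and>
      mon E3 V3 (\<lambda>p. J x (\<lambda>j. cst (D.mult3 (D.mult3 D_Phi (comult_id (D_comult (axis (i, j) 1)))) D_Psi) p)) (g, h, k) c w"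
      using 1 G by (simp add: av_cst linK_J biK_J_left biK_J_right cst_lin[OF vlin_D_comult]
        cst_lin[OF vlin_lift(1)] cst_bil[OF vbil_D_mults(2)]) blast
  qed
  show ?thesis
  proof (rule vlin_eqI[of "\<lambda>u. id_comult (D_comult u)" "\<lambda>u. D.mult3 (D.mult3 D_Phi (comult_id (D_comult u))) D_Psi"])
    show "vlin (\<lambda>u. id_comult (D_comult u))" by (rule vlin_comp[OF vlin_lift(1) vlin_D_comult])
    show "vlin (\<lambda>u. D.mult3 (D.mult3 D_Phi (comult_id (D_comult u))) D_Psi)"
      by (rule vlin_comp[OF vbil_vlin(2)[OF vbil_D_mults(2)]], rule vlin_comp[OF vbil_vlin(1)[OF vbil_D_mults(2)]],
          rule vlin_comp[OF vlin_lift(1) vlin_D_comult])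
  qed (use 1 in auto)
qed

end

context comm_alg begin

lemma J_tens_tE:
  "J (cst (tens u v)) (\<lambda>r. tE E E' (g, h) r (k, l)) = J (cst u) (\<lambda>p. E g p k) \<cdot> J (cst v) (\<lambda>q. E' h q l)"
  by (simp add: cst_tens tE_def case_prod_app J_prod_mul flip: case_prod_beta)

text \<open>For maps that permute tensor factors or insert a fixed factor: \<open>\<pi>\<close> gives the places of the
  original factors, and \<open>d\<close> is the value of the inserted one.\<close>

lemma mon_reindex:
  assumes "mon E V U g c x"
    and "\<And>p k. J (cst (T (axis p 1))) (\<lambda>r. E' H r k) = E g p (\<pi> k) \<cdot> d k"
    and "\<And>k. V' y k = V x (\<pi> k) \<cdot> d k"
  shows "mon E' V' (linK T U) H c y"
  using assms(1) by (simp add: mon_def J_linK assms(2,3) J_const_right assoc)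

lemma mor_one_left_gen:
  assumes T: "\<And>p. T (axis p 1) = tens e (axis p 1)" and e: "\<And>k. J (cst e) (\<lambda>p. E0 g0 p k) = V0 x0 k"
  shows "mor T E V (tE E0 E) (tV V0 V) g x (g0, g) (x0, x) \<one>"
proof -
  let ?F = "\<lambda>a (k, l). V0 x0 k \<cdot> (if a = l then \<one> else 0)"
  have "J (cst (T (axis p 1))) (\<lambda>r. tE E0 E (g0, g) r k) = J (E g p) (\<lambda>a. ?F a k)" for p k
    by (cases k) (simp add: T J_tens_tE e cst_axis J_const_left J_delta)
  moreover have "J (V x) (\<lambda>a. ?F a k) = \<one> \<cdot> tV V0 V (x0, x) k" for k
    by (cases k) (simp add: tV_def J_const_left J_delta)
  ultimately show ?thesis unfolding mor_def by (intro exI[of _ ?F]) blast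
qed

lemma mor_one_right_gen:
  assumes T: "\<And>p. T (axis p 1) = tens (axis p 1) e" and e: "\<And>k. J (cst e) (\<lambda>p. E0 g0 p k) = V0 x0 k"
  shows "mor T E V (tE E E0) (tV V V0) g x (g, g0) (x, x0) \<one>"
proof -
  let ?F = "\<lambda>a (l, k). (if a = l then \<one> else 0) \<cdot> V0 x0 k"
  have "J (cst (T (axis p 1))) (\<lambda>r. tE E E0 (g, g0) r k) = J (E g p) (\<lambda>a. ?F a k)" for p k
    by (cases k) (simp add: T J_tens_tE e cst_axis J_const_right J_delta)
  moreover have "J (V x) (\<lambda>a. ?F a k) = \<one> \<cdot> tV V V0 (x, x0) k" for k
    by (cases k) (simp add: tV_def J_const_right J_delta)
  ultimately show ?thesis unfolding mor_def by (intro exI[of _ ?F]) blast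
qed

end

context generic_points begin

lemma J_one: "g \<in> points \<Longrightarrow> J (cst D_one) (\<lambda>p. E1 g p k) = V1 pone k"
  using mon_one[of g] by (simp add: mon_def)

abbreviation (input) "one_left3 t \<equiv> D.lift3 (*s) t (\<lambda>X1 X2 X3. D.tensor4 D_one X1 X2 X3)"
abbreviation (input) "one_right3 t \<equiv> D.lift3 (*s) t (\<lambda>X1 X2 X3. D.tensor4 X1 X2 X3 D_one)"
abbreviation (input) "comult1 t \<equiv> D.lift3 (*s) t (\<lambda>X1 X2 X3. D.lift2 (*s) (D_comult X1) (\<lambda>a c. D.tensor4 a c X2 X3))"
abbreviation (input) "comult2 t \<equiv> D.lift3 (*s) t (\<lambda>X1 X2 X3. D.lift2 (*s) (D_comult X2) (\<lambda>a c. D.tensor4 X1 a c X3))"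
abbreviation (input) "comult3 t \<equiv> D.lift3 (*s) t (\<lambda>X1 X2 X3. D.lift2 (*s) (D_comult X3) (\<lambda>a c. D.tensor4 X1 X2 a c))"

lemma mor_one_left3:
  "g0 \<in> points \<Longrightarrow> mor (\<lambda>t. one_left3 t) E3 V3 E4 V4 g x (g0, g) (pone, x) \<one>"
proof (rule mor_one_left_gen)
  show "one_left3 (axis p 1) = tens D_one (axis p 1)" for p
    by (cases p) (simp add: arr_lift_axis arr_tensor tens_axis)
qed (rule J_one)

lemma mor_one_right3:
  assumes "l \<in> points"
  shows "mor (\<lambda>t. one_right3 t) E3 V3 E4 V4 (g, h, k) (x, y, z) (g, h, k, l) (x, y, z, pone) (\<one> \<cdot> (\<one> \<cdot> \<one>))"
proof (rule mor_tens)
  show "mor (\<lambda>u. u) E1 V1 E1 V1 g x g x \<one>" by (rule mor_id) rule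
  have "mor (\<lambda>u. tens u D_one) E1 V1 E2 V2 k z (k, l) (z, pone) \<one>"
    by (rule mor_one_right_gen) (rule refl, rule J_one[OF assms])
  then show "mor (tmap (\<lambda>u. u) (\<lambda>u. tens u D_one)) E2 V2 E3 V3 (h, k) (y, z) (h, k, l) (y, z, pone) (\<one> \<cdot> \<one>)"
    by (rule mor_tens[where T = "\<lambda>u. u", OF mor_id[where T = "\<lambda>u. u", OF refl] _ tmap_axis])
  show "one_right3 (axis (p, q) 1) = tens (axis p 1) (tmap (\<lambda>u. u) (\<lambda>u. tens u D_one) (axis q 1))" for p q
    by (cases q) (simp add: arr_lift_axis arr_tensor tmap_axis)
qed

lemma mor_comult1:
  assumes "g \<in> points" "h \<in> points" "x \<in> points"
  shows "mor (\<lambda>t. comult1 t) E3 V3 E4 V4 (g \<otimes> h, k, l) (x, y, z) (g, h, k, l) (x, x, y, z) (ga x g h \<cdot> \<one>)"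
proof (rule mor_amap)
  show "mor (tmap D_comult (\<lambda>u. u)) E3 V3 (tE E2 E2) (tV V2 V2) (g \<otimes> h, k, l) (x, y, z)
      ((g, h), k, l) ((x, x), y, z) (ga x g h \<cdot> \<one>)"
    by (rule mor_tens[OF mor_comult[OF assms] mor_id tmap_axis]) rule
  show "comult1 (axis p 1) = amap (tmap D_comult (\<lambda>u. u) (axis p 1))" for p
    by (cases p) (simp add: arr_lift_axis arr_tensor lift2_tens tmap_axis tens_axis)
qed

lemma mor_comult2:
  assumes "h \<in> points" "k \<in> points" "y \<in> points"
  shows "mor (\<lambda>t. comult2 t) E3 V3 E4 V4 (g, h \<otimes> k, l) (x, y, z) (g, h, k, l) (x, y, y, z) (\<one> \<cdot> (ga y h k \<cdot> \<one>))"
proof (rule mor_tens)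
  show "mor (\<lambda>u. u) E1 V1 E1 V1 g x g x \<one>" by (rule mor_id) rule
  show "mor (\<lambda>t. comult_id t) E2 V2 E3 V3 (h \<otimes> k, l) (y, z) (h, k, l) (y, y, z) (ga y h k \<cdot> \<one>)"
    using assms by (rule mor_comult_id)
  show "comult2 (axis (p, q) 1) = tens (axis p 1) (comult_id (axis q 1))" for p q
    by (cases q) (simp add: arr_lift_axis arr_tensor lift2_vlin[OF vlin_tens(1)])
qed

lemma mor_comult3:
  assumes "k \<in> points" "l \<in> points" "z \<in> points"
  shows "mor (\<lambda>t. comult3 t) E3 V3 E4 V4 (g, h, k \<otimes> l) (x, y, z) (g, h, k, l) (x, y, z, z) (\<one> \<cdot> (\<one> \<cdot> ga z k l))"
proof (rule mor_tens)
  show "mor (\<lambda>u. u) E1 V1 E1 V1 g x g x \<one>" by (rule mor_id) rule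
  show "mor (\<lambda>t. id_comult t) E2 V2 E3 V3 (h, k \<otimes> l) (y, z) (h, k, l) (y, z, z) (\<one> \<cdot> ga z k l)"
    using assms by (rule mor_id_comult)
  show "comult3 (axis (p, q) 1) = tens (axis p 1) (id_comult (axis q 1))" for p q
    by (cases q) (simp add: arr_lift_axis arr_tensor lift2_vlin[OF vlin_tens(1)])
qed

text \<open>At points the pentagon is the cocycle equation for the inverse of \<open>\<omega>\<close>; no group element moves
  any object, since all values lie over the unit.\<close>

lemma D_pentagon:
  "D.mult4 (D.mult4 (one_left3 D_Phi) (comult2 D_Phi)) (one_right3 D_Phi) =
   D.mult4 (comult3 D_Phi) (comult1 D_Phi)"
proof (rule sep04)
  fix g h k l assume G: "g \<in> points" "h \<in> points" "k \<in> points" "l \<in> points"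
  have 1: "mon E4 V4 (cst (one_left3 D_Phi)) (g, h, k, l) (W' h k l) (pone, pone, pone, pone)"
    using mon_linK[OF mor_one_left3[OF G(1)] mon_Phi[of h k l]] by (simp add: cst_lin[OF vlin_lift(2)])
  have 2: "mon E4 V4 (cst (comult2 D_Phi)) (g, h, k, l) (W' g (h \<otimes> k) l) (pone, pone, pone, pone)"
    using mon_linK[OF mor_comult2[OF G(2,3) gone_closed] mon_Phi[of g "h \<otimes> k" l]] G by (simp add: cst_lin[OF vlin_lift(2)])
  have 3: "mon E4 V4 (cst (one_right3 D_Phi)) (g, h, k, l) (W' g h k) (pone, pone, pone, pone)"
    using mon_linK[OF mor_one_right3[OF G(4)] mon_Phi[of g h k]] by (simp add: cst_lin[OF vlin_lift(2)])
  have 4: "mon E4 V4 (cst (comult3 D_Phi)) (g, h, k, l) (W' g h (k \<otimes> l)) (pone, pone, pone, pone)"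
    using mon_linK[OF mor_comult3[OF G(3,4) gone_closed] mon_Phi[of g h "k \<otimes> l"]] G by (simp add: cst_lin[OF vlin_lift(2)])
  have 5: "mon E4 V4 (cst (comult1 D_Phi)) (g, h, k, l) (W' (g \<otimes> h) k l) (pone, pone, pone, pone)"
    using mon_linK[OF mor_comult1[OF G(1,2) gone_closed] mon_Phi[of "g \<otimes> h" k l]] G by (simp add: cst_lin[OF vlin_lift(2)])
  have m: "mon E4 V4 (biK D.mult4 U U') (g, h, k, l) (c \<cdot> d) (pone, pone, pone, pone)"
    if "mon E4 V4 U (g, h, k, l) c (pone, pone, pone, pone)" "mon E4 V4 U' (g, h, k, l) d (pone, pone, pone, pone)" for U U' c d
    using mon4_mult[OF that(1), of U' d pone pone pone pone] that(2) G by simp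
  have "mon E4 V4 (cst (D.mult4 (D.mult4 (one_left3 D_Phi) (comult2 D_Phi)) (one_right3 D_Phi))) (g, h, k, l)
      (W' h k l \<cdot> W' g (h \<otimes> k) l \<cdot> W' g h k) (pone, pone, pone, pone)"
    unfolding cst_bil[OF vbil_D_mults(3)] by (intro m 1 2 3)
  moreover have "mon E4 V4 (cst (D.mult4 (comult3 D_Phi) (comult1 D_Phi))) (g, h, k, l)
      (W' g h (k \<otimes> l) \<cdot> W' (g \<otimes> h) k l) (pone, pone, pone, pone)"
    unfolding cst_bil[OF vbil_D_mults(3)] by (intro m 4 5)
  ultimately show "\<exists>c w.
      mon E4 V4 (cst (D.mult4 (D.mult4 (one_left3 D_Phi) (comult2 D_Phi)) (one_right3 D_Phi))) (g, h, k, l) c w \<and>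
      mon E4 V4 (cst (D.mult4 (comult3 D_Phi) (comult1 D_Phi))) (g, h, k, l) c w"
    unfolding w'_cocycle[OF G] by blast
qed

lemma D_reassociator_counit:
  "D.lift3 (*s) D_Phi (\<lambda>X1 X2 X3. D_counit X2 *s D.tensor2 X1 X3) = tens D_one D_one"
proof (rule sep02)
  fix g h assume G: "g \<in> points" "h \<in> points"
  let ?T = "\<lambda>t. D.lift3 (*s) t (\<lambda>X1 X2 X3. D_counit X2 *s D.tensor2 X1 X3)"
  let ?L = "\<lambda>t. D.lift2 (*s) t (\<lambda>x1 x2. D_counit x1 *s x2)"
  have L: "?L (axis (p, q) 1) = D_counit (axis p 1) *s axis q 1" for p q
    by (simp add: arr_lift_axis)
  have "mor ?T E3 V3 E2 V2 (g, pone, h) (pone, pone, pone) (g, h) (pone, pone) (\<one> \<cdot> \<one>)"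
  proof (rule mor_tens)
    show "mor (\<lambda>u. u) E1 V1 E1 V1 g pone g pone \<one>" by (rule mor_id) rule
    show "mor ?L E2 V2 E1 V1 (pone, h) (pone, pone) h pone \<one>" by (rule mor_counit_left[OF L gone_closed])
    show "?T (axis (p, q) 1) = tens (axis p 1) (?L (axis q 1))" for p q
      by (cases q) (simp add: arr_lift_axis arr_tensor vlin_scale[OF vlin_tens(1)])
  qed
  from mon_linK[OF this mon_Phi] have "mon E2 V2 (cst (?T D_Phi)) (g, h) \<one> (pone, pone)"
    using G by (simp add: cst_lin[OF vlin_lift(2)])
  then show "\<exists>c w. mon E2 V2 (cst (?T D_Phi)) (g, h) c w \<and> mon E2 V2 (cst (tens D_one D_one)) (g, h) c w"
    using mon_ones(1)[OF G] by blast
qed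

sublocale D: quasi_bialgebra "(*s)" "\<lambda>p::'n \<times> 'n. axis p (1::'k)" D_mult D_one D_comult D_counit D_Phi D_Psi
proof (rule quasi_bialgebra.intro[OF D.fd_algebra_comult_axioms], rule quasi_bialgebra_axioms.intro)
qed (rule D_reassociator_inverse D_quasi_coassoc D_pentagon D_reassociator_counit[folded arr_tensor(1)])+

end

section \<open>The R-matrix\<close>

lemma lift3_tens:
  assumes "\<And>v w. vlin (\<lambda>u. F u v w)" "\<And>u w. vlin (\<lambda>v. F u v w)" "\<And>u v. vlin (\<lambda>w. F u v w)"
  shows "arr.lift3 (*s) (tens u (tens v w)) F = F u v w"
proof -
  have 1: "arr.lift3 (*s) (tens (axis p 1) (tens (axis q 1) (axis r 1))) F = F (axis p 1) (axis q 1) (axis r 1)" for p q r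
    by (simp add: tens_axis arr_lift_axis)
  have 2: "arr.lift3 (*s) (tens (axis p 1) (tens (axis q 1) w)) F = F (axis p 1) (axis q 1) w" for p q w
    by (rule vlin_eqI[of "\<lambda>w. arr.lift3 (*s) (tens (axis p 1) (tens (axis q 1) w)) F" "\<lambda>w. F (axis p 1) (axis q 1) w"])
       (rule vlin_comp[OF vlin_lift(2)] vlin_comp[OF vlin_tens(1)] vlin_tens assms 1)+
  have 3: "arr.lift3 (*s) (tens (axis p 1) (tens v w)) F = F (axis p 1) v w" for p v w
    by (rule vlin_eqI[of "\<lambda>v. arr.lift3 (*s) (tens (axis p 1) (tens v w)) F" "\<lambda>v. F (axis p 1) v w"])
       (rule vlin_comp[OF vlin_lift(2)] vlin_comp[OF vlin_tens(1)] vlin_tens assms 2)+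
  show ?thesis
    by (rule vlin_eqI[of "\<lambda>u. arr.lift3 (*s) (tens u (tens v w)) F" "\<lambda>u. F u v w"])
       (rule vlin_comp[OF vlin_lift(2)] vlin_tens assms 3)+
qed

text \<open>These rules turn a product of factors under nested sums into a product of sums.\<close>

lemma lift_vbil:
  assumes m: "vbil m"
  shows "arr.lift2 (*s) t (\<lambda>a c. m (F a c) u) = m (arr.lift2 (*s) t F) u"
    "arr.lift2 (*s) t (\<lambda>a c. m u (F a c)) = m u (arr.lift2 (*s) t F)"
    "arr.lift3 (*s) t3 (\<lambda>a c d. m (G a c d) u) = m (arr.lift3 (*s) t3 G) u"
    "arr.lift3 (*s) t3 (\<lambda>a c d. m u (G a c d)) = m u (arr.lift3 (*s) t3 G)"
  by (rule lift2_vlin[OF vbil_vlin(2)[OF m]] lift2_vlin[OF vbil_vlin(1)[OF m]]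
      lift3_vlin[OF vbil_vlin(2)[OF m]] lift3_vlin[OF vbil_vlin(1)[OF m]])+

lemma (in comm_alg) tE_apply: "tE E E' (g, h) (p, q) (k, l) = E g p k \<cdot> E' h q l"
  and tV_apply: "tV V V' (x, y) (k, l) = V x k \<cdot> V' y l"
  by (simp_all add: tE_def tV_def)

context generic_points begin

lemma D_mult3_tens:
  "D.mult3 (tens a (tens c d)) (tens a' (tens c' d')) =
     tens (D_mult a a') (tens (D_mult c c') (D_mult d d'))"
proof -
  have l: "vlin (\<lambda>u. tens (T u) s)" "vlin (\<lambda>u. tens s' (T u))" if "vlin T"
    for T :: "'k ^ ('n \<times> 'n) \<Rightarrow> 'k ^ 'r::finite" and s :: "'k ^ 's::finite" and s' :: "'k ^ 't::finite"
    by (rule vlin_comp[OF vlin_tens(2) that], rule vlin_comp[OF vlin_tens(1) that])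
  have 1: "arr.lift3 (*s) (tens a' (tens c' d')) (\<lambda>y1 y2 y3. tens (D_mult x1 y1) (tens (D_mult x2 y2) (D_mult x3 y3))) =
     tens (D_mult x1 a') (tens (D_mult x2 c') (D_mult x3 d'))" for x1 x2 x3
    by (rule lift3_tens) (intro l vlin_D_mult)+
  show ?thesis
    unfolding D.mult3_def arr_tensor 1
    by (rule lift3_tens) (intro l vlin_D_mult)+
qed

text \<open>At points \<open>R(g, h) = 1 \<otimes> g\<close>, and its inverse is \<open>\<theta>(h; g\<inverse>, g)\<inverse> 1 \<otimes> g\<inverse>\<close>.\<close>

definition D_R :: "'k ^ (('n \<times> 'n) \<times> ('n \<times> 'n))" where
  "D_R = (\<chi> r. case r of ((i, p), (j, q)) \<Rightarrow> coord p one * (\<epsilon> (b j) * coord q (b i)))"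

definition D_R' :: "'k ^ (('n \<times> 'n) \<times> ('n \<times> 'n))" where
  "D_R' = (\<chi> r. case r of ((i, p), (j, q)) \<Rightarrow> coord p one *
     sw3 (*) (b i) (\<lambda>x1 x2 x3. theta' (b j) (S x1) x2 * coord q (S x3)))"

lemma mon_R: 
  assumes "h \<in> points"
  shows "mon E2 V2 (cst D_R) (g, h) \<one> (pone, g)"
  unfolding mon_def
proof
  fix k :: "'n \<times> 'n"
  obtain k1 k2 where k: "k = (k1, k2)" by (cases k)
  have "J (cst D_R) (\<lambda>p. E2 (g, h) p k) = I g (\<lambda>a. I h (\<lambda>c. pone k1 \<cdot> (emb (\<epsilon> c) \<cdot> emb (coord k2 a))))"
    by (simp add: k J_tE J_EE cst_def D_R_def emb_mult pone_def I_def)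
  also have "\<dots> = \<one> \<cdot> V2 (pone, g) k"
    by (simp add: k tV_def I_const_left I_const_right I_counit[OF assms] I_coord)
  finally show "J (cst D_R) (\<lambda>p. E2 (g, h) p k) = \<one> \<cdot> V2 (pone, g) k" .
qed

lemma mon_R':
  assumes g: "g \<in> points" and h: "h \<in> points"
  shows "mon E2 V2 (cst D_R') (g, h) (th' h (pinv g) g) (pone, pinv g)"
  unfolding mon_def
proof
  fix k :: "'n \<times> 'n"
  obtain k1 k2 where k: "k = (k1, k2)" by (cases k)
  have "J (cst D_R') (\<lambda>p. E2 (g, h) p k) = I g (\<lambda>a. I h (\<lambda>c. pone k1 \<cdot>
      swK a (\<lambda>x1 y. swK y (\<lambda>x2 x3. emb (theta' c (S x1) x2) \<cdot> emb (coord k2 (S x3))))))"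
    by (simp add: k J_tE J_EE cst_def D_R'_def sw3_def emb_sw2 emb_mult pone_def I_def)
  also have "\<dots> = pone k1 \<cdot> (I g (\<lambda>x1. I g (\<lambda>x2. I h (\<lambda>c. emb (theta' c (S x1) x2)))) \<cdot> I g (\<lambda>x3. emb (coord k2 (S x3))))"
    by (simp add: I_const_left I_const_right I_swK I_split g)
  also have "I g (\<lambda>x1. I g (\<lambda>x2. I h (\<lambda>c. emb (theta' c (S x1) x2)))) = th' h (pinv g) g"
    using at3_theta'[OF h ginv_closed[OF g] g]
    by (simp add: at3_def I_pinv lin_rules gamma_rules I_swap[of h g])
  also have "I g (\<lambda>x3. emb (coord k2 (S x3))) = pinv g k2"
    by (simp add: pinv_def)
  also have "pone k1 \<cdot> (th' h (pinv g) g \<cdot> pinv g k2) = th' h (pinv g) g \<cdot> V2 (pone, pinv g) k"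
    by (simp add: k tV_def left_commute)
  finally show "J (cst D_R') (\<lambda>p. E2 (g, h) p k) = th' h (pinv g) g \<cdot> V2 (pone, pinv g) k" .
qed

lemma D_R_invertible: "D.inverses2 D_R D_R'"
  unfolding D.inverses2_def arr_tensor
proof (intro conjI sep02)
  fix g h assume G: "g \<in> points" "h \<in> points"
  have R': "mon E2 V2 (cst D_R') (cj g pone, cj h g) (th' (cj h g) (pinv g) g) (pone, pinv g)"
    using mon_R'[of g "cj h g"] G by simp
  have "mon E2 V2 (biK D.mult2 (cst D_R) (cst D_R')) (g, h)
    (\<one> \<cdot> th' (cj h g) (pinv g) g \<cdot> (th g pone pone \<cdot> th h g (pinv g))) (pone \<otimes> pone, g \<otimes> pinv g)"
    by (rule mon2_mult[OF mon_R R']) (use G in simp_all)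
  then have 1: "mon E2 V2 (biK D.mult2 (cst D_R) (cst D_R')) (g, h) \<one> (pone, pone)"
    using G th_inverse[of "cj h g" "pinv g" g] by (simp add: th_inv_swap commute)
  have R: "mon E2 V2 (cst D_R) (cj g pone, cj h (pinv g)) \<one> (pone, g)"
    using mon_R[of "cj h (pinv g)" g] G by simp
  have "mon E2 V2 (biK D.mult2 (cst D_R') (cst D_R)) (g, h)
    (th' h (pinv g) g \<cdot> \<one> \<cdot> (th g pone pone \<cdot> th h (pinv g) g)) (pone \<otimes> pone, pinv g \<otimes> g)"
    by (rule mon2_mult[OF mon_R' R]) (use G in simp_all)
  then have 2: "mon E2 V2 (biK D.mult2 (cst D_R') (cst D_R)) (g, h) \<one> (pone, pone)"
    using G th_inverse[of h "pinv g" g] by (simp add: commute)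
  show "\<exists>c w. mon E2 V2 (cst (D.mult2 D_R D_R')) (g, h) c w \<and> mon E2 V2 (cst (tens D_one D_one)) (g, h) c w"
    "\<exists>c w. mon E2 V2 (cst (D.mult2 D_R' D_R)) (g, h) c w \<and> mon E2 V2 (cst (tens D_one D_one)) (g, h) c w"
    using 1 2 mon_ones(1)[OF G] unfolding cst_bil[OF vbil_D_mults(1)] by blast+
qed

abbreviation (input) "swap t \<equiv> D.lift2 (*s) t (\<lambda>h1 h2. D.tensor2 h2 h1)"

lemma mon_swap: "mon E2 V2 U (h, g) c (y, x) \<Longrightarrow> mon E2 V2 (linK (\<lambda>t. swap t) U) (g, h) c (x, y)"
  by (rule mon_reindex[where \<pi> = "\<lambda>(k, l). (l, k)" and d = "\<lambda>_. \<one>"])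
     (auto simp: arr_lift_axis arr_tensor J_tens_tE cst_axis tE_apply tV_apply commute)

lemma D_R_comult: "D.mult2 (swap (D_comult u)) D_R = D.mult2 D_R (D_comult u)"
proof -
  have 1: "D.mult2 (swap (D_comult (axis (i, j) 1))) D_R = D.mult2 D_R (D_comult (axis (i, j) 1))" for i j
  proof (rule sep12[of "\<lambda>j. D.mult2 (swap (D_comult (axis (i, j) 1))) D_R"])
    fix x g h assume G: "x \<in> points" "g \<in> points" "h \<in> points"
    have "mon E2 V2 (linK (\<lambda>t. swap t) (linK D_comult (dl x i))) (g, h) ((h \<otimes> g) i \<cdot> ga x h g) (x, x)"
      by (rule mon_swap, rule mon_comult[OF G(3,2,1) mon_dl])
    then have "mon E2 V2 (biK D.mult2 (linK (\<lambda>t. swap t) (linK D_comult (dl x i))) (cst D_R)) (g, h)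
      ((h \<otimes> g) i \<cdot> ga x h g \<cdot> \<one> \<cdot> (th g x pone \<cdot> th h x (cj g x))) (x \<otimes> pone, x \<otimes> cj g x)"
      by (rule mon2_mult[OF _ mon_R]) (use G in simp_all)
    then have a: "mon E2 V2 (biK D.mult2 (linK (\<lambda>t. swap t) (linK D_comult (dl x i))) (cst D_R)) (g, h)
      ((h \<otimes> g) i \<cdot> ga x h g \<cdot> th h x (cj g x)) (x, g \<otimes> x)"
      using G by (simp add: gmul_cj_swap)
    have d: "mon E2 V2 (linK D_comult (dl x i)) (cj g pone, cj h g) ((g \<otimes> cj h g) i \<cdot> ga x g (cj h g)) (x, x)"
      using G by (simp only: cj_gone, intro mon_comult mon_dl cj_closed)
    have "mon E2 V2 (biK D.mult2 (cst D_R) (linK D_comult (dl x i))) (g, h)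
      (\<one> \<cdot> ((g \<otimes> cj h g) i \<cdot> ga x g (cj h g)) \<cdot> (th g pone x \<cdot> th h g x)) (pone \<otimes> x, g \<otimes> x)"
      by (rule mon2_mult[OF mon_R[OF G(3)] d]) (use G in simp_all)
    then have c: "mon E2 V2 (biK D.mult2 (cst D_R) (linK D_comult (dl x i))) (g, h)
      ((h \<otimes> g) i \<cdot> ga x g (cj h g) \<cdot> th h g x) (x, g \<otimes> x)"
      using G by (simp add: gmul_cj_swap)
    have "(h \<otimes> g) i \<cdot> ga x h g \<cdot> th h x (cj g x) = (h \<otimes> g) i \<cdot> ga x g (cj h g) \<cdot> th h g x"
      using ga_th_swap[OF G] by (simp only: assoc)
    then show "\<exists>c w. mon E2 V2 (\<lambda>p. J x (\<lambda>j. cst (D.mult2 (swap (D_comult (axis (i, j) 1))) D_R) p)) (g, h) c w \<and>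
      mon E2 V2 (\<lambda>p. J x (\<lambda>j. cst (D.mult2 D_R (D_comult (axis (i, j) 1))) p)) (g, h) c w"
      using a c by (simp add: av_cst linK_J biK_J_left biK_J_right cst_lin[OF vlin_D_comult]
        cst_lin[OF vlin_lift(1)] cst_bil[OF vbil_D_mults(1)]) metis
  qed
  show ?thesis
  proof (rule vlin_eqI[of "\<lambda>u. D.mult2 (swap (D_comult u)) D_R" "\<lambda>u. D.mult2 D_R (D_comult u)"])
    show "vlin (\<lambda>u. D.mult2 (swap (D_comult u)) D_R)"
      by (rule vlin_comp[OF vbil_vlin(2)[OF vbil_D_mults(1)]], rule vlin_comp[OF vlin_lift(1) vlin_D_comult])
    show "vlin (\<lambda>u. D.mult2 D_R (D_comult u))"
      by (rule vlin_comp[OF vbil_vlin(1)[OF vbil_D_mults(1)] vlin_D_comult])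
  qed (use 1 in auto)
qed

lemma mon3_id_mult:
  assumes "mon E3 V3 U (g1, g2, g3) c (x1, x2, x3)" "mon E3 V3 U' (g1', g2', g3') d (y1, y2, y3)"
    and "cj g1 x1 = g1'" "cj g2 x2 = g2'" "cj g3 x3 = g3'"
    and "g1 \<in> points" "g2 \<in> points" "g3 \<in> points" "x1 \<in> points" "x2 \<in> points" "x3 \<in> points"
      "y1 \<in> points" "y2 \<in> points" "y3 \<in> points"
  shows "mon E3 V3 (biK D.mult3 U U') (g1, g2, g3)
    (c \<cdot> d \<cdot> (th g1 x1 y1 \<cdot> (th g2 x2 y2 \<cdot> th g3 x3 y3))) (x1 \<otimes> y1, x2 \<otimes> y2, x3 \<otimes> y3)"
  using mon3_mult[OF assms(1), of U' d y1 y2 y3] assms(2-) by simp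

lemmas perm_simps = arr_lift_axis arr_tensor J_tens_tE cst_axis J_one tE_apply tV_apply

lemma mon_perm:
  "mon E3 V3 U (k, g, h) c (x, y, z) \<Longrightarrow>
    mon E3 V3 (linK (\<lambda>t. D.lift3 (*s) t (\<lambda>X1 X2 X3. D.tensor3 X2 X3 X1)) U) (g, h, k) c (y, z, x)"
  "mon E3 V3 U (g, k, h) c (x, y, z) \<Longrightarrow>
    mon E3 V3 (linK (\<lambda>t. D.lift3 (*s) t (\<lambda>X1 X2 X3. D.tensor3 X1 X3 X2)) U) (g, h, k) c (x, z, y)"
  "mon E3 V3 U (h, k, g) c (x, y, z) \<Longrightarrow>
    mon E3 V3 (linK (\<lambda>t. D.lift3 (*s) t (\<lambda>X1 X2 X3. D.tensor3 X3 X1 X2)) U) (g, h, k) c (z, x, y)"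
  "mon E3 V3 U (h, g, k) c (x, y, z) \<Longrightarrow>
    mon E3 V3 (linK (\<lambda>t. D.lift3 (*s) t (\<lambda>X1 X2 X3. D.tensor3 X2 X1 X3)) U) (g, h, k) c (y, x, z)"
  subgoal by (rule mon_reindex[where \<pi> = "\<lambda>(k1, k2, k3). (k3, k1, k2)" and d = "\<lambda>_. \<one>"])
     (auto simp: perm_simps ac_simps)
  subgoal by (rule mon_reindex[where \<pi> = "\<lambda>(k1, k2, k3). (k1, k3, k2)" and d = "\<lambda>_. \<one>"])
     (auto simp: perm_simps ac_simps)
  subgoal by (rule mon_reindex[where \<pi> = "\<lambda>(k1, k2, k3). (k2, k3, k1)" and d = "\<lambda>_. \<one>"])
     (auto simp: perm_simps ac_simps)
  subgoal by (rule mon_reindex[where \<pi> = "\<lambda>(k1, k2, k3). (k2, k1, k3)" and d = "\<lambda>_. \<one>"])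
     (auto simp: perm_simps ac_simps)
  done

lemma mon_leg13:
  "h \<in> points \<Longrightarrow> mon E2 V2 U (g, k) c (x, y) \<Longrightarrow>
    mon E3 V3 (linK (\<lambda>t. D.lift2 (*s) t (\<lambda>R1 R2. D.tensor3 R1 D_one R2)) U) (g, h, k) c (x, pone, y)"
  by (rule mon_reindex[where \<pi> = "\<lambda>(k1, k2, k3). (k1, k3)" and d = "\<lambda>(k1, k2, k3). pone k2"])
     (auto simp: perm_simps ac_simps)

lemma mon_leg23:
  "g \<in> points \<Longrightarrow> mon E2 V2 U (h, k) c (x, y) \<Longrightarrow>
    mon E3 V3 (linK (\<lambda>t. D.lift2 (*s) t (\<lambda>R1 R2. D.tensor3 D_one R1 R2)) U) (g, h, k) c (pone, x, y)"
  by (rule mon_reindex[where \<pi> = "\<lambda>(k1, k2, k3). (k2, k3)" and d = "\<lambda>(k1, k2, k3). pone k1"])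
     (auto simp: perm_simps ac_simps)

lemma mon_leg12:
  "k \<in> points \<Longrightarrow> mon E2 V2 U (g, h) c (x, y) \<Longrightarrow>
    mon E3 V3 (linK (\<lambda>t. D.lift2 (*s) t (\<lambda>R1 R2. D.tensor3 R1 R2 D_one)) U) (g, h, k) c (x, y, pone)"
  by (rule mon_reindex[where \<pi> = "\<lambda>(k1, k2, k3). (k1, k2)" and d = "\<lambda>(k1, k2, k3). pone k3"])
     (auto simp: perm_simps ac_simps)

lemma lift3_tensor3: "D.lift3 (*s) t (\<lambda>a c d. D.tensor3 a c d) = t"
  by (rule vlin_eqI[of "\<lambda>t. D.lift3 (*s) t (\<lambda>a c d. D.tensor3 a c d)" "\<lambda>t. t"])
     (auto intro: vlin_lift vlin_id simp: arr_lift_axis arr_tensor tens_axis)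

text \<open>Written as a product of five elements, the right-hand side has the value
  \<open>th' k g h \<cdot> th k g h\<close> at \<open>(g, h, k)\<close>: the three values of \<open>\<omega>\<close> that come from the
  reassociators are those in the definition of \<open>\<theta>(k; g, h)\<close>, and \<open>\<theta>\<close> itself comes from multiplying
  the two copies of \<open>R\<close>.\<close>

lemma D_hexagon_left:
  "comult_id D_R = D.lift3 (*s) D_Phi (\<lambda>X1 X2 X3. D.lift2 (*s) D_R (\<lambda>R1 R2. D.lift3 (*s) D_Psi (\<lambda>x1 x2 x3.
     D.lift2 (*s) D_R (\<lambda>r1 r2. D.lift3 (*s) D_Phi (\<lambda>Y1 Y2 Y3.
       D.tensor3 (D_mult (D_mult (D_mult X2 R1) x1) Y1) (D_mult (D_mult (D_mult X3 x3) r1) Y2)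
         (D_mult (D_mult (D_mult (D_mult X1 R2) x2) r2) Y3))))))" (is "_ = ?R")
proof -
  let ?A = "D.lift3 (*s) D_Phi (\<lambda>X1 X2 X3. D.tensor3 X2 X3 X1)"
  let ?B = "D.lift2 (*s) D_R (\<lambda>R1 R2. D.tensor3 R1 D_one R2)"
  let ?C = "D.lift3 (*s) D_Psi (\<lambda>X1 X2 X3. D.tensor3 X1 X3 X2)"
  let ?D = "D.lift2 (*s) D_R (\<lambda>R1 R2. D.tensor3 D_one R1 R2)"
  have t: "D.tensor3 (D_mult (D_mult (D_mult X2 R1) x1) Y1) (D_mult (D_mult (D_mult X3 x3) r1) Y2)
         (D_mult (D_mult (D_mult (D_mult X1 R2) x2) r2) Y3) =
      D.mult3 (D.mult3 (D.mult3 (D.mult3 (D.tensor3 X2 X3 X1) (D.tensor3 R1 D_one R2)) (D.tensor3 x1 x3 x2))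
        (D.tensor3 D_one r1 r2)) (D.tensor3 Y1 Y2 Y3)" for X1 X2 X3 R1 R2 x1 x2 x3 r1 r2 Y1 Y2 Y3
    by (simp add: arr_tensor D_mult3_tens D_one_left D_one_right)
  have R: "?R = D.mult3 (D.mult3 (D.mult3 (D.mult3 ?A ?B) ?C) ?D) D_Phi"
    unfolding t by (simp only: lift_vbil[OF vbil_D_mults(2)] lift3_tensor3)
  show ?thesis
    unfolding R
  proof (rule sep03)
    fix g h k assume G: "g \<in> points" "h \<in> points" "k \<in> points"
    let ?k = "cj k g"
    have l: "mon E3 V3 (cst (comult_id D_R)) (g, h, k) (\<one> \<cdot> (ga pone g h \<cdot> \<one>)) (pone, pone, g \<otimes> h)"
      unfolding cst_lin[OF vlin_lift(1)] by (rule mon_linK[OF mor_comult_id[OF G(1,2) gone_closed] mon_R[OF G(3)]])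
    have A: "mon E3 V3 (cst ?A) (g, h, k) (W' k g h) (pone, pone, pone)"
      unfolding cst_lin[OF vlin_lift(2)] by (rule mon_perm(1)[OF mon_Phi])
    have B: "mon E3 V3 (cst ?B) (g, h, k) \<one> (pone, pone, g)"
      unfolding cst_lin[OF vlin_lift(1)] by (rule mon_leg13[OF G(2) mon_R[OF G(3)]])
    have C: "mon E3 V3 (cst ?C) (g, h, ?k) (W g ?k h) (pone, pone, pone)"
      unfolding cst_lin[OF vlin_lift(2)] by (rule mon_perm(2)[OF mon_Psi])
    have D: "mon E3 V3 (cst ?D) (g, h, ?k) \<one> (pone, pone, h)"
      unfolding cst_lin[OF vlin_lift(1)] by (rule mon_leg23[OF G(1) mon_R]) (use G in simp)
    have 1: "mon E3 V3 (biK D.mult3 (cst ?A) (cst ?B)) (g, h, k) (W' k g h) (pone, pone, g)"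
      using mon3_id_mult[OF A B] G by simp
    have 2: "mon E3 V3 (biK D.mult3 (biK D.mult3 (cst ?A) (cst ?B)) (cst ?C)) (g, h, k) (W' k g h \<cdot> W g ?k h) (pone, pone, g)"
      using mon3_id_mult[OF 1 C] G by simp
    have 3: "mon E3 V3 (biK D.mult3 (biK D.mult3 (biK D.mult3 (cst ?A) (cst ?B)) (cst ?C)) (cst ?D)) (g, h, k)
      (W' k g h \<cdot> W g ?k h \<cdot> th k g h) (pone, pone, g \<otimes> h)"
      using mon3_id_mult[OF 2 D] G by simp
    have 4: "mon E3 V3 (biK D.mult3 (biK D.mult3 (biK D.mult3 (biK D.mult3 (cst ?A) (cst ?B)) (cst ?C)) (cst ?D)) (cst D_Phi)) (g, h, k)
      (W' k g h \<cdot> W g ?k h \<cdot> th k g h \<cdot> W' g h (cj k (g \<otimes> h))) (pone, pone, g \<otimes> h)"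
      using mon3_id_mult[OF 3 mon_Phi] G by simp
    have "W' k g h \<cdot> W g ?k h \<cdot> th k g h \<cdot> W' g h (cj k (g \<otimes> h)) = th' k g h \<cdot> th k g h"
      unfolding th'_def by (simp only: ac_simps)
    then have e: "W' k g h \<cdot> W g ?k h \<cdot> th k g h \<cdot> W' g h (cj k (g \<otimes> h)) = \<one>"
      using th_inverse[OF G(3,1,2)] by (simp only: commute)
    show "\<exists>c w. mon E3 V3 (cst (comult_id D_R)) (g, h, k) c w \<and>
       mon E3 V3 (cst (D.mult3 (D.mult3 (D.mult3 (D.mult3 ?A ?B) ?C) ?D) D_Phi)) (g, h, k) c w"
      unfolding cst_bil[OF vbil_D_mults(2)] using l 4 G by (simp add: e) blast
  qed
qed

text \<open>Here the copies of \<open>R\<close> act in different tensor factors, and the three values of \<open>\<omega>\<close> form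
  \<open>\<gamma>\<^sub>g(h, k)\<close>, which is the coproduct of the second leg of \<open>R\<close>.\<close>

lemma D_hexagon_right:
  "id_comult D_R = D.lift3 (*s) D_Psi (\<lambda>x1 x2 x3. D.lift2 (*s) D_R (\<lambda>R1 R2. D.lift3 (*s) D_Phi (\<lambda>X1 X2 X3.
     D.lift2 (*s) D_R (\<lambda>r1 r2. D.lift3 (*s) D_Psi (\<lambda>y1 y2 y3.
       D.tensor3 (D_mult (D_mult (D_mult (D_mult x3 R1) X2) r1) y1) (D_mult (D_mult (D_mult x1 X1) r2) y2)
         (D_mult (D_mult (D_mult x2 R2) X3) y3))))))" (is "_ = ?R")
proof -
  let ?A = "D.lift3 (*s) D_Psi (\<lambda>X1 X2 X3. D.tensor3 X3 X1 X2)"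
  let ?B = "D.lift2 (*s) D_R (\<lambda>R1 R2. D.tensor3 R1 D_one R2)"
  let ?C = "D.lift3 (*s) D_Phi (\<lambda>X1 X2 X3. D.tensor3 X2 X1 X3)"
  let ?D = "D.lift2 (*s) D_R (\<lambda>R1 R2. D.tensor3 R1 R2 D_one)"
  have t: "D.tensor3 (D_mult (D_mult (D_mult (D_mult x3 R1) X2) r1) y1) (D_mult (D_mult (D_mult x1 X1) r2) y2)
         (D_mult (D_mult (D_mult x2 R2) X3) y3) =
      D.mult3 (D.mult3 (D.mult3 (D.mult3 (D.tensor3 x3 x1 x2) (D.tensor3 R1 D_one R2)) (D.tensor3 X2 X1 X3))
        (D.tensor3 r1 r2 D_one)) (D.tensor3 y1 y2 y3)" for X1 X2 X3 R1 R2 x1 x2 x3 r1 r2 y1 y2 y3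
    by (simp add: arr_tensor D_mult3_tens D_one_left D_one_right)
  have R: "?R = D.mult3 (D.mult3 (D.mult3 (D.mult3 ?A ?B) ?C) ?D) D_Psi"
    unfolding t by (simp only: lift_vbil[OF vbil_D_mults(2)] lift3_tensor3)
  show ?thesis
    unfolding R
  proof (rule sep03)
    fix g h k assume G: "g \<in> points" "h \<in> points" "k \<in> points"
    let ?k = "cj k g" and ?h = "cj h g"
    have l: "mon E3 V3 (cst (id_comult D_R)) (g, h, k) (\<one> \<cdot> (\<one> \<cdot> ga g h k)) (pone, g, g)"
      unfolding cst_lin[OF vlin_lift(1)]
      by (rule mon_linK[OF mor_id_comult[OF G(2,3,1)] mon_R]) (use G in simp)
    have A: "mon E3 V3 (cst ?A) (g, h, k) (W h k g) (pone, pone, pone)"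
      unfolding cst_lin[OF vlin_lift(2)] by (rule mon_perm(3)[OF mon_Psi])
    have B: "mon E3 V3 (cst ?B) (g, h, k) \<one> (pone, pone, g)"
      unfolding cst_lin[OF vlin_lift(1)] by (rule mon_leg13[OF G(2) mon_R[OF G(3)]])
    have C: "mon E3 V3 (cst ?C) (g, h, ?k) (W' h g ?k) (pone, pone, pone)"
      unfolding cst_lin[OF vlin_lift(2)] by (rule mon_perm(4)[OF mon_Phi])
    have D: "mon E3 V3 (cst ?D) (g, h, ?k) \<one> (pone, g, pone)"
      unfolding cst_lin[OF vlin_lift(1)] by (rule mon_leg12[OF _ mon_R]) (use G in simp_all)
    have 1: "mon E3 V3 (biK D.mult3 (cst ?A) (cst ?B)) (g, h, k) (W h k g) (pone, pone, g)"
      using mon3_id_mult[OF A B] G by simp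
    have 2: "mon E3 V3 (biK D.mult3 (biK D.mult3 (cst ?A) (cst ?B)) (cst ?C)) (g, h, k) (W h k g \<cdot> W' h g ?k) (pone, pone, g)"
      using mon3_id_mult[OF 1 C] G by simp
    have 3: "mon E3 V3 (biK D.mult3 (biK D.mult3 (biK D.mult3 (cst ?A) (cst ?B)) (cst ?C)) (cst ?D)) (g, h, k)
      (W h k g \<cdot> W' h g ?k) (pone, g, g)"
      using mon3_id_mult[OF 2 D] G by simp
    have 4: "mon E3 V3 (biK D.mult3 (biK D.mult3 (biK D.mult3 (biK D.mult3 (cst ?A) (cst ?B)) (cst ?C)) (cst ?D)) (cst D_Psi)) (g, h, k)
      (W h k g \<cdot> W' h g ?k \<cdot> W g ?h ?k) (pone, g, g)"
      using mon3_id_mult[OF 3 mon_Psi] G by simp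
    have e: "W h k g \<cdot> W' h g ?k \<cdot> W g ?h ?k = ga g h k"
      unfolding ga_def by (simp only: ac_simps)
    show "\<exists>c w. mon E3 V3 (cst (id_comult D_R)) (g, h, k) c w \<and>
       mon E3 V3 (cst (D.mult3 (D.mult3 (D.mult3 (D.mult3 ?A ?B) ?C) ?D) D_Psi)) (g, h, k) c w"
      unfolding cst_bil[OF vbil_D_mults(2)] using l 4 G by (simp add: e) blast
  qed
qed

lemma D_R_counit_left: "D.lift2 (*s) D_R (\<lambda>R1 R2. D_counit R1 *s R2) = D_one"
proof (rule sep01)
  fix g assume G: "g \<in> points"
  let ?T = "\<lambda>t. D.lift2 (*s) t (\<lambda>x1 x2. D_counit x1 *s x2)"
  have T: "?T (axis (p, q) 1) = D_counit (axis p 1) *s axis q 1" for p q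
    by (simp add: arr_lift_axis)
  have "mon E1 V1 (cst (?T D_R)) g (\<one> \<cdot> \<one>) pone"
    unfolding cst_lin[OF vlin_lift(1)] by (rule mon_linK[OF mor_counit_left[OF T gone_closed] mon_R[OF G]])
  then show "\<exists>c w. mon E1 V1 (cst (?T D_R)) g c w \<and> mon E1 V1 (cst D_one) g c w"
    using mon_one[OF G] by simp blast
qed

lemma D_R_counit_right: "D.lift2 (*s) D_R (\<lambda>R1 R2. D_counit R2 *s R1) = D_one"
proof (rule sep01)
  fix g assume G: "g \<in> points"
  let ?T = "\<lambda>t. D.lift2 (*s) t (\<lambda>x1 x2. D_counit x2 *s x1)"
  have T: "?T (axis (p, q) 1) = D_counit (axis q 1) *s axis p 1" for p q
    by (simp add: arr_lift_axis)
  have "mon E1 V1 (cst (?T D_R)) g (\<one> \<cdot> \<one>) pone"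
    unfolding cst_lin[OF vlin_lift(1)] by (rule mon_linK[OF mor_counit_right[OF T G] mon_R[OF gone_closed]])
  then show "\<exists>c w. mon E1 V1 (cst (?T D_R)) g c w \<and> mon E1 V1 (cst D_one) g c w"
    using mon_one[OF G] by simp blast
qed

end

section \<open>The antipode\<close>

context comm_alg begin

lemma J_homogeneous2:
  fixes x y :: "'n::finite \<Rightarrow> 'c"
  shows "J (\<lambda>((a, m), (c, n)). F a c \<cdot> (x m \<cdot> y n)) f =
    J (\<lambda>_. \<one>) (\<lambda>a. J (F a) (\<lambda>c. J x (\<lambda>m. J y (\<lambda>n. f ((a, m), (c, n))))))"
proof -
  have "J (\<lambda>((a, m), (c, n)). F a c \<cdot> (x m \<cdot> y n)) f =
    (\<Sum>a\<in>UNIV. \<Sum>m\<in>UNIV. \<Sum>c\<in>UNIV. \<Sum>n\<in>UNIV. F a c \<cdot> (x m \<cdot> y n) \<cdot> f ((a, m), (c, n)))"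
    unfolding J_def sum_UNIV_pair by simp
  also have "\<dots> = (\<Sum>a\<in>UNIV. \<Sum>c\<in>UNIV. \<Sum>m\<in>UNIV. \<Sum>n\<in>UNIV. F a c \<cdot> (x m \<cdot> y n) \<cdot> f ((a, m), (c, n)))"
    by (intro sum.cong refl sum.swap)
  finally show ?thesis by (simp add: J_def sum_mul_left assoc)
qed

lemma J_homogeneous3:
  fixes x y z :: "'n::finite \<Rightarrow> 'c"
  shows "J (\<lambda>((a, m), (c, n), (d, p)). F a c d \<cdot> (x m \<cdot> (y n \<cdot> z p))) f =
    J (\<lambda>_. \<one>) (\<lambda>a. J (\<lambda>_. \<one>) (\<lambda>c. J (F a c) (\<lambda>d.
      J x (\<lambda>m. J y (\<lambda>n. J z (\<lambda>p. f ((a, m), (c, n), (d, p))))))))"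
proof -
  have s: "(\<Sum>m\<in>UNIV. \<Sum>c\<in>UNIV. \<Sum>n\<in>UNIV. \<Sum>d\<in>UNIV. \<Sum>p\<in>UNIV. g m c n d p) =
     (\<Sum>c\<in>UNIV. \<Sum>d\<in>UNIV. \<Sum>m\<in>UNIV. \<Sum>n\<in>UNIV. \<Sum>p\<in>UNIV. g m c n d p)"
    for g :: "'n \<Rightarrow> 'q::finite \<Rightarrow> 'n \<Rightarrow> 'r::finite \<Rightarrow> 'n \<Rightarrow> 'c"
  proof -
    have "(\<Sum>m\<in>UNIV. \<Sum>c\<in>UNIV. \<Sum>n\<in>UNIV. \<Sum>d\<in>UNIV. \<Sum>p\<in>UNIV. g m c n d p)
      = (\<Sum>c\<in>UNIV. \<Sum>m\<in>UNIV. \<Sum>n\<in>UNIV. \<Sum>d\<in>UNIV. \<Sum>p\<in>UNIV. g m c n d p)"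
      by (rule sum.swap)
    also have "\<dots> = (\<Sum>c\<in>UNIV. \<Sum>m\<in>UNIV. \<Sum>d\<in>UNIV. \<Sum>n\<in>UNIV. \<Sum>p\<in>UNIV. g m c n d p)"
      by (intro sum.cong refl sum.swap)
    also have "\<dots> = (\<Sum>c\<in>UNIV. \<Sum>d\<in>UNIV. \<Sum>m\<in>UNIV. \<Sum>n\<in>UNIV. \<Sum>p\<in>UNIV. g m c n d p)"
      by (intro sum.cong refl sum.swap)
    finally show ?thesis .
  qed
  have "J (\<lambda>((a, m), (c, n), (d, p)). F a c d \<cdot> (x m \<cdot> (y n \<cdot> z p))) f =
    (\<Sum>a\<in>UNIV. \<Sum>m\<in>UNIV. \<Sum>c\<in>UNIV. \<Sum>n\<in>UNIV. \<Sum>d\<in>UNIV. \<Sum>p\<in>UNIV.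
      F a c d \<cdot> (x m \<cdot> (y n \<cdot> z p)) \<cdot> f ((a, m), (c, n), (d, p)))"
    unfolding J_def sum_UNIV_pair by simp
  also have "\<dots> = (\<Sum>a\<in>UNIV. \<Sum>c\<in>UNIV. \<Sum>d\<in>UNIV. \<Sum>m\<in>UNIV. \<Sum>n\<in>UNIV. \<Sum>p\<in>UNIV.
      F a c d \<cdot> (x m \<cdot> (y n \<cdot> z p)) \<cdot> f ((a, m), (c, n), (d, p)))"
    unfolding s ..
  finally show ?thesis by (simp add: J_def sum_mul_left assoc)
qed

lemma J_one_weight: "J (\<lambda>_. \<one>) (\<lambda>a. J (F a) (\<lambda>c. x a \<cdot> f a c)) = J x (\<lambda>a. J (F a) (f a))"
  by (simp add: J_def sum_mul_left ac_simps)

end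

context generic_points begin

definition D_beta :: "'k ^ ('n \<times> 'n)" where
  "D_beta = fn (\<lambda>a. sw3 (*) a (\<lambda>a1 a2 a3. \<omega> a1 (S a2) a3))"

lemma mon_beta: "g \<in> points \<Longrightarrow> mon E1 V1 (cst D_beta) g (be g) pone"
  unfolding D_beta_def
  by (rule mon_cong[OF mon_fn])
     (simp_all add: sw3_def emb_sw2 I_split be_def at3_def I_pinv lin_rules omega_rules)

text \<open>At points \<open>S(\<phi> # x)(g) = \<phi>(x g\<inverse> x\<inverse>) \<kappa>(g, x) x\<inverse>\<close>.\<close>

definition D_S :: "'k ^ ('n \<times> 'n) \<Rightarrow> 'k ^ ('n \<times> 'n)" where
  "D_S u = (\<Sum>p\<in>UNIV. (u $ p) *s (\<chi> r. case (p, r) of ((i, j), (a, m)) \<Rightarrow>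
     sw2 (*) (b a) (\<lambda>g1 g2. sw4 (*) (b j) (\<lambda>x1 x2 x3 x4.
       coord i (x1 \<odot> (S g1 \<odot> S x2)) * (kappa g2 x3 * coord m (S x4))))))"

lemma vlin_D_S: "vlin D_S"
  unfolding D_S_def
  by (rule vlinI) (simp_all add: vec.scale_left_distrib sum.distrib vec.scale_sum_right)

lemma D_S_axis: "D_S (axis (i, j) 1) $ (a, m) =
  sw2 (*) (b a) (\<lambda>g1 g2. sw4 (*) (b j) (\<lambda>x1 x2 x3 x4.
       coord i (x1 \<odot> (S g1 \<odot> S x2)) * (kappa g2 x3 * coord m (S x4))))"
  unfolding D_S_def sum_axis by simp

lemma at2_ka: "g \<in> points \<Longrightarrow> x \<in> points \<Longrightarrow> at2 kappa g x = ka g x"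
  by (simp add: at2_kappa ka_def)

lemma J_dl: "J (dl x i) f = J x (\<lambda>m. f (i, m))"
  by (simp add: J_av cst_axis)

lemma mon_S:
  assumes g: "g \<in> points" and x: "x \<in> points"
  shows "mon E1 V1 (linK D_S (dl x i)) g ((cj (pinv g) (pinv x)) i \<cdot> ka g x) (pinv x)"
  unfolding mon_def
proof
  fix m
  have 1: "I x (\<lambda>x1. I x (\<lambda>x2. I g (\<lambda>g1. emb (coord i (x1 \<odot> (S g1 \<odot> S x2)))))) = (cj (pinv g) (pinv x)) i"
  proof -
    have "(cj (pinv g) (pinv x)) i = I (x \<otimes> (pinv g \<otimes> pinv x)) (\<lambda>e. emb (coord i e))"
      using g x by (simp add: I_coord cj_def gassoc)
    also have "\<dots> = I x (\<lambda>x1. I g (\<lambda>g1. I x (\<lambda>x2. emb (coord i (x1 \<odot> (S g1 \<odot> S x2))))))"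
      by (simp add: I_pmul I_pinv lin_rules mult_assoc)
    finally show ?thesis by (simp only: I_swap[of g x])
  qed
  have 2: "I x (\<lambda>x3. I g (\<lambda>g2. emb (kappa g2 x3))) = ka g x"
    using at2_ka[OF g x] unfolding at2_def by (simp only: I_swap[of g x])
  have "J (linK D_S (dl x i)) (\<lambda>p. E1 g p m) = I x (\<lambda>c. I g (\<lambda>a.
      swK a (\<lambda>g1 g2. swK c (\<lambda>x1 y. swK y (\<lambda>x2 y. swK y (\<lambda>x3 x4.
       emb (coord i (x1 \<odot> (S g1 \<odot> S x2))) \<cdot> (emb (kappa g2 x3) \<cdot> emb (coord m (S x4)))))))))"
    unfolding J_linK J_dl
    by (simp add: J_EE cst_def D_S_axis sw4_def sw3_def emb_sw2 emb_mult I_def)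
  also have "\<dots> = I x (\<lambda>x1. I x (\<lambda>x2. I g (\<lambda>g1. emb (coord i (x1 \<odot> (S g1 \<odot> S x2))))))
      \<cdot> (I x (\<lambda>x3. I g (\<lambda>g2. emb (kappa g2 x3))) \<cdot> I x (\<lambda>x4. emb (coord m (S x4))))"
    by (simp add: I_swK I_split g x I_swap[of g x] I_const_left I_const_right)
  also have "I x (\<lambda>x4. emb (coord m (S x4))) = (pinv x) m"
    by (simp add: pinv_def)
  finally show "J (linK D_S (dl x i)) (\<lambda>p. E1 g p m) = (cj (pinv g) (pinv x)) i \<cdot> ka g x \<cdot> V1 (pinv x) m"
    by (simp only: 1 2 assoc)
qed

text \<open>The value of \<open>S(U)\<close> at \<open>g\<close> depends on the value of \<open>U\<close> at a point that involves the group element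
  of \<open>U\<close>.  So \<open>S\<close> is not a \<open>mor\<close>, and \<open>U\<close> must have the same group element \<open>x\<close> everywhere,
  that is, \<open>U = F # x\<close>.\<close>

lemma mon_S_homogeneous:
  assumes U: "U = (\<lambda>(a, m). F a \<cdot> x m)"
    and mon: "mon E1 V1 U (cj (pinv g) (pinv x)) c x"
    and g: "g \<in> points" and x: "x \<in> points"
  shows "mon E1 V1 (linK D_S U) g (c \<cdot> ka g x) (pinv x)"
proof -
  let ?g = "cj (pinv g) (pinv x)"
  have "(\<lambda>k. J ?g F \<cdot> x k) = (\<lambda>k. c \<cdot> x k)"
    using mon unfolding mon_def U by (simp add: J_EE J_const_right)
  then have "J ?g F \<cdot> J x (\<lambda>k. emb (\<epsilon> (b k))) = c \<cdot> J x (\<lambda>k. emb (\<epsilon> (b k)))"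
    by (simp only: J_scale[symmetric])
  then have F: "J F ?g = c"
    by (simp add: J_counit x) (simp add: J_def commute)
  have "J (linK D_S U) (\<lambda>r. E1 g r k) = c \<cdot> ka g x \<cdot> V1 (pinv x) k" for k
  proof -
    have "J (linK D_S U) (\<lambda>r. E1 g r k) = J F (\<lambda>a. J (linK D_S (dl x a)) (\<lambda>r. E1 g r k))"
      unfolding U J_linK J_pair J_dl ..
    also have "\<dots> = J F (\<lambda>a. ?g a \<cdot> ka g x \<cdot> V1 (pinv x) k)"
      using mon_S[OF g x] unfolding mon_def by simp
    finally show ?thesis by (simp add: J_const_right F)
  qed
  then show ?thesis unfolding mon_def by blast
qed

lemma D_mult_homogeneous:
  assumes "x \<in> points" "y \<in> points"
  shows "\<exists>F. biK D_mult (dl x i) (dl y i') = (\<lambda>(a, m). F a \<cdot> (x \<otimes> y) m)"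
proof (intro exI ext)
  fix r :: "'n \<times> 'n"
  obtain a m where r: "r = (a, m)" by (cases r)
  let ?F = "\<lambda>a. I x (\<lambda>h1. I x (\<lambda>h2. I x (\<lambda>h3. I y (\<lambda>h1'.
      emb ((coord i \<star> (h1 \<rightharpoonup> coord i' \<leftharpoonup> S h2) \<star> sigma h3 h1') (b a))))))"
  have "biK D_mult (dl x i) (dl y i') r = I x (\<lambda>h. I y (\<lambda>h'. emb (smash_mult (coord i) h (coord i') h' $ (a, m))))"
    unfolding biK_def J_dl by (simp add: D_mult_axis cst_def r I_def)
  also have "\<dots> = ?F a \<cdot> I x (\<lambda>h4. I y (\<lambda>h2'. emb (coord m (h4 \<odot> h2'))))"
    by (simp add: smash_mult_def sw4_def sw3_def sw2_vec_component smash_def emb_sw2 emb_mult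
        I_swK I_split assms I_const_left I_const_right)
  finally show "biK D_mult (dl x i) (dl y i') r = (case r of (a, m) \<Rightarrow> ?F a \<cdot> (x \<otimes> y) m)"
    by (simp add: r pmul_def)
qed

lemma D_S_mult: "D_S (D_mult u v) = D_mult (D_S v) (D_S u)"
proof -
  have 1: "D_S (D_mult (axis (i, j) 1) (axis (i', l) 1)) = D_mult (D_S (axis (i', l) 1)) (D_S (axis (i, j) 1))" for i j i' l
  proof (rule sep21[of "\<lambda>j l. D_S (D_mult (axis (i, j) 1) (axis (i', l) 1))"])
    fix x y g assume G: "x \<in> points" "y \<in> points" "g \<in> points"
    let ?g = "cj (pinv g) (pinv (x \<otimes> y))"
    obtain F where F: "biK D_mult (dl x i) (dl y i') = (\<lambda>(a, m). F a \<cdot> (x \<otimes> y) m)"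
      using D_mult_homogeneous[OF G(1,2)] by blast
    have "mon E1 V1 (biK D_mult (dl x i) (dl y i')) ?g (?g i \<cdot> (cj ?g x) i' \<cdot> th ?g x y) (x \<otimes> y)"
      using G by (intro mon1_mult mon_dl cj_closed ginv_closed gmul_closed)
    then have a: "mon E1 V1 (linK D_S (biK D_mult (dl x i) (dl y i'))) g
        (?g i \<cdot> (cj ?g x) i' \<cdot> th ?g x y \<cdot> ka g (x \<otimes> y)) (pinv (x \<otimes> y))"
      using G by (intro mon_S_homogeneous[OF F]) simp_all
    have c: "mon E1 V1 (biK D_mult (linK D_S (dl y i')) (linK D_S (dl x i))) g
        (((cj (pinv g) (pinv y)) i' \<cdot> ka g y) \<cdot> ((cj (pinv (cj g (pinv y))) (pinv x)) i \<cdot> ka (cj g (pinv y)) x)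
          \<cdot> th g (pinv y) (pinv x)) (pinv y \<otimes> pinv x)"
      using G by (intro mon1_mult mon_S cj_closed ginv_closed)
    have g1: "cj ?g x = cj (pinv g) (pinv y)" "cj (pinv (cj g (pinv y))) (pinv x) = ?g"
      using G by (simp_all add: cj_cj ginv_gmul ginv_cj gassoc)
    have "?g i \<cdot> (cj ?g x) i' \<cdot> th ?g x y \<cdot> ka g (x \<otimes> y) = ?g i \<cdot> (cj ?g x) i' \<cdot> (th ?g x y \<cdot> ka g (x \<otimes> y))"
      by (simp only: assoc)
    also have "\<dots> = ((cj (pinv g) (pinv y)) i' \<cdot> ka g y) \<cdot> ((cj (pinv (cj g (pinv y))) (pinv x)) i \<cdot> ka (cj g (pinv y)) x)
          \<cdot> th g (pinv y) (pinv x)"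
      unfolding g1 ka_mult[OF G(3,1,2)] by (simp only: ac_simps)
    finally show "\<exists>c w. mon E1 V1 (\<lambda>p. J x (\<lambda>j. J y (\<lambda>l. cst (D_S (D_mult (axis (i, j) 1) (axis (i', l) 1))) p))) g c w \<and>
      mon E1 V1 (\<lambda>p. J x (\<lambda>j. J y (\<lambda>l. cst (D_mult (D_S (axis (i', l) 1)) (D_S (axis (i, j) 1))) p))) g c w"
      using a c unfolding ginv_gmul[OF G(1,2)]
      by (simp only: av_cst linK_J biK_J_left biK_J_right cst_lin[OF vlin_D_S] cst_bil[OF vbil_D_mult] J_swap[of x y]) metis
  qed
  show ?thesis
  proof (rule vbil_eqI[of "\<lambda>u v. D_S (D_mult u v)" "\<lambda>u v. D_mult (D_S v) (D_S u)"])
    show "vbil (\<lambda>u v. D_S (D_mult u v))"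
      by (intro vbilI vlin_comp[OF vlin_D_S] vlin_D_mult)
    show "vbil (\<lambda>u v. D_mult (D_S v) (D_S u))"
      by (intro vbilI vlin_D_mult_comp vlin_D_S)
    show "D_S (D_mult (axis p 1) (axis q 1)) = D_mult (D_S (axis q 1)) (D_S (axis p 1))" for p q
      by (cases p, cases q) (simp only: 1)
  qed
qed

lemma D_S_one: "D_S D_one = D_one"
proof (rule sep01)
  fix g assume g: "g \<in> points"
  have U: "cst D_one = (\<lambda>(a, m). emb (\<epsilon> (b a)) \<cdot> pone m)"
    by (auto simp: cst_def D_one_def smash_def emb_mult pone_def)
  have "mon E1 V1 (linK D_S (cst D_one)) g (\<one> \<cdot> ka g pone) (pinv pone)"
    using g by (intro mon_S_homogeneous[OF U] mon_one cj_closed ginv_closed gone_closed)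
  then show "\<exists>c w. mon E1 V1 (cst (D_S D_one)) g c w \<and> mon E1 V1 (cst D_one) g c w"
    using g mon_one[OF g] by (simp add: cst_lin[OF vlin_D_S]) blast
qed

lemma comult_homogeneous:
  assumes x: "x \<in> points"
  shows "linK D_comult (dl x i) = (\<lambda>((a, m), (c, n)). I x (\<lambda>y. emb (comult_coeff y i (b a) (b c))) \<cdot> (x m \<cdot> x n))"
proof -
  have "linK D_comult (dl x i) ((a, m), (c, n)) = I x (\<lambda>y. emb (comult_coeff y i (b a) (b c))) \<cdot> (x m \<cdot> x n)" for a m c n
  proof -
    have "linK D_comult (dl x i) ((a, m), (c, n)) = I x (\<lambda>y. swK y (\<lambda>x1 y. swK y (\<lambda>x2 x3.
        emb (comult_coeff x1 i (b a) (b c)) \<cdot> (emb (coord m x2) \<cdot> emb (coord n x3)))))"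
      unfolding linK_def J_dl by (simp add: cst_def D_comult_axis sw3_def emb_sw2 emb_mult I_def)
    then show ?thesis
      by (simp add: I_split x I_const_left I_const_right I_coord)
  qed
  then show ?thesis by auto
qed

text \<open>Contracts the coproduct of \<open>coord i # x\<close> with a bilinear expression in its two factors, such as
  \<open>S(h\<^sub>1) h\<^sub>2\<close>.  The coproduct is a combination of tensors \<open>(coord a # x) \<otimes> (coord c # x)\<close>; if the
  expression evaluates \<open>coord a\<close> at \<open>g\<close> and \<open>coord c\<close> at \<open>h\<close>, the coefficients add up to
  \<open>coord i (g h) \<gamma>\<^sub>x(g, h)\<close>.\<close>

lemma comult_contract:
  assumes G: "x \<in> points" "g \<in> points" "h \<in> points" 
    and f: "\<And>a c k. J (biK B (T (dl x a)) (T' (dl x c))) (\<lambda>p. E1 g0 p k) = g a \<cdot> (h c \<cdot> (d \<cdot> w k))"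
    and B: "\<And>a m c n. cst (L (axis ((a, m), (c, n)) 1)) = biK B (T (cst (axis (a, m) 1))) (T' (cst (axis (c, n) 1)))"
    and lin: "\<And>U. T (\<lambda>p. J x (\<lambda>j. U j p)) = (\<lambda>r. J x (\<lambda>j. T (U j) r))"
      "\<And>U. T' (\<lambda>p. J x (\<lambda>j. U j p)) = (\<lambda>r. J x (\<lambda>j. T' (U j) r))"
  shows "mon E1 V1 (linK L (linK D_comult (dl x i))) g0 ((g \<otimes> h) i \<cdot> (ga x g h \<cdot> d)) w"
proof -
  let ?F = "\<lambda>a c. I x (\<lambda>y. emb (comult_coeff y i (b a) (b c)))"
  have F: "J g (\<lambda>a. J (?F a) h) = (g \<otimes> h) i \<cdot> ga x g h"
  proof -
    have "J g (\<lambda>a. J (?F a) h) = J g (\<lambda>a. J h (?F a))"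
      by (simp add: J_def commute)
    also have "\<dots> = I g (\<lambda>a. I h (\<lambda>c. I x (\<lambda>y. emb (comult_coeff y i a c))))"
      by (simp add: I_def)
    also have "\<dots> = I x (\<lambda>y. I g (\<lambda>a. I h (\<lambda>c. emb (comult_coeff y i a c))))"
      by (simp only: I_swap[of g x] I_swap[of h x])
    also have "\<dots> = (g \<otimes> h) i \<cdot> ga x g h"
      using G at3_gamma(1)[OF G] by (simp add: emb_comult_coeff I_const_left at3_def)
    finally show ?thesis .
  qed
  have e: "J x (\<lambda>m. J x (\<lambda>n. J (cst (L (axis ((a, m), (c, n)) 1))) (\<lambda>p. E1 g0 p k)))
    = g a \<cdot> (h c \<cdot> (d \<cdot> w k))" for a c k
    unfolding f[symmetric] B
    by (simp add: av_cst lin biK_J_left biK_J_right J_J)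
  show ?thesis
    unfolding mon_def
  proof
    fix k
    have "J (linK L (linK D_comult (dl x i))) (\<lambda>p. E1 g0 p k)
      = J (\<lambda>_. \<one>) (\<lambda>a. J (?F a) (\<lambda>c. g a \<cdot> (h c \<cdot> (d \<cdot> w k))))"
      unfolding J_linK comult_homogeneous[OF G(1)] J_homogeneous2 e ..
    also have "\<dots> = J g (\<lambda>a. J (?F a) (\<lambda>c. h c \<cdot> (d \<cdot> w k)))"
      by (rule J_one_weight)
    also have "\<dots> = J g (\<lambda>a. J (?F a) h) \<cdot> (d \<cdot> w k)"
      by (simp add: J_const_right)
    finally show "J (linK L (linK D_comult (dl x i))) (\<lambda>p. E1 g0 p k) = (g \<otimes> h) i \<cdot> (ga x g h \<cdot> d) \<cdot> V1 w k"
      unfolding F by (simp only: assoc)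
  qed
qed

lemma mon_counit_scale:
  assumes x: "x \<in> points" and t: "mon E1 V1 (cst t) g c w"
  shows "mon E1 V1 (\<lambda>p. J x (\<lambda>j. cst (D_counit (axis (i, j) 1) *s t) p)) g (pone i \<cdot> c) w"
proof -
  have "counitK (dl x i) = pone i"
    using mon_dl counitK_mon[OF x] by blast
  then have "J x (\<lambda>j. emb (D_counit (axis (i, j) 1))) = pone i"
    by (simp add: emb_D_counit counitK_def J_dl cst_axis)
  then have "(\<lambda>p. J x (\<lambda>j. cst (D_counit (axis (i, j) 1) *s t) p)) = (\<lambda>p. pone i \<cdot> cst t p)"
    by (simp add: cst_scale J_const_right)
  then show ?thesis using t by (simp add: mon_def J_scale assoc)
qed

lemma cst_D_mult: "cst (D_mult u v) = biK D_mult (cst u) (cst v)"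
  by (rule cst_bil[OF vbil_D_mult])

text \<open>The two points at which the factors are evaluated are inverse to each other.\<close>

lemma D_antipode_alpha:
  "D.lift2 (*s) (D_comult u) (\<lambda>h1 h2. D_mult (D_mult (D_S h1) D_one) h2) = D_counit u *s D_one"
proof -
  let ?L = "\<lambda>t. D.lift2 (*s) t (\<lambda>h1 h2. D_mult (D_S h1) h2)"
  have 1: "?L (D_comult (axis (i, j) 1)) = D_counit (axis (i, j) 1) *s D_one" for i j
  proof (rule sep11[of "\<lambda>j. ?L (D_comult (axis (i, j) 1))"])
    fix x g assume G: "x \<in> points" "g \<in> points"
    let ?g = "cj (pinv g) (pinv x)" and ?h = "cj g (pinv x)"
    have "mon E1 V1 (linK ?L (linK D_comult (dl x i))) g ((?g \<otimes> ?h) i \<cdot> (ga x ?g ?h \<cdot> (ka g x \<cdot> th g (pinv x) x))) pone"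
    proof (rule comult_contract[where B = D_mult and T = "linK D_S" and T' = "\<lambda>U. U"])
      fix a c k
      have "mon E1 V1 (biK D_mult (linK D_S (dl x a)) (dl x c)) g ((?g a \<cdot> ka g x) \<cdot> ?h c \<cdot> th g (pinv x) x) (pinv x \<otimes> x)"
        using G by (intro mon1_mult mon_S mon_dl ginv_closed)
      then show "J (biK D_mult (linK D_S (dl x a)) (dl x c)) (\<lambda>p. E1 g p k)
          = ?g a \<cdot> (?h c \<cdot> (ka g x \<cdot> th g (pinv x) x \<cdot> pone k))"
        using G by (simp add: mon_def) (simp only: ac_simps)
    qed (use G in \<open>simp_all add: arr_lift_axis cst_D_mult cst_lin[OF vlin_D_S] linK_J\<close>)
    moreover have "?g \<otimes> ?h = pone" using G by (simp flip: gmul_cj)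
    moreover have "ga x ?g ?h \<cdot> (ka g x \<cdot> th g (pinv x) x) = \<one>"
      using ka_inverse[OF G(2,1)] by (simp only: ac_simps)
    ultimately have "mon E1 V1 (linK ?L (linK D_comult (dl x i))) g (pone i \<cdot> \<one>) pone" by simp
    moreover have "mon E1 V1 (\<lambda>p. J x (\<lambda>j. cst (D_counit (axis (i, j) 1) *s D_one) p)) g (pone i \<cdot> \<one>) pone"
      by (rule mon_counit_scale[OF G(1) mon_one[OF G(2)]])
    ultimately show "\<exists>c w. mon E1 V1 (\<lambda>p. J x (\<lambda>j. cst (?L (D_comult (axis (i, j) 1))) p)) g c w \<and>
      mon E1 V1 (\<lambda>p. J x (\<lambda>j. cst (D_counit (axis (i, j) 1) *s D_one) p)) g c w"
      unfolding av_cst linK_J cst_lin[OF vlin_D_comult] cst_lin[OF vlin_lift(1)] by blast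
  qed
  have "?L (D_comult u) = D_counit u *s D_one"
  proof (rule vlin_eqI[of "\<lambda>u. ?L (D_comult u)" "\<lambda>u. D_counit u *s D_one"])
    show "vlin (\<lambda>u. ?L (D_comult u))" by (rule vlin_comp[OF vlin_lift(1) vlin_D_comult])
    show "vlin (\<lambda>u. D_counit u *s D_one)"
      using D_counit_linear by (intro vlinI) (simp_all add: Vector_Spaces.linear_iff vec.scale_left_distrib)
  qed (use 1 in auto)
  then show ?thesis by (simp only: D_one_right)
qed

lemma D_antipode_beta:
  "D.lift2 (*s) (D_comult u) (\<lambda>h1 h2. D_mult (D_mult h1 D_beta) (D_S h2)) = D_counit u *s D_beta"
proof -
  let ?L = "\<lambda>t. D.lift2 (*s) t (\<lambda>h1 h2. D_mult (D_mult h1 D_beta) (D_S h2))"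
  have 1: "?L (D_comult (axis (i, j) 1)) = D_counit (axis (i, j) 1) *s D_beta" for i j
  proof (rule sep11[of "\<lambda>j. ?L (D_comult (axis (i, j) 1))"])
    fix x g assume G: "x \<in> points" "g \<in> points"
    let ?x = "cj g x"
    have "mon E1 V1 (linK ?L (linK D_comult (dl x i))) g
      ((g \<otimes> pinv g) i \<cdot> (ga x g (pinv g) \<cdot> (be ?x \<cdot> ka ?x x \<cdot> th g x (pinv x)))) pone"
    proof (rule comult_contract[where B = D_mult and T = "\<lambda>U. biK D_mult U (cst D_beta)" and T' = "linK D_S"])
      fix a c k
      have "mon E1 V1 (biK D_mult (dl x a) (cst D_beta)) g (g a \<cdot> be ?x \<cdot> th g x pone) (x \<otimes> pone)"
        using G by (intro mon1_mult mon_beta mon_dl gone_closed cj_closed)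
      then have b: "mon E1 V1 (biK D_mult (dl x a) (cst D_beta)) g (g a \<cdot> be ?x) x" using G by simp
      have "mon E1 V1 (linK D_S (dl x c)) ?x ((cj (pinv ?x) (pinv x)) c \<cdot> ka ?x x) (pinv x)"
        using G by (intro mon_S cj_closed)
      then have "mon E1 V1 (linK D_S (dl x c)) ?x ((pinv g) c \<cdot> ka ?x x) (pinv x)"
        using G by (simp add: ginv_cj)
      then have "mon E1 V1 (biK D_mult (biK D_mult (dl x a) (cst D_beta)) (linK D_S (dl x c))) g
        ((g a \<cdot> be ?x) \<cdot> ((pinv g) c \<cdot> ka ?x x) \<cdot> th g x (pinv x)) (x \<otimes> pinv x)"
        using G by (intro mon1_mult b) simp_all
      then show "J (biK D_mult (biK D_mult (dl x a) (cst D_beta)) (linK D_S (dl x c))) (\<lambda>p. E1 g p k)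
          = g a \<cdot> ((pinv g) c \<cdot> (be ?x \<cdot> ka ?x x \<cdot> th g x (pinv x) \<cdot> pone k))"
        using G by (simp add: mon_def) (simp only: ac_simps)
    qed (use G in \<open>simp_all add: arr_lift_axis cst_D_mult cst_lin[OF vlin_D_S] linK_J biK_J_left\<close>)
    moreover have "ga x g (pinv g) \<cdot> (be ?x \<cdot> ka ?x x \<cdot> th g x (pinv x)) = be g"
      using ka_beta[OF G(2,1)] by (simp only: ac_simps)
    ultimately have "mon E1 V1 (linK ?L (linK D_comult (dl x i))) g (pone i \<cdot> be g) pone" using G by simp
    moreover have "mon E1 V1 (\<lambda>p. J x (\<lambda>j. cst (D_counit (axis (i, j) 1) *s D_beta) p)) g (pone i \<cdot> be g) pone"
      by (rule mon_counit_scale[OF G(1) mon_beta[OF G(2)]])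
    ultimately show "\<exists>c w. mon E1 V1 (\<lambda>p. J x (\<lambda>j. cst (?L (D_comult (axis (i, j) 1))) p)) g c w \<and>
      mon E1 V1 (\<lambda>p. J x (\<lambda>j. cst (D_counit (axis (i, j) 1) *s D_beta) p)) g c w"
      unfolding av_cst linK_J cst_lin[OF vlin_D_comult] cst_lin[OF vlin_lift(1)] by blast
  qed
  show ?thesis
  proof (rule vlin_eqI[of "\<lambda>u. ?L (D_comult u)" "\<lambda>u. D_counit u *s D_beta"])
    show "vlin (\<lambda>u. ?L (D_comult u))" by (rule vlin_comp[OF vlin_lift(1) vlin_D_comult])
    show "vlin (\<lambda>u. D_counit u *s D_beta)"
      using D_counit_linear by (intro vlinI) (simp_all add: Vector_Spaces.linear_iff vec.scale_left_distrib)
  qed (use 1 in auto)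
qed

lemma cst_tri: "cst (tri f) = (\<lambda>((a, m), (c, n), (d, p)). emb (f (b a) (b c) (b d)) \<cdot> (pone m \<cdot> (pone n \<cdot> pone p)))"
  by (auto simp: cst_def tri_def emb_mult pone_def)

text \<open>The analogue of \<open>comult_contract\<close> for the reassociator.\<close>

lemma tri_contract:
  assumes f: "\<And>a c d k. J (biK B (biK B' (T (dl pone a)) (T' (dl pone c))) (T'' (dl pone d))) (\<lambda>p. E1 g p k)
      = h1 a \<cdot> (h2 c \<cdot> (h3 d \<cdot> (e \<cdot> w k)))"
    and B: "\<And>u v z. cst (L u v z) = biK B (biK B' (T (cst u)) (T' (cst v))) (T'' (cst z))"
    and lin: "\<And>U. T (\<lambda>p. J pone (\<lambda>j. U j p)) = (\<lambda>r. J pone (\<lambda>j. T (U j) r))"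
      "\<And>U. T' (\<lambda>p. J pone (\<lambda>j. U j p)) = (\<lambda>r. J pone (\<lambda>j. T' (U j) r))"
      "\<And>U. T'' (\<lambda>p. J pone (\<lambda>j. U j p)) = (\<lambda>r. J pone (\<lambda>j. T'' (U j) r))"
  shows "mon E1 V1 (cst (D.lift3 (*s) (tri t) L)) g (at3 t h1 h2 h3 \<cdot> e) w"
  unfolding mon_def
proof
  fix k
  have s: "J pone (\<lambda>m. J pone (\<lambda>n. J pone (\<lambda>p.
      J (cst (L (axis (a, m) 1) (axis (c, n) 1) (axis (d, p) 1))) (\<lambda>r. E1 g r k))))
    = h1 a \<cdot> (h2 c \<cdot> (h3 d \<cdot> (e \<cdot> w k)))" for a c d
    unfolding f[symmetric] B
    by (simp add: av_cst lin biK_J_left biK_J_right J_J)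
  have "J (cst (D.lift3 (*s) (tri t) L)) (\<lambda>r. E1 g r k)
    = J (\<lambda>_. \<one>) (\<lambda>a. J (\<lambda>_. \<one>) (\<lambda>c. J (\<lambda>d. emb (t (b a) (b c) (b d))) (\<lambda>d. h1 a \<cdot> (h2 c \<cdot> (h3 d \<cdot> (e \<cdot> w k))))))"
    unfolding cst_lin[OF vlin_lift(2)] unfolding J_linK cst_tri J_homogeneous3 arr_lift_axis s ..
  also have "\<dots> = at3 t h1 h2 h3 \<cdot> e \<cdot> V1 w k"
    by (simp add: at3_def I_def J_def sum_mul_left sum_mul_right ac_simps)
  finally show "J (cst (D.lift3 (*s) (tri t) L)) (\<lambda>r. E1 g r k) = at3 t h1 h2 h3 \<cdot> e \<cdot> V1 w k" .
qed

lemma mon_dl_one: "mon E1 V1 (dl pone a) g (g a) pone"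
  by (rule mon_dl)

lemma mon_S_one: "g \<in> points \<Longrightarrow> mon E1 V1 (linK D_S (dl pone a)) g ((pinv g) a) pone"
  using mon_S[of g pone a] by simp

lemma mon1_mult_one:
  assumes "g \<in> points" "mon E1 V1 U g c pone" "mon E1 V1 U' g d pone"
  shows "mon E1 V1 (biK D_mult U U') g (c \<cdot> d) pone"
  using mon1_mult[OF assms(1) _ _ assms(2), of pone U' d] assms by simp

lemma D_antipode_reassociator:
  "D.lift3 (*s) D_Phi (\<lambda>X1 X2 X3. D_mult (D_mult (D_mult (D_mult X1 D_beta) (D_S X2)) D_one) X3) = D_one"
proof -
  let ?L = "\<lambda>X1 X2 X3. D_mult (D_mult (D_mult X1 D_beta) (D_S X2)) X3"
  have "D.lift3 (*s) D_Phi ?L = D_one"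
  proof (rule sep01)
    fix g assume G: "g \<in> points"
    have "mon E1 V1 (cst (D.lift3 (*s) D_Phi ?L)) g (W' g (pinv g) g \<cdot> be g) pone"
    proof (rule tri_contract[where B = D_mult and B' = D_mult and T = "\<lambda>U. biK D_mult U (cst D_beta)"
          and T' = "linK D_S" and T'' = "\<lambda>U. U"])
      fix a c d k
      have "mon E1 V1 (biK D_mult (biK D_mult (biK D_mult (dl pone a) (cst D_beta)) (linK D_S (dl pone c))) (dl pone d)) g
        (g a \<cdot> be g \<cdot> (pinv g) c \<cdot> g d) pone"
        using G by (intro mon1_mult_one mon_dl_one mon_S_one mon_beta)
      then show "J (biK D_mult (biK D_mult (biK D_mult (dl pone a) (cst D_beta)) (linK D_S (dl pone c))) (dl pone d)) (\<lambda>p. E1 g p k)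
        = g a \<cdot> ((pinv g) c \<cdot> (g d \<cdot> (be g \<cdot> pone k)))"
        by (simp add: mon_def) (simp only: ac_simps)
    qed (simp_all add: cst_D_mult cst_lin[OF vlin_D_S] linK_J biK_J_left)
    then show "\<exists>c w. mon E1 V1 (cst (D.lift3 (*s) D_Phi ?L)) g c w \<and> mon E1 V1 (cst D_one) g c w"
      using mon_one[OF G] G by (simp add: be_def W'_W) blast
  qed
  then show ?thesis by (simp only: D_one_right)
qed

lemma D_antipode_reassociator_inv:
  "D.lift3 (*s) D_Psi (\<lambda>x1 x2 x3. D_mult (D_mult (D_mult (D_mult (D_S x1) D_one) x2) D_beta) (D_S x3)) = D_one"
proof -
  let ?L = "\<lambda>x1 x2 x3. D_mult (D_mult (D_S x1) (D_mult x2 D_beta)) (D_S x3)"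
  have "D.lift3 (*s) D_Psi ?L = D_one"
  proof (rule sep01)
    fix g assume G: "g \<in> points"
    have "mon E1 V1 (cst (D.lift3 (*s) D_Psi ?L)) g (W (pinv g) g (pinv g) \<cdot> be g) pone"
    proof (rule tri_contract[where B = D_mult and B' = D_mult and T' = "\<lambda>U. biK D_mult U (cst D_beta)"
          and T = "linK D_S" and T'' = "linK D_S"])
      fix a c d k
      have "mon E1 V1 (biK D_mult (biK D_mult (linK D_S (dl pone a)) (biK D_mult (dl pone c) (cst D_beta))) (linK D_S (dl pone d))) g
        ((pinv g) a \<cdot> (g c \<cdot> be g) \<cdot> (pinv g) d) pone"
        using G by (intro mon1_mult_one mon_dl_one mon_S_one mon_beta)
      then show "J (biK D_mult (biK D_mult (linK D_S (dl pone a)) (biK D_mult (dl pone c) (cst D_beta))) (linK D_S (dl pone d))) (\<lambda>p. E1 g p k)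
        = (pinv g) a \<cdot> (g c \<cdot> ((pinv g) d \<cdot> (be g \<cdot> pone k)))"
        by (simp add: mon_def) (simp only: ac_simps)
    qed (simp_all add: cst_D_mult cst_lin[OF vlin_D_S] linK_J biK_J_left)
    then show "\<exists>c w. mon E1 V1 (cst (D.lift3 (*s) D_Psi ?L)) g c w \<and> mon E1 V1 (cst D_one) g c w"
      using mon_one[OF G] G by (simp add: be_def w_inv_inv) blast
  qed
  then show ?thesis by (simp only: D_one_right D_assoc)
qed

lemma D_quasitriangular:
  "quasitriangular_quasi_hopf_algebra (*s) (\<lambda>p::'n \<times> 'n. axis p (1::'k)) D_mult D_one D_comult D_counit
     D_Phi D_Psi D_S D_one D_beta D_R"
proof (intro quasitriangular_quasi_hopf_algebra.intro quasi_hopf_algebra.intro)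
  show "quasi_bialgebra (*s) (\<lambda>p::'n \<times> 'n. axis p (1::'k)) D_mult D_one D_comult D_counit D_Phi D_Psi"
    by (rule D.quasi_bialgebra_axioms)
  show "quasi_hopf_algebra_axioms (*s) (\<lambda>p::'n \<times> 'n. axis p (1::'k)) D_mult D_one D_comult D_counit D_Phi D_Psi D_S D_one D_beta"
    by (intro quasi_hopf_algebra_axioms.intro)
       (rule vlin_linear[OF vlin_D_S] D_S_mult D_S_one D_antipode_alpha D_antipode_beta
         D_antipode_reassociator D_antipode_reassociator_inv)+
  show "quasitriangular_quasi_hopf_algebra_axioms (*s) (\<lambda>p::'n \<times> 'n. axis p (1::'k)) D_mult D_one D_comult D_counit D_Phi D_Psi D_R"
    by (intro quasitriangular_quasi_hopf_algebra_axioms.intro exI[of _ D_R'])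
       (rule D_R_invertible D_R_comult D_hexagon_left D_hexagon_right D_R_counit_left D_R_counit_right)+
qed

end

section \<open>The coordinate algebra of four generic points\<close>

text \<open>The dual algebra of a coalgebra with basis, in coordinates.  Multiplication tables are used because
  the tensor powers of the coalgebra have different index types.\<close>

definition amul :: "('p::finite \<Rightarrow> 'p \<Rightarrow> 'p \<Rightarrow> 'k::field) \<Rightarrow> 'k ^ 'p \<Rightarrow> 'k ^ 'p \<Rightarrow> 'k ^ 'p" where
  "amul m u v = (\<chi> l. \<Sum>i\<in>UNIV. \<Sum>j\<in>UNIV. m i j l * (u $ i * v $ j))"

definition structure_constants :: "('p::finite \<Rightarrow> 'p \<Rightarrow> 'p \<Rightarrow> 'k::field) \<Rightarrow> ('p \<Rightarrow> 'k) \<Rightarrow> bool" where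
  "structure_constants m e \<longleftrightarrow> (\<forall>i j l. m i j l = m j i l) \<and>
     (\<forall>i j k l. (\<Sum>s\<in>UNIV. m i j s * m s k l) = (\<Sum>s\<in>UNIV. m j k s * m i s l)) \<and>
     (\<forall>j l. (\<Sum>i\<in>UNIV. e i * m i j l) = (if j = l then 1 else 0))"

lemma structure_constantsD:
  assumes "structure_constants m e"
  shows "m i j l = m j i l"
    and "(\<Sum>s\<in>UNIV. m i j s * m s k l) = (\<Sum>s\<in>UNIV. m j k s * m i s l)"
    and "(\<Sum>i\<in>UNIV. e i * m i j l) = (if j = l then 1 else 0)"
  using assms unfolding structure_constants_def by blast+

lemma amul_axis: "amul m (axis i 1) (axis j 1) = (\<chi> l. m i j l)"
proof -
  have "(\<Sum>p\<in>UNIV. \<Sum>q\<in>UNIV. m p q l * (axis i 1 $ p * axis j 1 $ q)) = m i j l" for l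
  proof -
    have "(\<Sum>p\<in>UNIV. \<Sum>q\<in>UNIV. m p q l * (axis i 1 $ p * axis j 1 $ q)) =
      (\<Sum>p\<in>UNIV. \<Sum>q\<in>UNIV. if p = i then (if q = j then m p q l else 0) else 0)"
      by (intro sum.cong refl) (auto simp: axis_def)
    then show ?thesis by (simp add: sum.If_cases)
  qed
  then show ?thesis by (simp add: amul_def vec_eq_iff)
qed

lemma vbil_amul: "vbil (amul m)"
  unfolding vbil_def by (simp add: amul_axis) (simp add: amul_def ac_simps)

lemmas amul_scale = vlin_scale[OF vbil_vlin(1)[OF vbil_amul]] vlin_scale[OF vbil_vlin(2)[OF vbil_amul]]

lemma amul_commute:
  assumes "structure_constants m e"
  shows "amul m u v = amul m v u"
proof (rule vbil_eqI[of "amul m" "\<lambda>u v. amul m v u"])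
  show "vbil (\<lambda>u v. amul m v u)" by (intro vbilI vbil_vlin[OF vbil_amul])
  show "amul m (axis p 1) (axis q 1) = amul m (axis q 1) (axis p 1)" for p q
    by (simp add: amul_axis vec_eq_iff structure_constantsD(1)[OF assms, of p q])
qed (rule vbil_amul)

lemma amul_unit:
  assumes "structure_constants m e"
  shows "amul m (\<chi> l. e l) u = u"
proof (rule vlin_eqI[of "amul m (\<chi> l. e l)" "\<lambda>u. u"])
  show "amul m (\<chi> l. e l) (axis j 1) = axis j 1" for j
    by (simp add: vec_eq_iff vlinD[OF vbil_vlin(2)[OF vbil_amul]] amul_axis
        structure_constantsD(3)[OF assms]) (simp add: axis_def eq_commute)
qed (rule vbil_vlin[OF vbil_amul] vlinI; simp)+

lemma amul_assoc:
  assumes "structure_constants m e"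
  shows "amul m (amul m u v) w = amul m u (amul m v w)"
proof (rule vbil_assocI[OF vbil_amul])
  have 1: "amul m c (axis k 1) $ l = (\<Sum>s\<in>UNIV. c $ s * m s k l)" for c k l
    using vlinD[OF vbil_vlin(2)[OF vbil_amul, where v = "axis k 1"], of m c l] by (simp add: amul_axis)
  have 2: "amul m (axis i 1) c $ l = (\<Sum>s\<in>UNIV. c $ s * m i s l)" for c i l
    using vlinD[OF vbil_vlin(1)[OF vbil_amul, where u = "axis i 1"], of m c l] by (simp add: amul_axis)
  show "amul m (amul m (axis i 1) (axis j 1)) (axis k 1) = amul m (axis i 1) (amul m (axis j 1) (axis k 1))" for i j k
    unfolding vec_eq_iff
    by (intro allI) (simp only: 1 2 amul_axis vec_lambda_beta structure_constantsD(2)[OF assms, of i j])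
qed

lemma structure_constants_comm_alg:
  assumes s: "structure_constants m e"
  shows "comm_alg (amul m) (\<chi> l. e l) (\<lambda>r. r *s (\<chi> l. e l))"
proof
  show "amul m (amul m u v) w = amul m u (amul m v w)" for u v w by (rule amul_assoc[OF s])
  show "amul m u v = amul m v u" for u v by (rule amul_commute[OF s])
  show "amul m u (\<chi> l. e l) = u" for u
    unfolding amul_commute[OF s, of u] by (rule amul_unit[OF s])
  show "amul m (u + v) w = amul m u w + amul m v w" for u v w
    by (simp add: amul_def vec_eq_iff algebra_simps sum.distrib)
  show "(r + r') *s (\<chi> l. e l) = r *s (\<chi> l. e l) + r' *s (\<chi> l. e l)" for r r'
    by (rule vec.scale_left_distrib)
  show "(r * r') *s (\<chi> l. e l) = amul m (r *s (\<chi> l. e l)) (r' *s (\<chi> l. e l))" for r r'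
    by (simp add: amul_scale amul_unit[OF s] mult.commute)
  show "1 *s (\<chi> l. e l) = (\<chi> l. e l)" by simp
qed

definition tensor_constants where
  "tensor_constants m m' = (\<lambda>(i, i') (j, j') (l, l'). m i j l * m' i' j' l')"

lemma sum_product_pair:
  fixes f :: "'p::finite \<Rightarrow> 'k::field" and g :: "'q::finite \<Rightarrow> 'k"
  shows "(\<Sum>s\<in>UNIV. case s of (p, q) \<Rightarrow> f p * g q) = sum f UNIV * sum g UNIV"
  unfolding sum_UNIV_pair by (simp add: sum_product)

lemma tensor_structure_constants:
  fixes m :: "'p::finite \<Rightarrow> 'p \<Rightarrow> 'p \<Rightarrow> 'k::field" and m' :: "'q::finite \<Rightarrow> 'q \<Rightarrow> 'q \<Rightarrow> 'k"
  assumes "structure_constants m e" "structure_constants m' e'"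
  shows "structure_constants (tensor_constants m m') (\<lambda>(i, i'). e i * e' i')"
  unfolding structure_constants_def
proof (intro conjI allI)
  fix i j k l :: "'p \<times> 'q"
  obtain i1 i2 j1 j2 k1 k2 l1 l2 where p: "i = (i1, i2)" "j = (j1, j2)" "k = (k1, k2)" "l = (l1, l2)"
    by (metis surj_pair)
  show "tensor_constants m m' i j l = tensor_constants m m' j i l"
    by (simp add: p tensor_constants_def structure_constantsD(1)[OF assms(1), of i1]
        structure_constantsD(1)[OF assms(2), of i2])
  have "(\<Sum>s\<in>UNIV. tensor_constants m m' i j s * tensor_constants m m' s k l)
    = (\<Sum>s\<in>UNIV. case s of (s1, s2) \<Rightarrow> (m i1 j1 s1 * m s1 k1 l1) * (m' i2 j2 s2 * m' s2 k2 l2))"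
    by (rule sum.cong) (auto simp: p tensor_constants_def)
  also have "\<dots> = (\<Sum>s\<in>UNIV. case s of (s1, s2) \<Rightarrow> (m j1 k1 s1 * m i1 s1 l1) * (m' j2 k2 s2 * m' i2 s2 l2))"
    by (simp only: sum_product_pair structure_constantsD(2)[OF assms(1)] structure_constantsD(2)[OF assms(2)])
  also have "\<dots> = (\<Sum>s\<in>UNIV. tensor_constants m m' j k s * tensor_constants m m' i s l)"
    by (rule sum.cong) (auto simp: p tensor_constants_def)
  finally show "(\<Sum>s\<in>UNIV. tensor_constants m m' i j s * tensor_constants m m' s k l)
    = (\<Sum>s\<in>UNIV. tensor_constants m m' j k s * tensor_constants m m' i s l)" .
  have "(\<Sum>i\<in>UNIV. (case i of (i, i') \<Rightarrow> e i * e' i') * tensor_constants m m' i j l)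
    = (\<Sum>s\<in>UNIV. case s of (s1, s2) \<Rightarrow> (e s1 * m s1 j1 l1) * (e' s2 * m' s2 j2 l2))"
    by (rule sum.cong) (auto simp: p tensor_constants_def)
  also have "\<dots> = (if j = l then 1 else 0)"
    by (simp add: sum_product_pair structure_constantsD(3)[OF assms(1)] structure_constantsD(3)[OF assms(2)] p)
  finally show "(\<Sum>i\<in>UNIV. (case i of (i, i') \<Rightarrow> e i * e' i') * tensor_constants m m' i j l)
    = (if j = l then 1 else 0)" .
qed

lemma amul_tens: "amul (tensor_constants m m') (tens u v) (tens u' v') = tens (amul m u u') (amul m' v v')"
proof -
  have "amul (tensor_constants m m') (tens u v) (tens u' v') $ (l, l') =
    (\<Sum>i\<in>UNIV. \<Sum>i'\<in>UNIV. \<Sum>j\<in>UNIV. \<Sum>j'\<in>UNIV.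
      (m i j l * (u $ i * u' $ j)) * (m' i' j' l' * (v $ i' * v' $ j')))" for l l'
    by (simp add: amul_def sum_UNIV_pair tensor_constants_def tens_def ac_simps)
  also have "\<dots> l l' = (\<Sum>i\<in>UNIV. \<Sum>j\<in>UNIV. \<Sum>i'\<in>UNIV. \<Sum>j'\<in>UNIV.
      (m i j l * (u $ i * u' $ j)) * (m' i' j' l' * (v $ i' * v' $ j')))" for l l'
    by (rule sum.cong[OF refl], rule sum.swap)
  also have "\<dots> l l' = amul m u u' $ l * amul m' v v' $ l'" for l l'
    by (simp only: sum_distrib_left[symmetric] sum_distrib_right[symmetric] amul_def vec_lambda_beta)
  finally show ?thesis by (simp add: vec_eq_iff tens_def)
qed

context cocommutative_hopf_algebra begin

lemma comult_component_commute: "\<Delta> x $ (i, j) = \<Delta> x $ (j, i)"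
proof -
  have "\<Delta> x $ (i, j) = lift2 (*s) (\<Delta> x) (\<lambda>x1 x2. tensor2 x2 x1) $ (i, j)"
    by (simp add: cocommutative)
  also have "\<dots> = (\<Sum>p\<in>UNIV. \<Sum>q\<in>UNIV. if p = j then (if q = i then \<Delta> x $ (p, q) else 0) else 0)"
    unfolding lift2_def sum_UNIV_pair
    by (simp add: tensor2_def coord_b) (intro sum.cong refl, auto)
  also have "\<dots> = \<Delta> x $ (j, i)"
    by (simp add: sum.If_cases)
  finally show ?thesis .
qed

text \<open>Coassociativity, cocommutativity and the counit law of \<open>H\<close>, in coordinates.\<close>

lemma comult_structure_constants:
  "structure_constants (\<lambda>i j l. \<Delta> (b l) $ (i, j)) (\<lambda>l. \<epsilon> (b l))"
  unfolding structure_constants_def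
proof (intro conjI allI)
  fix i j k l
  show "\<Delta> (b l) $ (i, j) = \<Delta> (b l) $ (j, i)" by (rule comult_component_commute)
  have "lift2 (*s) (\<Delta> x) (\<lambda>x1 y. lift2 (*s) (\<Delta> y) (\<lambda>x2 x3. tensor3 x1 x2 x3)) $ (i, j, k)
    = (\<Sum>s\<in>UNIV. \<Delta> x $ (i, s) * \<Delta> (b s) $ (j, k))" for x
  proof -
    have d: "(\<Sum>q\<in>UNIV. \<Sum>r\<in>UNIV. c * (f q r * (e * (if j = q then 1 else 0) * (if k = r then 1 else 0))))
        = c * (f j k * e)"
      for c e and f :: "'n \<Rightarrow> 'n \<Rightarrow> 'k"
    proof -
      have "(\<Sum>q\<in>UNIV. \<Sum>r\<in>UNIV. c * (f q r * (e * (if j = q then 1 else 0) * (if k = r then 1 else 0)))) =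
        (\<Sum>q\<in>UNIV. \<Sum>r\<in>UNIV. if r = k then (if q = j then c * (f q r * e) else 0) else 0)"
        by (intro sum.cong refl) auto
      then show ?thesis by simp
    qed
    have d': "(\<Sum>p\<in>UNIV. c p * (e * (if i = p then 1 else 0))) = c i * e" for c :: "'n \<Rightarrow> 'k" and e
    proof -
      have "(\<Sum>p\<in>UNIV. c p * (e * (if i = p then 1 else 0))) = (\<Sum>p\<in>UNIV. if p = i then c p * e else 0)"
        by (intro sum.cong refl) auto
      then show ?thesis by simp
    qed
    have "lift2 (*s) (\<Delta> x) (\<lambda>x1 y. lift2 (*s) (\<Delta> y) (\<lambda>x2 x3. tensor3 x1 x2 x3)) $ (i, j, k)
      = (\<Sum>p\<in>UNIV. \<Sum>s\<in>UNIV. \<Delta> x $ (p, s) * (\<Delta> (b s) $ (j, k) * (if i = p then 1 else 0)))"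
      unfolding lift2_def sum_UNIV_pair by (simp add: tensor3_def coord_b sum_distrib_left d)
    also have "\<dots> = (\<Sum>s\<in>UNIV. \<Sum>p\<in>UNIV. \<Delta> x $ (p, s) * (\<Delta> (b s) $ (j, k) * (if i = p then 1 else 0)))"
      by (rule sum.swap)
    finally show ?thesis by (simp only: d')
  qed
  moreover have "lift2 (*s) (\<Delta> x) (\<lambda>y x3. lift2 (*s) (\<Delta> y) (\<lambda>x1 x2. tensor3 x1 x2 x3)) $ (i, j, k)
    = (\<Sum>s\<in>UNIV. \<Delta> x $ (s, k) * \<Delta> (b s) $ (i, j))" for x
  proof -
    have d: "(\<Sum>r\<in>UNIV. \<Sum>p\<in>UNIV. \<Sum>q\<in>UNIV. c r * (f p q *
        ((if i = p then 1 else 0) * (if j = q then 1 else 0) * (if k = r then 1 else 0)))) = c k * f i j"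
      for c and f :: "'n \<Rightarrow> 'n \<Rightarrow> 'k"
    proof -
      have "(\<Sum>r\<in>UNIV. \<Sum>p\<in>UNIV. \<Sum>q\<in>UNIV. c r * (f p q *
        ((if i = p then 1 else 0) * (if j = q then 1 else 0) * (if k = r then 1 else 0)))) =
        (\<Sum>r\<in>UNIV. \<Sum>p\<in>UNIV. \<Sum>q\<in>UNIV.
          if q = j then (if p = i then (if r = k then c r * f p q else 0) else 0) else 0)"
        by (intro sum.cong refl) auto
      then show ?thesis by simp
    qed
    show ?thesis
      unfolding lift2_def sum_UNIV_pair by (simp add: tensor3_def coord_b sum_distrib_left d)
  qed
  ultimately have "(\<Sum>s\<in>UNIV. \<Delta> (b l) $ (s, k) * \<Delta> (b s) $ (i, j)) = (\<Sum>s\<in>UNIV. \<Delta> (b l) $ (i, s) * \<Delta> (b s) $ (j, k))"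
    using coassoc by metis
  then show "(\<Sum>s\<in>UNIV. \<Delta> (b s) $ (i, j) * \<Delta> (b l) $ (s, k)) = (\<Sum>s\<in>UNIV. \<Delta> (b s) $ (j, k) * \<Delta> (b l) $ (i, s))"
    by (simp add: mult.commute)
  have "coord j (lift2 scale (\<Delta> x) (\<lambda>x1 x2. scale (\<epsilon> x1) x2)) = (\<Sum>i\<in>UNIV. \<epsilon> (b i) * \<Delta> x $ (i, j))" for x
  proof -
    have add: "coord j (x + y) = coord j x + coord j y" and scl: "coord j (scale c x) = c * coord j x" for x y c
      by (simp_all add: coord_def representation_add representation_scale independent_Basis span_Basis)
    have z: "coord j 0 = 0" using scl[of 0 0] by simp
    have s: "coord j (sum f A) = (\<Sum>a\<in>A. coord j (f a))" for f :: "'n \<Rightarrow> 'a" and A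
      by (induction A rule: infinite_finite_induct) (simp_all add: add z)
    have "coord j (lift2 scale (\<Delta> x) (\<lambda>x1 x2. scale (\<epsilon> x1) x2))
      = (\<Sum>p\<in>UNIV. \<Sum>q\<in>UNIV. \<Delta> x $ (p, q) * \<epsilon> (b p) * coord j (b q))"
      unfolding lift2_def sum_UNIV_pair by (simp add: s scl)
    also have "\<dots> = (\<Sum>p\<in>UNIV. \<Sum>q\<in>UNIV. if q = j then \<epsilon> (b p) * \<Delta> x $ (p, q) else 0)"
      by (intro sum.cong refl) (auto simp: coord_b)
    finally show ?thesis by simp
  qed
  then show "(\<Sum>i\<in>UNIV. \<epsilon> (b i) * \<Delta> (b l) $ (i, j)) = (if j = l then 1 else 0)"
    unfolding counit_left by (metis coord_b)
qed

end

lemma sum_scale_tens: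
  fixes u :: "'p::finite \<Rightarrow> 'k::field" and f :: "'q::finite \<Rightarrow> 'k"
    and F G :: "'q \<Rightarrow> 'k ^ 't::finite"
  shows "(\<Sum>l\<in>UNIV. u l *s axis l 1) = (\<chi> l. u l)"
    "(\<Sum>l\<in>UNIV. f l *s tens (F l) v) = tens (\<Sum>l\<in>UNIV. f l *s F l) (v :: 'k ^ 'r::finite)"
    "(\<Sum>l\<in>UNIV. f l *s tens w (G l)) = tens (w :: 'k ^ 's::finite) (\<Sum>l\<in>UNIV. f l *s G l)"
  using basis_expansion[of "\<chi> l. u l"]
  by (simp_all add: vec_eq_iff tens_def sum_distrib_left sum_distrib_right ac_simps)

context normalized_3cocycle begin

text \<open>Take for \<open>K\<close> the algebra dual to the coalgebra \<open>H \<otimes> H \<otimes> H \<otimes> H\<close>, the coordinate ring of \<open>G\<^sup>4\<close>, and for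
  the generic points the four projections: the \<open>i\<close>-th coordinate of the \<open>r\<close>-th one is \<open>coord i\<close> in the
  \<open>r\<close>-th tensor factor.  Products of one coordinate of each are then the elements of the dual basis.\<close>

lemma ex_generic_points:
  "\<exists>mul (unit :: 'k ^ (('n \<times> 'n) \<times> ('n \<times> 'n))) emb \<xi>1 \<xi>2 \<xi>3 \<xi>4.
    generic_points scale b mult one \<Delta> \<epsilon> S \<omega> mul unit emb \<xi>1 \<xi>2 \<xi>3 \<xi>4"
proof -
  let ?m = "\<lambda>i j l. \<Delta> (b l) $ (i, j)" and ?e = "\<lambda>l. \<epsilon> (b l)"
  let ?m2 = "tensor_constants ?m ?m" and ?e2 = "\<lambda>(i, j). ?e i * ?e j"
  let ?m4 = "tensor_constants ?m2 ?m2" and ?e4 = "\<lambda>(i, j). ?e2 i * ?e2 j"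
  define o1 where "o1 = (\<chi> l. ?e l)"
  define o2 where "o2 = (\<chi> l. ?e2 l)"
  define o4 where "o4 = (\<chi> l. ?e4 l)"
  note s1 = comult_structure_constants
  note s2 = tensor_structure_constants[OF s1 s1]
  note s4 = tensor_structure_constants[OF s2 s2]
  have o: "o2 = tens o1 o1" "o4 = tens o2 o2"
    by (auto simp: o1_def o2_def o4_def tens_def vec_eq_iff)
  have u1: "amul ?m o1 u = u" "amul ?m u o1 = u" for u
    using amul_unit[OF s1, of u] amul_commute[OF s1, of u o1] by (simp_all add: o1_def)
  have u2: "amul ?m2 o2 u = u" "amul ?m2 u o2 = u" for u
    using amul_unit[OF s2, of u] amul_commute[OF s2, of u o2] by (simp_all add: o2_def)
  have u4: "amul ?m4 o4 u = u" "amul ?m4 u o4 = u" for u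
    using amul_unit[OF s4, of u] amul_commute[OF s4, of u o4] by (simp_all add: o4_def)
  interpret K: comm_alg "amul ?m4" o4 "\<lambda>r. r *s o4"
    unfolding o4_def by (rule structure_constants_comm_alg[OF s4])
  interpret K: hopf_points scale b mult one \<Delta> \<epsilon> S "amul ?m4" o4 "\<lambda>r. r *s o4"
    by unfold_locales
  define \<xi>1 where "\<xi>1 i = tens (tens (axis i 1) o1) o2" for i :: 'n
  define \<xi>2 where "\<xi>2 i = tens (tens o1 (axis i 1)) o2" for i :: 'n
  define \<xi>3 where "\<xi>3 i = tens o2 (tens (axis i 1) o1)" for i :: 'n
  define \<xi>4 where "\<xi>4 i = tens o2 (tens o1 (axis i 1))" for i :: 'n
  have pt: "\<xi> \<in> K.points" if "\<And>i j. (\<Sum>l\<in>UNIV. ?m i j l *s \<xi> l) = amul ?m4 (\<xi> i) (\<xi> j)"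
    "(\<Sum>l\<in>UNIV. ?e l *s \<xi> l) = o4" for \<xi>
    unfolding K.points_def
  proof (intro CollectI conjI allI)
    fix F
    have "K.I \<xi> (\<lambda>a. K.swK a F) = (\<Sum>l\<in>UNIV. \<Sum>i\<in>UNIV. \<Sum>j\<in>UNIV. ?m i j l *s amul ?m4 (\<xi> l) (F (b i) (b j)))"
      by (simp add: K.I_def K.J_def K.swK_def K.sum_mul_left amul_scale u4)
    also have "\<dots> = (\<Sum>i\<in>UNIV. \<Sum>j\<in>UNIV. \<Sum>l\<in>UNIV. ?m i j l *s amul ?m4 (\<xi> l) (F (b i) (b j)))"
      by (subst sum.swap, rule sum.cong[OF refl], rule sum.swap)
    also have "\<dots> = (\<Sum>i\<in>UNIV. \<Sum>j\<in>UNIV. amul ?m4 (\<Sum>l\<in>UNIV. ?m i j l *s \<xi> l) (F (b i) (b j)))"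
      by (simp add: K.sum_mul_right amul_scale)
    finally have "K.I \<xi> (\<lambda>a. K.swK a F) =
        (\<Sum>i\<in>UNIV. \<Sum>j\<in>UNIV. amul ?m4 (\<Sum>l\<in>UNIV. ?m i j l *s \<xi> l) (F (b i) (b j)))" .
    then show "K.I \<xi> (\<lambda>a. K.swK a F) = K.I \<xi> (\<lambda>u. K.I \<xi> (F u))"
      by (simp add: that K.I_def K.J_def K.sum_mul_left K.assoc)
    show "K.I \<xi> (\<lambda>a. \<epsilon> a *s o4) = o4"
      using that(2) by (simp add: K.I_def K.J_def amul_scale u4)
  qed
  have c: "(\<Sum>l\<in>UNIV. ?m i j l *s \<xi>1 l) = amul ?m4 (\<xi>1 i) (\<xi>1 j)"
    "(\<Sum>l\<in>UNIV. ?m i j l *s \<xi>2 l) = amul ?m4 (\<xi>2 i) (\<xi>2 j)"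
    "(\<Sum>l\<in>UNIV. ?m i j l *s \<xi>3 l) = amul ?m4 (\<xi>3 i) (\<xi>3 j)"
    "(\<Sum>l\<in>UNIV. ?m i j l *s \<xi>4 l) = amul ?m4 (\<xi>4 i) (\<xi>4 j)" for i j
    by (simp_all add: \<xi>1_def \<xi>2_def \<xi>3_def \<xi>4_def sum_scale_tens amul_tens u1 u2 amul_axis)
  have e: "(\<Sum>l\<in>UNIV. ?e l *s \<xi>1 l) = o4" "(\<Sum>l\<in>UNIV. ?e l *s \<xi>2 l) = o4"
    "(\<Sum>l\<in>UNIV. ?e l *s \<xi>3 l) = o4" "(\<Sum>l\<in>UNIV. ?e l *s \<xi>4 l) = o4"
    by (simp_all add: \<xi>1_def \<xi>2_def \<xi>3_def \<xi>4_def sum_scale_tens o flip: o1_def)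
  have x: "amul ?m4 (\<xi>1 i) (amul ?m4 (\<xi>2 j) (amul ?m4 (\<xi>3 l) (\<xi>4 m))) = axis ((i, j), (l, m)) 1" for i j l m
    by (simp add: \<xi>1_def \<xi>2_def \<xi>3_def \<xi>4_def amul_tens u1 u2 tens_axis)
  have J: "K.J \<xi>1 (\<lambda>i. K.J \<xi>2 (\<lambda>j. K.J \<xi>3 (\<lambda>l. K.J \<xi>4 (\<lambda>m. f i j l m *s o4)))) =
      (\<chi> r. case r of ((i, j), (l, m)) \<Rightarrow> f i j l m)" for f
  proof -
    have "K.J \<xi>1 (\<lambda>i. K.J \<xi>2 (\<lambda>j. K.J \<xi>3 (\<lambda>l. K.J \<xi>4 (\<lambda>m. f i j l m *s o4)))) =
      (\<Sum>r\<in>UNIV. (case r of ((i, j), (l, m)) \<Rightarrow> f i j l m) *s axis r 1)"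
      by (simp add: K.J_def K.sum_mul_left amul_scale u4 x sum_UNIV_pair)
    then show ?thesis by (simp only: sum_scale_tens(1))
  qed
  have "generic_points scale b mult one \<Delta> \<epsilon> S \<omega> (amul ?m4) o4 (\<lambda>r. r *s o4) \<xi>1 \<xi>2 \<xi>3 \<xi>4"
  proof (intro generic_points.intro generic_points_axioms.intro)
    show "normalized_3cocycle scale b mult one \<Delta> \<epsilon> S \<omega>" by (rule normalized_3cocycle_axioms)
    show "hopf_points scale b mult one \<Delta> \<epsilon> S (amul ?m4) o4 (\<lambda>r. r *s o4)" by (rule K.hopf_points_axioms)
    show "\<xi>1 \<in> K.points" "\<xi>2 \<in> K.points" "\<xi>3 \<in> K.points" "\<xi>4 \<in> K.points"
      by (rule pt; rule c e)+
    fix f f' i j l m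
    assume "K.J \<xi>1 (\<lambda>i. K.J \<xi>2 (\<lambda>j. K.J \<xi>3 (\<lambda>l. K.J \<xi>4 (\<lambda>m. f i j l m *s o4)))) =
      K.J \<xi>1 (\<lambda>i. K.J \<xi>2 (\<lambda>j. K.J \<xi>3 (\<lambda>l. K.J \<xi>4 (\<lambda>m. f' i j l m *s o4))))"
    then have "(\<chi> r. case r of ((i, j), (l, m)) \<Rightarrow> f i j l m) $ ((i, j), (l, m)) =
        (\<chi> r. case r of ((i, j), (l, m)) \<Rightarrow> f' i j l m) $ ((i, j), (l, m))"
      unfolding J by simp
    then show "f i j l m = f' i j l m" by simp
  qed
  then show ?thesis by blast
qed

end

section \<open>The theorem\<close>

theorem theorem4p2:
  fixes scale :: "'k::field \<Rightarrow> 'h::ab_group_add \<Rightarrow> 'h"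
    and b :: "'n::finite \<Rightarrow> 'h"
    and mult :: "'h \<Rightarrow> 'h \<Rightarrow> 'h" and one :: 'h
    and \<Delta> :: "'h \<Rightarrow> 'k ^ ('n \<times> 'n)" and \<epsilon> :: "'h \<Rightarrow> 'k" and S :: "'h \<Rightarrow> 'h"
    and \<omega> :: "'h \<Rightarrow> 'h \<Rightarrow> 'h \<Rightarrow> 'k"
  assumes "cocommutative_hopf_algebra scale b mult one \<Delta> \<epsilon> S"
    and "normalized_3cocycle scale b mult one \<Delta> \<epsilon> S \<omega>"
  shows "\<exists>\<Delta>\<^sub>D \<epsilon>\<^sub>D \<Phi> \<Psi> S\<^sub>D \<alpha> \<beta> R.
    quasitriangular_quasi_hopf_algebra (*s) (\<lambda>p. axis p 1)
      (normalized_3cocycle.D_mult scale b mult \<Delta> \<epsilon> S \<omega>)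
      (normalized_3cocycle.D_one scale b one \<epsilon>)
      \<Delta>\<^sub>D \<epsilon>\<^sub>D \<Phi> \<Psi> S\<^sub>D \<alpha> \<beta> R"
proof -
  obtain mul unit emb \<xi>1 \<xi>2 \<xi>3 \<xi>4
    where "generic_points scale b mult one \<Delta> \<epsilon> S \<omega> mul (unit :: 'k ^ (('n \<times> 'n) \<times> ('n \<times> 'n))) emb \<xi>1 \<xi>2 \<xi>3 \<xi>4"
    using normalized_3cocycle.ex_generic_points[OF assms(2)] by blast
  from generic_points.D_quasitriangular[OF this] show ?thesis by blast
qed

end
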